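(* Let $L$ be a finite simplicial complex on vertex set $\mathsf{V}$ with $|\mathsf{V}|>1$, and let $G_L=\pi_1(T_L)$ be the associated right-angled Artin group. Let $\chi\colon G_L\twoheadrightarrow\mathbb{Z}$ be an epimorphism, $N_\chi=\ker(\chi)$, and $\iota\colon N_\chi\hookrightarrow G_L$ the inclusion map. (i) Suppose $H_1(N_\chi,\mathbb{Q})$ has trivial $\mathbb{Q}\mathbb{Z}$-action, and let $\Bbbk$ be an algebraically closed field. Then the induced homomorphism $\iota^*\colon\mathrm{Hom}(G_L,\Bbbk^\times)\to\mathrm{Hom}(N_\chi,\Bbbk^\times)$ restricts to a surjection $\iota^*\colon\mathcal{V}^1_1(G_L,\Bbbk)\twoheadrightarrow\mathcal{V}^1_1(N_\chi,\Bbbk)$. (ii) Suppose $H_i(N_\chi,\mathbb{Q})$ has trivial $\mathbb{Q}\mathbb{Z}$-action, for $i=1,2$. Then the induced homomorphism $\iota^*\colon\mathrm{Hom}(G_L,\mathbb{C})\to\mathrm{Hom}(N_\chi,\mathbb{C})$ restricts to a surjection $\iota^*\colon\mathcal{R}^1_1(G_L,\mathbb{C})\twoheadrightarrow\mathcal{R}^1_1(N_\chi,\mathbb{C})$.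
   Context: $G_L$ is the group with a generator $v$ for each vertex $v\in\mathsf{V}$ and a relation $vw=wv$ for each edge $\{v,w\}$ of $L$; it is the fundamental group of the toric complex $T_L$ (the subcomplex of the torus $(S^1)^{\mathsf{V}}$, with standard cells indexed by subsets of $\mathsf{V}$, obtained by deleting cells corresponding to non-faces of $L$). $\mathbb{Q}\mathbb{Z}$ is the group ring of $\mathbb{Z}=G_L/N_\chi$, which acts on $H_*(N_\chi,\mathbb{Q})$ through the conjugation action of $G_L$ on $N_\chi$. If $H_1(N_\chi,\mathbb{Q})$ has trivial $\mathbb{Q}\mathbb{Z}$-action, it is known that $N_\chi$ is finitely generated. For a finitely generated group $G$: $\mathcal{V}^1_1(G,\Bbbk)=\{\rho\in\mathrm{Hom}(G,\Bbbk^\times)\mid H_1(G,\Bbbk_\rho)\ne0\}$, with $\Bbbk_\rho$ the field $\Bbbk$ with $G$ acting through $\rho$; and $\mathcal{R}^1_1(G,\mathbb{C})=\{a\in A^1\mid H^1(A,\cdot a)\ne0\}$, where $A=H^*(G,\mathbb{C})$ and $(A,\cdot a)$ is the cochain complex with differential multiplication by $a$. *)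

theory Defs
  imports
    "HOL-Algebra.Algebra"
    "HOL-Library.Poly_Mapping"
    "HOL-Library.Function_Algebras"
    "HOL-Computational_Algebra.Polynomial"
    Complex_Main
begin

section \<open>Group presentations and right-angled Artin groups\<close>

text \<open>
  A word is a list of pairs \<open>(s, e)\<close>, where \<open>(s, True)\<close> stands for the generator \<open>s\<close> and
  \<open>(s, False)\<close> for its inverse.  A relation \<open>(r, r') \<in> R\<close> is read as \<open>r = r'\<close>.
\<close>

type_synonym 's word = "('s \<times> bool) list"

inductive pres_eq :: "'s set \<Rightarrow> ('s word \<times> 's word) set \<Rightarrow> 's word \<Rightarrow> 's word \<Rightarrow> bool"
  for S :: "'s set" and R :: "('s word \<times> 's word) set" where
  refl: "pres_eq S R w w"
| sym: "pres_eq S R w w' \<Longrightarrow> pres_eq S R w' w"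
| trans: "pres_eq S R w w' \<Longrightarrow> pres_eq S R w' w'' \<Longrightarrow> pres_eq S R w w''"
| cancel: "s \<in> S \<Longrightarrow> pres_eq S R (u @ [(s, e), (s, \<not> e)] @ v) (u @ v)"
| relation: "(r, r') \<in> R \<Longrightarrow> pres_eq S R (u @ r @ v) (u @ r' @ v)"

definition pres_words :: "'s set \<Rightarrow> 's word set" where
  "pres_words S = lists (S \<times> UNIV)"

definition pres_class :: "'s set \<Rightarrow> ('s word \<times> 's word) set \<Rightarrow> 's word \<Rightarrow> 's word set" where
  "pres_class S R w = {w' \<in> pres_words S. pres_eq S R w w'}"

definition presented_group :: "'s set \<Rightarrow> ('s word \<times> 's word) set \<Rightarrow> 's word set monoid" where
  "presented_group S R =
     \<lparr>carrier = pres_class S R ` pres_words S,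
      monoid.mult = (\<lambda>A B. \<Union>a\<in>A. \<Union>b\<in>B. pres_class S R (a @ b)),
      one = pres_class S R []\<rparr>"

text \<open>The vertex set of \<open>L\<close> is all of \<open>V\<close>: there are no ghost vertices.\<close>

definition finite_simplicial_complex_on :: "'v set set \<Rightarrow> 'v set \<Rightarrow> bool" where
  "finite_simplicial_complex_on L V \<longleftrightarrow>
     finite V \<and> L \<subseteq> Pow V \<and> (\<forall>v\<in>V. {v} \<in> L) \<and> (\<forall>\<sigma>\<in>L. \<forall>\<tau>. \<tau> \<subseteq> \<sigma> \<longrightarrow> \<tau> \<in> L)"

definition raag :: "'v set \<Rightarrow> 'v set set \<Rightarrow> 'v word set monoid" where
  "raag V L = presented_group V
     {([(v, True), (w, True)], [(w, True), (v, True)]) | v w. v \<noteq> w \<and> {v, w} \<in> L}"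


section \<open>Group homology\<close>

definition additive_group :: "'m::ab_group_add set \<Rightarrow> 'm monoid" where
  "additive_group S = \<lparr>carrier = S, monoid.mult = (+), one = 0\<rparr>"

definition group_tuples :: "('a, 'b) monoid_scheme \<Rightarrow> nat \<Rightarrow> 'a list set" where
  "group_tuples G n = {xs. length xs = n \<and> set xs \<subseteq> carrier G}"

text \<open>The faces of the bar symbol \<open>[g\<^sub>1|\<dots>|g\<^sub>n]\<close>, indexed by \<open>i = 0, \<dots>, n\<close>.\<close>

definition bar_face :: "('a, 'b) monoid_scheme \<Rightarrow> nat \<Rightarrow> 'a list \<Rightarrow> 'a list" where
  "bar_face G i xs =
     (if i = 0 then tl xs
      else if i = length xs then butlast xs
      else take (i - 1) xs @ (xs ! (i - 1) \<otimes>\<^bsub>G\<^esub> xs ! i) # drop (i + 1) xs)"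

text \<open>
  The bar complex of \<open>G\<close> with coefficients in the left \<open>G\<close>-module \<open>\<kk>\<^sub>\<rho>\<close>, on which \<open>g\<close> acts as
  multiplication by \<open>\<rho> g\<close>: finitely supported functions on \<open>n\<close>-tuples of group elements.
  The boundary comes from \<open>F \<otimes>\<^sub>G \<kk>\<^sub>\<rho>\<close> with \<open>F\<close> the free left bar resolution, in which
  \<open>g x \<otimes> m = x \<otimes> g\<^sup>-\<^sup>1 m\<close>; hence the factor \<open>\<rho>(g\<^sub>1)\<^sup>-\<^sup>1\<close> on the initial face.  The constant function
  \<open>\<rho> = 1\<close> gives the homology with untwisted coefficients.
\<close>

definition bar_chains :: "('a, 'b) monoid_scheme \<Rightarrow> nat \<Rightarrow> ('a list \<Rightarrow>\<^sub>0 'k::field) set" where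
  "bar_chains G n = {c. Poly_Mapping.keys c \<subseteq> group_tuples G n}"

definition bar_boundary ::
    "('a, 'b) monoid_scheme \<Rightarrow> ('a \<Rightarrow> 'k::field) \<Rightarrow> ('a list \<Rightarrow>\<^sub>0 'k) \<Rightarrow> ('a list \<Rightarrow>\<^sub>0 'k)" where
  "bar_boundary G \<rho> c =
     (\<Sum>xs \<in> Poly_Mapping.keys c.
        if xs = [] then 0
        else \<Sum>i\<le>length xs.
          Poly_Mapping.single (bar_face G i xs)
            ((- 1) ^ i * (if i = 0 then inverse (\<rho> (hd xs)) else 1) * Poly_Mapping.lookup c xs))"

definition bar_cycles ::
    "('a, 'b) monoid_scheme \<Rightarrow> ('a \<Rightarrow> 'k::field) \<Rightarrow> nat \<Rightarrow> ('a list \<Rightarrow>\<^sub>0 'k) set" where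
  "bar_cycles G \<rho> n = {c \<in> bar_chains G n. bar_boundary G \<rho> c = 0}"

definition bar_boundaries ::
    "('a, 'b) monoid_scheme \<Rightarrow> ('a \<Rightarrow> 'k::field) \<Rightarrow> nat \<Rightarrow> ('a list \<Rightarrow>\<^sub>0 'k) set" where
  "bar_boundaries G \<rho> n = bar_boundary G \<rho> ` bar_chains G (Suc n)"

definition group_homology ::
    "('a, 'b) monoid_scheme \<Rightarrow> ('a \<Rightarrow> 'k::field) \<Rightarrow> nat \<Rightarrow> ('a list \<Rightarrow>\<^sub>0 'k) set monoid" where
  "group_homology G \<rho> n = additive_group (bar_cycles G \<rho> n) Mod bar_boundaries G \<rho> n"

definition bar_chain_map :: "('a \<Rightarrow> 'c) \<Rightarrow> ('a list \<Rightarrow>\<^sub>0 'k::field) \<Rightarrow> ('c list \<Rightarrow>\<^sub>0 'k)" where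
  "bar_chain_map f c =
     (\<Sum>xs \<in> Poly_Mapping.keys c. Poly_Mapping.single (map f xs) (Poly_Mapping.lookup c xs))"

text \<open>
  For a normal subgroup \<open>N\<close> of \<open>G\<close>, the map that conjugation \<open>x \<mapsto> g x g\<^sup>-\<^sup>1\<close> induces on \<open>H\<^sub>n(N, \<kk>)\<close>;
  it depends only on the class of \<open>g\<close> in \<open>G/N\<close>.  A homology class is a coset of boundaries.
\<close>

definition conj_on_homology ::
    "('a, 'b) monoid_scheme \<Rightarrow> 'a set \<Rightarrow> nat \<Rightarrow> 'a \<Rightarrow>
     ('a list \<Rightarrow>\<^sub>0 'k::field) set \<Rightarrow> ('a list \<Rightarrow>\<^sub>0 'k) set" where
  "conj_on_homology G N n g \<alpha> =
     (\<Union>z\<in>\<alpha>. bar_boundaries (G\<lparr>carrier := N\<rparr>) (\<lambda>_. 1) n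
        #>\<^bsub>additive_group (bar_cycles (G\<lparr>carrier := N\<rparr>) (\<lambda>_. 1) n)\<^esub>
        bar_chain_map (\<lambda>x. g \<otimes>\<^bsub>G\<^esub> x \<otimes>\<^bsub>G\<^esub> inv\<^bsub>G\<^esub> g) z)"

text \<open>
  Triviality of \<open>H\<^sub>n(N, \<rat>)\<close> as a \<open>\<rat>[G/N]\<close>-module: every coset \<open>C \<in> G/N\<close> acts as the identity,
  so that the group ring acts through its augmentation.
\<close>

definition trivial_action_on_homology ::
    "('a, 'b) monoid_scheme \<Rightarrow> 'a set \<Rightarrow> nat \<Rightarrow> bool" where
  "trivial_action_on_homology G N n \<longleftrightarrow>
     (\<forall>C \<in> carrier (G Mod N). \<forall>g \<in> C.
        \<forall>\<alpha> \<in> carrier (group_homology (G\<lparr>carrier := N\<rparr>) (\<lambda>_. 1 :: rat) n).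
          conj_on_homology G N n g \<alpha> = \<alpha>)"


section \<open>Characteristic varieties\<close>

definition units_group :: "'k::field monoid" where
  "units_group = \<lparr>carrier = UNIV - {0}, monoid.mult = (*), one = 1\<rparr>"

text \<open>Homomorphisms as functions that are \<open>undefined\<close> off the carrier, so that equality is literal.\<close>

definition Hom :: "('a, 'b) monoid_scheme \<Rightarrow> ('c, 'd) monoid_scheme \<Rightarrow> ('a \<Rightarrow> 'c) set" where
  "Hom G K = hom G K \<inter> extensional (carrier G)"

definition char_variety_1_1 :: "('a, 'b) monoid_scheme \<Rightarrow> ('a \<Rightarrow> 'k::field) set" where
  "char_variety_1_1 G = {\<rho> \<in> Hom G units_group. \<not> trivial_group (group_homology G \<rho> 1)}"


section \<open>The cohomology ring and resonance varieties\<close>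

text \<open>The inhomogeneous cochain complex with trivial coefficients; cochains vanish off \<open>G\<^sup>n\<close>.\<close>

definition cochains :: "('a, 'b) monoid_scheme \<Rightarrow> nat \<Rightarrow> ('a list \<Rightarrow> 'k::field) set" where
  "cochains G n = {f. \<forall>xs. xs \<notin> group_tuples G n \<longrightarrow> f xs = 0}"

definition coboundary ::
    "('a, 'b) monoid_scheme \<Rightarrow> nat \<Rightarrow> ('a list \<Rightarrow> 'k::field) \<Rightarrow> ('a list \<Rightarrow> 'k)" where
  "coboundary G n f = (\<lambda>xs. if xs \<in> group_tuples G (Suc n)
     then \<Sum>i\<le>Suc n. (- 1) ^ i * f (bar_face G i xs) else 0)"

definition cocycles :: "('a, 'b) monoid_scheme \<Rightarrow> nat \<Rightarrow> ('a list \<Rightarrow> 'k::field) set" where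
  "cocycles G n = {f \<in> cochains G n. coboundary G n f = 0}"

definition coboundaries :: "('a, 'b) monoid_scheme \<Rightarrow> nat \<Rightarrow> ('a list \<Rightarrow> 'k::field) set" where
  "coboundaries G n = (case n of 0 \<Rightarrow> {0} | Suc m \<Rightarrow> coboundary G m ` cochains G m)"

definition group_cohomology ::
    "('a, 'b) monoid_scheme \<Rightarrow> nat \<Rightarrow> ('a list \<Rightarrow> 'k::field) set monoid" where
  "group_cohomology G n = additive_group (cocycles G n) Mod coboundaries G n"

definition cohomology_class ::
    "('a, 'b) monoid_scheme \<Rightarrow> nat \<Rightarrow> ('a list \<Rightarrow> 'k::field) \<Rightarrow> ('a list \<Rightarrow> 'k) set" where
  "cohomology_class G n f = coboundaries G n #>\<^bsub>additive_group (cocycles G n)\<^esub> f"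

text \<open>Cup product of a \<open>p\<close>-cochain with a cochain of arbitrary degree.\<close>

definition cup_cochain :: "nat \<Rightarrow> ('a list \<Rightarrow> 'k::field) \<Rightarrow> ('a list \<Rightarrow> 'k) \<Rightarrow> ('a list \<Rightarrow> 'k)" where
  "cup_cochain p f g = (\<lambda>xs. f (take p xs) * g (drop p xs))"

definition cup_product ::
    "('a, 'b) monoid_scheme \<Rightarrow> nat \<Rightarrow> nat \<Rightarrow>
     ('a list \<Rightarrow> 'k::field) set \<Rightarrow> ('a list \<Rightarrow> 'k) set \<Rightarrow> ('a list \<Rightarrow> 'k) set" where
  "cup_product G p q \<alpha> \<beta> = (\<Union>f\<in>\<alpha>. \<Union>g\<in>\<beta>. cohomology_class G (p + q) (cup_cochain p f g))"

text \<open>The cochain complex \<open>(A, \<cdot>a)\<close> for \<open>A = H\<^sup>*(G, \<kk>)\<close> and \<open>a \<in> A\<^sup>1\<close>, and its cohomology.\<close>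

definition aomoto_diff ::
    "('a, 'b) monoid_scheme \<Rightarrow> ('a list \<Rightarrow> 'k::field) set \<Rightarrow> nat \<Rightarrow>
     ('a list \<Rightarrow> 'k) set \<Rightarrow> ('a list \<Rightarrow> 'k) set" where
  "aomoto_diff G a n x = cup_product G n 1 x a"

definition aomoto_cocycles ::
    "('a, 'b) monoid_scheme \<Rightarrow> ('a list \<Rightarrow> 'k::field) set \<Rightarrow> nat \<Rightarrow> ('a list \<Rightarrow> 'k) set set" where
  "aomoto_cocycles G a n =
     kernel (group_cohomology G n) (group_cohomology G (Suc n)) (aomoto_diff G a n)"

definition aomoto_coboundaries ::
    "('a, 'b) monoid_scheme \<Rightarrow> ('a list \<Rightarrow> 'k::field) set \<Rightarrow> nat \<Rightarrow> ('a list \<Rightarrow> 'k) set set" where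
  "aomoto_coboundaries G a n =
     (case n of 0 \<Rightarrow> {\<one>\<^bsub>group_cohomology G 0\<^esub>}
      | Suc m \<Rightarrow> aomoto_diff G a m ` carrier (group_cohomology G m))"

definition aomoto_cohomology ::
    "('a, 'b) monoid_scheme \<Rightarrow> ('a list \<Rightarrow> 'k::field) set \<Rightarrow> nat \<Rightarrow>
     ('a list \<Rightarrow> 'k) set set monoid" where
  "aomoto_cohomology G a n =
     (group_cohomology G n)\<lparr>carrier := aomoto_cocycles G a n\<rparr> Mod aomoto_coboundaries G a n"

definition resonance_1_1 :: "('a, 'b) monoid_scheme \<Rightarrow> ('a list \<Rightarrow> complex) set set" where
  "resonance_1_1 G =
     {a \<in> carrier (group_cohomology G 1). \<not> trivial_group (aomoto_cohomology G a 1)}"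

text \<open>
  The identification of \<open>Hom(G, \<complex>)\<close> with \<open>H\<^sup>1(G, \<complex>)\<close>: a homomorphism is sent to the class of the
  corresponding 1-cocycle.  Through it, the resonance variety is a subset of \<open>Hom(G, \<complex>)\<close>.
\<close>

abbreviation complex_group :: "complex monoid" where
  "complex_group \<equiv> additive_group UNIV"

definition hom_class :: "('a, 'b) monoid_scheme \<Rightarrow> ('a \<Rightarrow> complex) \<Rightarrow> ('a list \<Rightarrow> complex) set" where
  "hom_class G h =
     cohomology_class G 1 (\<lambda>xs. if xs \<in> group_tuples G 1 then h (hd xs) else 0)"

definition resonance_in_Hom :: "('a, 'b) monoid_scheme \<Rightarrow> ('a \<Rightarrow> complex) set" where
  "resonance_in_Hom G = {h \<in> Hom G complex_group. hom_class G h \<in> resonance_1_1 G}"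

end

theory Submission
  imports Defs "HOL-Computational_Algebra.Fundamental_Theorem_Algebra"
begin

text \<open>
  Let \<open>N\<close> be the kernel and let \<open>\<tau>\<close> map to 1.  By duality, \<open>H\<^sub>1(G, \<kk>\<^sub>\<rho>) \<noteq> 0\<close> means that there is a
  nonprincipal derivation twisted by \<open>\<rho>\<^sup>-\<^sup>1\<close>.  Triviality of the action on \<open>H\<^sub>1(N, \<rat>)\<close> forces, for every
  prime \<open>p\<close>, the vertices \<open>v\<close> with \<open>p \<nmid> \<chi>(v)\<close> to span a connected dominating subgraph: otherwise
  \<open>G\<close> has an explicit nonprincipal derivation twisted by a \<open>p\<close>-th root of unity.  Moving along this subgraph for
  all \<open>p\<close> at once shows that every character of \<open>N\<close> is \<open>\<tau>\<close>-invariant, hence extends to \<open>G\<close>, and that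
  every derivation of \<open>N\<close> becomes principal under some nonzero polynomial in \<open>\<tau>\<close>.  An eigenvector of \<open>\<tau>\<close>
  modulo principal derivations then extends to a nonprincipal derivation of \<open>G\<close>.

  For resonance, let \<open>b \<union> a = \<delta> f\<close> on \<open>N\<close>.  Then \<open>\<tau>\<close> changes \<open>f\<close> by a homomorphism \<open>\<Theta> b\<close>, and triviality of the
  action on \<open>H\<^sub>2(N, \<rat>)\<close>, applied to the class of \<open>f \<union> a - b \<union> a\<^sup>2/2\<close>, gives \<open>\<Theta> b \<union> a = 0\<close>.  An eigenvector of
  \<open>\<Theta>\<close> modulo \<open>a\<close> yields extensions of \<open>a\<close> and \<open>b\<close> to \<open>G\<close> whose cup product vanishes.
\<close>

section \<open>Presented groups\<close>

text \<open>The obstacle is the coefficients. The hypothesis concerns rational homology, while a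
  character of \<open>N\<close> takes values in the units of a field of any characteristic, possibly
  with torsion. The way around is combinatorial: complex roots of unity turn the hypothesis into a
  property of the graph of \<open>L\<close>, and a graph property can be used with any coefficients.
  Let \<open>T\<close> be the shift along \<open>\<tau>\<close>-orbits. Commuting generators relate
  the operators \<open>1 + T + ... + T^(n-1)\<close> with \<open>n = |\<chi>(v)|\<close>. In a
  general abelian group these are not injective, but two of them with coprime lengths have no common
  kernel, by Euclid's algorithm. This is why every prime \<open>p\<close> is needed for invariance
  of characters. For derivations a single prime is enough, since any nonzero polynomial in
  \<open>T\<close> will do. The second obstacle is that no space of homomorphisms or derivations is
  known in advance to be finite dimensional. Eigenvectors therefore come from one polynomial
  relation satisfied by one vector: from the chase along the graph for derivations, and from
  finitely many elements of \<open>N\<close> detecting homomorphisms for resonance.\<close>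

lemma pres_eq_context:
  assumes "pres_eq S R w w'"
  shows "pres_eq S R (u @ w @ v) (u @ w' @ v)"
  using assms
proof (induction rule: pres_eq.induct)
  case (cancel s u' e v')
  then show ?case
    using pres_eq.cancel[of s S R "u @ u'" e "v' @ v"] by simp
next
  case (relation r r' u' v')
  then show ?case
    using pres_eq.relation[of r r' R S "u @ u'" "v' @ v"] by simp
qed (auto intro: pres_eq.intros)

lemma pres_eq_append:
  assumes "pres_eq S R a a'" "pres_eq S R b b'"
  shows "pres_eq S R (a @ b) (a' @ b')"
  using pres_eq_context[OF assms(1), of "[]" b] pres_eq_context[OF assms(2), of a' "[]"]
  by (auto intro: pres_eq.trans)

lemma pres_words_append [simp]:
  "a @ b \<in> pres_words S \<longleftrightarrow> a \<in> pres_words S \<and> b \<in> pres_words S"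
  by (auto simp: pres_words_def)

lemma pres_words_Nil [simp]: "[] \<in> pres_words S"
  by (simp add: pres_words_def)

lemma pres_words_Cons [simp]: "(s, e) # w \<in> pres_words S \<longleftrightarrow> s \<in> S \<and> w \<in> pres_words S"
  by (auto simp: pres_words_def)

lemma pres_class_self: "w \<in> pres_words S \<Longrightarrow> w \<in> pres_class S R w"
  by (simp add: pres_class_def pres_eq.refl)

lemma pres_class_eqI: "pres_eq S R w w' \<Longrightarrow> pres_class S R w = pres_class S R w'"
  unfolding pres_class_def by (blast intro: pres_eq.sym pres_eq.trans)

lemma pres_class_memD: "w' \<in> pres_class S R w \<Longrightarrow> pres_eq S R w' w"
  by (auto simp: pres_class_def intro: pres_eq.sym)

lemma presented_group_mult:
  assumes "a \<in> pres_words S" "b \<in> pres_words S"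
  shows "pres_class S R a \<otimes>\<^bsub>presented_group S R\<^esub> pres_class S R b = pres_class S R (a @ b)"
proof -
  have "(\<Union>a'\<in>pres_class S R a. \<Union>b'\<in>pres_class S R b. pres_class S R (a' @ b')) =
      (\<Union>a'\<in>pres_class S R a. \<Union>b'\<in>pres_class S R b. pres_class S R (a @ b))"
    by (intro SUP_cong refl pres_class_eqI pres_eq_append pres_class_memD)
  moreover have "pres_class S R a \<noteq> {}" "pres_class S R b \<noteq> {}"
    using assms pres_class_self by blast+
  ultimately show ?thesis
    by (simp add: presented_group_def)
qed

lemma presented_group_one: "\<one>\<^bsub>presented_group S R\<^esub> = pres_class S R []"
  by (simp add: presented_group_def)

lemma presented_group_carrier: "carrier (presented_group S R) = pres_class S R ` pres_words S"
  by (simp add: presented_group_def)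

lemma pres_inverse_word:
  assumes "w \<in> pres_words S"
  shows "\<exists>w' \<in> pres_words S. pres_eq S R (w' @ w) []"
  using assms
proof (induction w)
  case Nil
  then show ?case by (auto intro: pres_eq.refl)
next
  case (Cons p w)
  obtain s e where p: "p = (s, e)" by fastforce
  from Cons p obtain w' where w': "w' \<in> pres_words S" "pres_eq S R (w' @ w) []" and s: "s \<in> S"
    by auto
  have "pres_eq S R (w' @ [(s, \<not> e), (s, \<not> \<not> e)] @ w) (w' @ w)"
    by (rule pres_eq.cancel[OF s])
  then have "pres_eq S R ((w' @ [(s, \<not> e)]) @ p # w) []"
    using w'(2) p by (auto intro: pres_eq.trans)
  then show ?case
    using w'(1) s by (intro bexI[of _ "w' @ [(s, \<not> e)]"]) auto
qed

lemma group_presented_group: "group (presented_group S R)"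
proof (rule groupI)
  fix x assume "x \<in> carrier (presented_group S R)"
  then obtain w where w: "w \<in> pres_words S" "x = pres_class S R w"
    by (auto simp: presented_group_carrier)
  obtain w' where w': "w' \<in> pres_words S" "pres_eq S R (w' @ w) []"
    using pres_inverse_word[OF w(1)] by blast
  have "pres_class S R w' \<otimes>\<^bsub>presented_group S R\<^esub> x = \<one>\<^bsub>presented_group S R\<^esub>"
    using w w' by (simp add: presented_group_mult presented_group_one pres_class_eqI)
  then show "\<exists>y \<in> carrier (presented_group S R).
      y \<otimes>\<^bsub>presented_group S R\<^esub> x = \<one>\<^bsub>presented_group S R\<^esub>"
    using w'(1) by (auto simp: presented_group_carrier)
next
  fix x y assume "x \<in> carrier (presented_group S R)" "y \<in> carrier (presented_group S R)"
  then obtain a b where "a \<in> pres_words S" "b \<in> pres_words S"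
    "x = pres_class S R a" "y = pres_class S R b"
    by (auto simp: presented_group_carrier)
  then show "x \<otimes>\<^bsub>presented_group S R\<^esub> y \<in> carrier (presented_group S R)"
    using presented_group_mult[of a S b R] by (auto simp: presented_group_carrier)
qed (auto simp: presented_group_carrier presented_group_mult presented_group_one)

lemma presented_group_inv_gen:
  assumes "s \<in> S"
  shows "inv\<^bsub>presented_group S R\<^esub> (pres_class S R [(s, True)]) = pres_class S R [(s, False)]"
proof (rule group.inv_equality[OF group_presented_group])
  have "pres_eq S R ([] @ [(s, False), (s, \<not> False)] @ []) ([] @ [])"
    by (rule pres_eq.cancel[OF assms])
  then show "pres_class S R [(s, False)] \<otimes>\<^bsub>presented_group S R\<^esub> pres_class S R [(s, True)] =
      \<one>\<^bsub>presented_group S R\<^esub>"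
    using assms by (simp add: presented_group_mult presented_group_one pres_class_eqI)
qed (use assms in \<open>auto simp: presented_group_carrier\<close>)

lemma presented_group_induct [consumes 1, case_names one gen inv_gen]:
  fixes S R
  defines "P \<equiv> presented_group S R"
  assumes "x \<in> carrier P"
    and one: "Q \<one>\<^bsub>P\<^esub>"
    and gen: "\<And>s x. s \<in> S \<Longrightarrow> x \<in> carrier P \<Longrightarrow> Q x \<Longrightarrow> Q (pres_class S R [(s, True)] \<otimes>\<^bsub>P\<^esub> x)"
    and inv_gen: "\<And>s x. s \<in> S \<Longrightarrow> x \<in> carrier P \<Longrightarrow> Q x \<Longrightarrow>
      Q (inv\<^bsub>P\<^esub> (pres_class S R [(s, True)]) \<otimes>\<^bsub>P\<^esub> x)"
  shows "Q x"
proof -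
  have "Q (pres_class S R w)" if "w \<in> pres_words S" for w
    using that
  proof (induction w)
    case Nil
    then show ?case using one by (simp add: P_def presented_group_one)
  next
    case (Cons p w)
    obtain s e where p: "p = (s, e)" by fastforce
    have *: "s \<in> S" "w \<in> pres_words S" "pres_class S R w \<in> carrier P" "Q (pres_class S R w)"
      using Cons p by (auto simp: P_def presented_group_carrier)
    show ?case
    proof (cases e)
      case True
      then show ?thesis
        using gen[OF *(1,3,4)] *(1,2) p by (simp add: P_def presented_group_mult)
    next
      case False
      then show ?thesis
        using inv_gen[OF *(1,3,4)] *(1,2) p
        by (simp add: P_def presented_group_mult presented_group_inv_gen)
    qed
  qed
  then show ?thesis
    using assms(2) by (auto simp: P_def presented_group_carrier)
qed

lemma presented_group_lift:
  assumes "\<And>w w'. pres_eq S R w w' \<Longrightarrow> F w = F w'"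
  shows "\<exists>F'. \<forall>w \<in> pres_words S. F' (pres_class S R w) = F w"
proof (intro exI ballI)
  fix w assume "w \<in> pres_words S"
  then have "(SOME a. a \<in> pres_class S R w) \<in> pres_class S R w"
    by (metis pres_class_self someI)
  then show "F (SOME a. a \<in> pres_class S R w) = F w"
    using assms by (auto simp: pres_class_def)
qed

section \<open>Derivations of right-angled Artin groups\<close>

text \<open>Crossed homomorphisms: 1-cocycles with coefficients in \<open>'k\<close>, on which
  \<open>x\<close> acts as multiplication by \<open>\<sigma> x\<close>. The maps called
  \<open>principal\<close> below are the 1-coboundaries, so a nonprincipal derivation is a nonzero
  class in first cohomology.\<close>

definition derivation :: "('a, 'b) monoid_scheme \<Rightarrow> ('a \<Rightarrow> 'k::ring) \<Rightarrow> ('a \<Rightarrow> 'k) \<Rightarrow> bool" where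
  "derivation H \<sigma> d \<longleftrightarrow> (\<forall>x \<in> carrier H. \<forall>y \<in> carrier H. d (x \<otimes>\<^bsub>H\<^esub> y) = d x + \<sigma> x * d y)"

definition principal :: "('a, 'b) monoid_scheme \<Rightarrow> ('a \<Rightarrow> 'k::ring_1) \<Rightarrow> ('a \<Rightarrow> 'k) \<Rightarrow> bool" where
  "principal H \<sigma> d \<longleftrightarrow> (\<exists>c. \<forall>x \<in> carrier H. d x = (\<sigma> x - 1) * c)"

definition mult_char :: "('a, 'b) monoid_scheme \<Rightarrow> ('a \<Rightarrow> 'k::field) \<Rightarrow> bool" where
  "mult_char H \<sigma> \<longleftrightarrow> (\<forall>x \<in> carrier H. \<sigma> x \<noteq> 0) \<and>
     (\<forall>x \<in> carrier H. \<forall>y \<in> carrier H. \<sigma> (x \<otimes>\<^bsub>H\<^esub> y) = \<sigma> x * \<sigma> y)"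

lemma mult_charD:
  assumes "mult_char H \<sigma>" "x \<in> carrier H"
  shows "\<sigma> x \<noteq> 0" "y \<in> carrier H \<Longrightarrow> \<sigma> (x \<otimes>\<^bsub>H\<^esub> y) = \<sigma> x * \<sigma> y"
  using assms by (auto simp: mult_char_def)

lemma mult_char_one:
  assumes "group H" "mult_char H \<sigma>"
  shows "\<sigma> \<one>\<^bsub>H\<^esub> = 1"
proof -
  interpret group H by fact
  show ?thesis
    using mult_charD[OF assms(2) one_closed] mult_charD(2)[OF assms(2) one_closed one_closed] by simp
qed

lemma mult_char_inv:
  assumes "group H" "mult_char H \<sigma>" "x \<in> carrier H"
  shows "\<sigma> (inv\<^bsub>H\<^esub> x) = inverse (\<sigma> x)"
proof -
  interpret group H by fact
  have "\<sigma> x * \<sigma> (inv\<^bsub>H\<^esub> x) = 1"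
    using mult_charD(2)[OF assms(2,3), of "inv\<^bsub>H\<^esub> x"] mult_char_one[OF assms(1,2)] assms(3) by simp
  then show ?thesis
    by (simp add: inverse_unique)
qed

fun word_char :: "('s \<Rightarrow> 'k::field) \<Rightarrow> 's word \<Rightarrow> 'k" where
  "word_char f [] = 1"
| "word_char f ((s, e) # w) = (if e then f s else inverse (f s)) * word_char f w"

text \<open>Fox calculus evaluated at a character. The clause for an inverse letter is forced by the
  value 0 on the product of a letter and its inverse.\<close>

fun word_deriv :: "('s \<Rightarrow> 'k::field) \<Rightarrow> ('s \<Rightarrow> 'k) \<Rightarrow> 's word \<Rightarrow> 'k" where
  "word_deriv f h [] = 0"
| "word_deriv f h ((s, e) # w) =
     (if e then h s + f s * word_deriv f h w else inverse (f s) * (word_deriv f h w - h s))"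

lemma word_char_append: "word_char f (u @ v) = word_char f u * word_char f v"
  by (induction f u rule: word_char.induct) auto

lemma word_deriv_append:
  "word_deriv f h (u @ v) = word_deriv f h u + word_char f u * word_deriv f h v"
  by (induction f u rule: word_char.induct) (auto simp: algebra_simps word_char_append)

definition raag_gen :: "'v set \<Rightarrow> 'v set set \<Rightarrow> 'v \<Rightarrow> 'v word set" where
  "raag_gen V L v = pres_class V
     {([(v, True), (w, True)], [(w, True), (v, True)]) | v w. v \<noteq> w \<and> {v, w} \<in> L} [(v, True)]"

lemma group_raag: "group (raag V L)"
  by (simp add: raag_def group_presented_group)

lemma raag_gen_closed: "v \<in> V \<Longrightarrow> raag_gen V L v \<in> carrier (raag V L)"
  by (auto simp: raag_gen_def raag_def presented_group_carrier)

lemmas raag_induct =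
  presented_group_induct[of _ V "{([(v, True), (w, True)], [(w, True), (v, True)]) | v w. v \<noteq> w \<and> {v, w} \<in> L}"
    for V L, folded raag_def raag_gen_def, consumes 1, case_names one gen inv_gen]

lemma raag_gen_commute:
  assumes "L \<subseteq> Pow V" "v \<noteq> w" "{v, w} \<in> L"
  shows "raag_gen V L v \<otimes>\<^bsub>raag V L\<^esub> raag_gen V L w = raag_gen V L w \<otimes>\<^bsub>raag V L\<^esub> raag_gen V L v"
proof -
  let ?R = "{([(v, True), (w, True)], [(w, True), (v, True)]) | v w. v \<noteq> w \<and> {v, w} \<in> L}"
  have "pres_eq V ?R ([] @ [(v, True), (w, True)] @ []) ([] @ [(w, True), (v, True)] @ [])"
    by (rule pres_eq.relation) (use assms in auto)
  then have "pres_class V ?R [(v, True), (w, True)] = pres_class V ?R [(w, True), (v, True)]"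
    by (intro pres_class_eqI) simp
  moreover have "v \<in> V" "w \<in> V"
    using assms by auto
  ultimately show ?thesis
    by (simp add: raag_gen_def raag_def presented_group_mult)
qed

text \<open>The condition on \<open>h\<close> is the equality of the values that the product rule
  gives to \<open>vw\<close> and \<open>wv\<close>, so \<open>word_deriv\<close> is constant on the
  classes of words.\<close>

lemma raag_derivation_exists:
  fixes \<sigma> :: "'v word set \<Rightarrow> 'k::field"
  assumes L: "L \<subseteq> Pow V"
    and \<sigma>: "mult_char (raag V L) \<sigma>"
    and h: "\<And>v w. v \<noteq> w \<Longrightarrow> {v, w} \<in> L \<Longrightarrow>
      (\<sigma> (raag_gen V L v) - 1) * h w = (\<sigma> (raag_gen V L w) - 1) * h v"
  shows "\<exists>d. derivation (raag V L) \<sigma> d \<and> (\<forall>v \<in> V. d (raag_gen V L v) = h v)"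
proof -
  interpret group "raag V L" by (rule group_raag)
  define R where "R = {([(v, True), (w, True)], [(w, True), (v, True)]) | v w. v \<noteq> w \<and> {v, w} \<in> L}"
  have G: "raag V L = presented_group V R" and gen: "raag_gen V L v = pres_class V R [(v, True)]" for v
    by (simp_all add: raag_def R_def raag_gen_def)
  \<comment> \<open>The value 1 off \<open>V\<close> keeps \<open>f\<close> nowhere zero.\<close>
  define f where "f v = (if v \<in> V then \<sigma> (raag_gen V L v) else 1)" for v
  have f0: "f v \<noteq> 0" for v
    using \<sigma> raag_gen_closed[of v V L] by (auto simp: f_def mult_char_def)
  have inv: "word_char f w = word_char f w' \<and> word_deriv f h w = word_deriv f h w'"
    if "pres_eq V R w w'" for w w'
    using that
  proof (induction rule: pres_eq.induct)
    case (cancel s u e v)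
    have "word_char f [(s, e), (s, \<not> e)] = 1" "word_deriv f h [(s, e), (s, \<not> e)] = 0"
      using f0[of s] by (cases e; simp add: mult.assoc[symmetric])+
    then show ?case
      by (simp only: word_char_append word_deriv_append) simp
  next
    case (relation r r' u v)
    then obtain a b where ab: "r = [(a, True), (b, True)]" "r' = [(b, True), (a, True)]"
      "a \<noteq> b" "{a, b} \<in> L" by (auto simp: R_def)
    then have "(f a - 1) * h b = (f b - 1) * h a"
      using h[OF ab(3,4)] L by (auto simp: f_def)
    then have "h a + f a * h b = h b + f b * h a"
      by (simp add: algebra_simps)
    then have "word_deriv f h r = word_deriv f h r'" "word_char f r = word_char f r'"
      by (simp_all add: ab)
    then show ?case
      by (simp add: word_char_append word_deriv_append)
  qed auto
  then obtain d where d: "\<And>w. w \<in> pres_words V \<Longrightarrow> d (pres_class V R w) = word_deriv f h w"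
    using presented_group_lift[of V R "word_deriv f h"] by blast
  have char: "\<sigma> (pres_class V R w) = word_char f w" if "w \<in> pres_words V" for w
    using that
  proof (induction w)
    case Nil
    then show ?case using mult_char_one[OF group_raag \<sigma>] by (simp add: G presented_group_one)
  next
    case (Cons p w)
    obtain s e where p: "p = (s, e)" by fastforce
    have s: "s \<in> V" "w \<in> pres_words V"
      using Cons.prems p by simp_all
    have sw: "pres_class V R w \<in> carrier (raag V L)"
      using s unfolding G presented_group_carrier by (rule_tac imageI)
    have se: "pres_class V R [(s, e)] \<in> carrier (raag V L)"
      unfolding G presented_group_carrier by (rule imageI) (simp add: s)
    have *: "\<sigma> (pres_class V R [(s, e)]) = (if e then f s else inverse (f s))"
    proof (cases e)
      case False
      then show ?thesis
        using presented_group_inv_gen[OF s(1), of R] s(1)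
          mult_char_inv[OF group_raag \<sigma> raag_gen_closed[OF s(1)]]
        by (simp add: gen G f_def)
    qed (use s(1) in \<open>simp add: f_def gen\<close>)
    have "pres_class V R ((s, e) # w) = pres_class V R [(s, e)] \<otimes>\<^bsub>raag V L\<^esub> pres_class V R w"
      using s(1,2) by (simp add: G presented_group_mult)
    then show ?case
      using * mult_charD(2)[OF \<sigma> se sw] Cons.IH[OF s(2)] p by simp
  qed
  have "derivation (raag V L) \<sigma> d"
    unfolding derivation_def
    by (auto simp: G presented_group_carrier presented_group_mult d char word_deriv_append)
  moreover have "d (raag_gen V L v) = h v" if "v \<in> V" for v
    using d[of "[(v, True)]"] that by (simp add: gen)
  ultimately show ?thesis by blast
qed

section \<open>The bar complex\<close>

lemma additive_r_coset: "B #>\<^bsub>additive_group Z\<^esub> z = (\<lambda>b. b + z) ` B"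
  by (auto simp: r_coset_def additive_group_def)

text \<open>Stated through the coset arithmetic of \<open>B\<close> alone, so that it serves the
  additive quotients as well as the Aomoto quotient, whose elements are themselves cosets.\<close>

lemma trivial_group_Mod_iff:
  assumes "B \<subseteq> carrier M" "B \<noteq> {}" and mult: "B <#>\<^bsub>M\<^esub> B = B"
    and coset: "\<And>z. z \<in> carrier M \<Longrightarrow> B #>\<^bsub>M\<^esub> z = B \<longleftrightarrow> z \<in> B"
  shows "trivial_group (M Mod B) \<longleftrightarrow> carrier M = B"
proof -
  have car: "carrier (M Mod B) = (\<lambda>z. B #>\<^bsub>M\<^esub> z) ` carrier M"
    by (auto simp: FactGroup_def RCOSETS_def)
  have one: "\<one>\<^bsub>M Mod B\<^esub> = B"
    by (simp add: FactGroup_def)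
  show ?thesis
  proof
    assume "trivial_group (M Mod B)"
    then have "carrier (M Mod B) = {B}"
      unfolding trivial_group_def one by (rule conjunct2)
    then have im: "(\<lambda>z. B #>\<^bsub>M\<^esub> z) ` carrier M = {B}"
      by (simp only: car)
    have "z \<in> B" if "z \<in> carrier M" for z
      using imageI[OF that, of "\<lambda>z. B #>\<^bsub>M\<^esub> z"] unfolding im coset[OF that, symmetric] by simp
    then show "carrier M = B"
      using assms(1) by auto
  next
    assume Z: "carrier M = B"
    have "(\<lambda>z. B #>\<^bsub>M\<^esub> z) ` carrier M = (\<lambda>z. B) ` carrier M"
      by (rule image_cong[OF HOL.refl]) (simp only: coset Z)
    also have "\<dots> = {B}"
      using assms(2) Z by blast
    finally have B: "carrier (M Mod B) = {B}"
      by (simp only: car)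
    have "group (M Mod B)"
      by (rule groupI) (simp_all add: B one mult)
    then show "trivial_group (M Mod B)"
      unfolding trivial_group_def B one by (rule conjI[OF _ HOL.refl])
  qed
qed

lemma additive_r_coset_eq_iff:
  fixes B :: "'m::ab_group_add set"
  assumes "0 \<in> B" "\<And>x y. x \<in> B \<Longrightarrow> y \<in> B \<Longrightarrow> x + y \<in> B" "\<And>x. x \<in> B \<Longrightarrow> - x \<in> B"
  shows "(\<lambda>b. b + z) ` B = B \<longleftrightarrow> z \<in> B"
proof
  assume "z \<in> B"
  moreover have "x \<in> (\<lambda>b. b + z) ` B" if "x \<in> B" for x
    using assms(2)[OF that assms(3)[OF \<open>z \<in> B\<close>]] by (intro image_eqI[of _ _ "x + - z"]) auto
  ultimately show "(\<lambda>b. b + z) ` B = B"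
    using assms(2) by auto
next
  assume "(\<lambda>b. b + z) ` B = B"
  moreover have "0 + z \<in> (\<lambda>b. b + z) ` B"
    using assms(1) by (rule imageI)
  ultimately show "z \<in> B" by simp
qed

lemma trivial_group_additive_quotient_iff:
  assumes "B \<subseteq> Z" "0 \<in> B" "\<And>x y. x \<in> B \<Longrightarrow> y \<in> B \<Longrightarrow> x + y \<in> B" "\<And>x. x \<in> B \<Longrightarrow> - x \<in> B"
  shows "trivial_group (additive_group Z Mod B) \<longleftrightarrow> Z = B"
proof -
  have Z: "carrier (additive_group Z) = Z"
    by (simp add: additive_group_def)
  have "x \<in> B <#>\<^bsub>additive_group Z\<^esub> B" if "x \<in> B" for x
    unfolding set_mult_def additive_group_def by (rule UN_I[OF that], rule UN_I[OF assms(2)]) simp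
  then have "B <#>\<^bsub>additive_group Z\<^esub> B = B"
    using assms(3) by (auto simp: set_mult_def additive_group_def)
  moreover have "B \<noteq> {}"
    using assms(2) by blast
  ultimately show ?thesis
    using trivial_group_Mod_iff[of B "additive_group Z"] additive_r_coset_eq_iff[of B] assms
    unfolding additive_r_coset Z by blast
qed

text \<open>Makes chain spaces instances of \<open>vector_space\<close>, which supplies linear
  sections and extensions of functionals.\<close>

definition pm_scale :: "'k::field \<Rightarrow> ('a \<Rightarrow>\<^sub>0 'k) \<Rightarrow> ('a \<Rightarrow>\<^sub>0 'k)" where
  "pm_scale a c = Poly_Mapping.map ((*) a) c"

lemma lookup_pm_scale [simp]:
  "Poly_Mapping.lookup (pm_scale a c) x = a * Poly_Mapping.lookup c x"
  by (simp add: pm_scale_def map.rep_eq when_def)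

lemma keys_pm_scale: "Poly_Mapping.keys (pm_scale a c) \<subseteq> Poly_Mapping.keys c"
  by (auto simp: in_keys_iff)

lemma vector_space_pm_scale: "vector_space pm_scale"
  by unfold_locales (auto intro!: poly_mapping_eqI simp: lookup_add algebra_simps)

lemma poly_mapping_sum_single:
  "(\<Sum>x \<in> Poly_Mapping.keys c. Poly_Mapping.single x (Poly_Mapping.lookup c x)) = c"
proof (rule poly_mapping_eqI)
  fix y
  have "Poly_Mapping.lookup (\<Sum>x \<in> Poly_Mapping.keys c. Poly_Mapping.single x (Poly_Mapping.lookup c x)) y
     = (\<Sum>x \<in> Poly_Mapping.keys c. if x = y then Poly_Mapping.lookup c x else 0)"
    by (auto simp: lookup_sum lookup_single when_def intro!: sum.cong)
  also have "\<dots> = Poly_Mapping.lookup c y"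
    by (simp add: sum.delta in_keys_iff)
  finally show "Poly_Mapping.lookup (\<Sum>x \<in> Poly_Mapping.keys c.
      Poly_Mapping.single x (Poly_Mapping.lookup c x)) y = Poly_Mapping.lookup c y" .
qed

text \<open>The support of a sum may shrink by cancellation, so all three sums are first taken over
  the union of the supports.\<close>

lemma sum_keys_add:
  fixes \<phi> :: "'a \<Rightarrow> 'k::field \<Rightarrow> 'm::ab_group_add"
  assumes "\<And>x a b. \<phi> x (a + b) = \<phi> x a + \<phi> x b"
  shows "(\<Sum>x \<in> Poly_Mapping.keys (c + c'). \<phi> x (Poly_Mapping.lookup (c + c') x)) =
    (\<Sum>x \<in> Poly_Mapping.keys c. \<phi> x (Poly_Mapping.lookup c x)) +
    (\<Sum>x \<in> Poly_Mapping.keys c'. \<phi> x (Poly_Mapping.lookup c' x))"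
proof -
  let ?A = "Poly_Mapping.keys c \<union> Poly_Mapping.keys c'"
  have zero: "\<phi> x 0 = 0" for x
    using assms[of x 0 0] by simp
  have sup: "(\<Sum>x \<in> Poly_Mapping.keys p. \<phi> x (Poly_Mapping.lookup p x)) =
      (\<Sum>x \<in> ?A. \<phi> x (Poly_Mapping.lookup p x))" if "Poly_Mapping.keys p \<subseteq> ?A" for p
    by (rule sum.mono_neutral_left) (use that zero in \<open>auto simp: in_keys_iff\<close>)
  have "(\<Sum>x \<in> Poly_Mapping.keys (c + c'). \<phi> x (Poly_Mapping.lookup (c + c') x)) =
      (\<Sum>x \<in> ?A. \<phi> x (Poly_Mapping.lookup c x) + \<phi> x (Poly_Mapping.lookup c' x))"
    by (subst sup[OF Poly_Mapping.keys_add]) (simp only: lookup_add assms)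
  also have "\<dots> = (\<Sum>x \<in> ?A. \<phi> x (Poly_Mapping.lookup c x)) + (\<Sum>x \<in> ?A. \<phi> x (Poly_Mapping.lookup c' x))"
    by (rule sum.distrib)
  finally show ?thesis
    using sup[of c] sup[of c'] by simp
qed

lemma sum_keys_scale:
  fixes \<phi> :: "'a \<Rightarrow> 'k::field \<Rightarrow> 'm::ab_group_add"
  assumes "\<And>x. \<phi> x 0 = 0"
  shows "(\<Sum>x \<in> Poly_Mapping.keys (pm_scale a c). \<phi> x (Poly_Mapping.lookup (pm_scale a c) x)) =
    (\<Sum>x \<in> Poly_Mapping.keys c. \<phi> x (a * Poly_Mapping.lookup c x))"
proof -
  have "(\<Sum>x \<in> Poly_Mapping.keys (pm_scale a c). \<phi> x (Poly_Mapping.lookup (pm_scale a c) x)) =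
      (\<Sum>x \<in> Poly_Mapping.keys c. \<phi> x (Poly_Mapping.lookup (pm_scale a c) x))"
    by (rule sum.mono_neutral_left) (use keys_pm_scale assms in \<open>auto simp: in_keys_iff\<close>)
  then show ?thesis by simp
qed

lemma bar_boundary_add:
  "bar_boundary H \<rho> (c + c') = bar_boundary H \<rho> c + bar_boundary H \<rho> c'"
  unfolding bar_boundary_def
  by (rule sum_keys_add) (auto simp: algebra_simps single_add sum.distrib)

lemma pm_scale_single: "pm_scale a (Poly_Mapping.single x b) = Poly_Mapping.single x (a * b)"
  by (rule poly_mapping_eqI) (simp add: lookup_single when_def)

lemma pm_scale_sum: "pm_scale a (sum f A) = (\<Sum>x\<in>A. pm_scale a (f x))"
proof -
  interpret vector_space pm_scale by (rule vector_space_pm_scale)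
  show ?thesis by (rule scale_sum_right)
qed

lemma bar_boundary_scale: "bar_boundary H \<rho> (pm_scale a c) = pm_scale a (bar_boundary H \<rho> c)"
proof -
  have z: "pm_scale a 0 = 0"
    by (rule poly_mapping_eqI) simp
  show ?thesis
    unfolding bar_boundary_def pm_scale_sum
    by (subst sum_keys_scale)
      (auto intro!: sum.cong simp: pm_scale_sum pm_scale_single z mult_ac)
qed

lemma linear_bar_boundary: "Vector_Spaces.linear pm_scale pm_scale (bar_boundary H \<rho>)"
proof -
  show ?thesis
    by (intro Vector_Spaces.linear_iff[THEN iffD2] conjI allI vector_space_pm_scale)
      (simp_all add: bar_boundary_add bar_boundary_scale)
qed

lemma bar_boundary_single:
  "bar_boundary H \<rho> (Poly_Mapping.single xs a) = (if xs = [] then 0 else \<Sum>i\<le>length xs.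
     Poly_Mapping.single (bar_face H i xs) ((- 1) ^ i * (if i = 0 then inverse (\<rho> (hd xs)) else 1) * a))"
proof (cases "a = 0")
  case False
  then have keys: "Poly_Mapping.keys (Poly_Mapping.single xs a) = {xs}" by simp
  show ?thesis unfolding bar_boundary_def keys by simp
qed (simp add: bar_boundary_def)

lemma bar_boundary_sum_single:
  "bar_boundary H \<rho> c =
     (\<Sum>xs \<in> Poly_Mapping.keys c. bar_boundary H \<rho> (Poly_Mapping.single xs (Poly_Mapping.lookup c xs)))"
  unfolding bar_boundary_single by (simp add: bar_boundary_def)

lemma subspace_bar_chains: "module.subspace pm_scale (bar_chains H n :: ('a list \<Rightarrow>\<^sub>0 'k::field) set)"
proof -
  interpret vector_space pm_scale by (rule vector_space_pm_scale)
  show ?thesis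
    unfolding subspace_def bar_chains_def mem_Collect_eq
  proof (intro conjI ballI allI; (elim CollectE)?)
    fix x y :: "'a list \<Rightarrow>\<^sub>0 'k"
    assume "Poly_Mapping.keys x \<subseteq> group_tuples H n" "Poly_Mapping.keys y \<subseteq> group_tuples H n"
    then show "Poly_Mapping.keys (x + y) \<subseteq> group_tuples H n"
      using Poly_Mapping.keys_add[of x y] by (meson Un_least subset_trans)
  next
    fix x :: "'a list \<Rightarrow>\<^sub>0 'k" and c
    assume "Poly_Mapping.keys x \<subseteq> group_tuples H n"
    then show "Poly_Mapping.keys (pm_scale c x) \<subseteq> group_tuples H n"
      using keys_pm_scale[of c x] by (rule subset_trans[rotated])
  qed simp
qed

lemma subspace_bar_boundaries: "module.subspace pm_scale (bar_boundaries H \<rho> n)"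
proof -
  interpret vector_space_pair pm_scale pm_scale
    by (intro vector_space_pair.intro vector_space_pm_scale)
  show ?thesis
    unfolding bar_boundaries_def
    by (rule linear_subspace_image[OF linear_bar_boundary subspace_bar_chains])
qed

text \<open>Cochains with values in \<open>'k\<close> are paired with chains over a subfield, embedded by \<open>e\<close>.\<close>

locale field_embedding =
  fixes e :: "'f::field \<Rightarrow> 'k::field"
  assumes e_add: "e (a + b) = e a + e b" and e_mult: "e (a * b) = e a * e b" and e_one: "e 1 = 1"
begin

lemma e_zero: "e 0 = 0"
  using e_add[of 0 0] by (metis add_0 add_right_imp_eq)

lemma e_minus: "e (- a) = - e a"
  using e_add[of a "- a"] by (simp add: e_zero minus_unique)

definition pairing :: "('a \<Rightarrow> 'k) \<Rightarrow> ('a \<Rightarrow>\<^sub>0 'f) \<Rightarrow> 'k" where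
  "pairing w c = (\<Sum>xs \<in> Poly_Mapping.keys c. e (Poly_Mapping.lookup c xs) * w xs)"

lemma pairing_add: "pairing w (c + c') = pairing w c + pairing w c'"
  unfolding pairing_def by (rule sum_keys_add) (simp add: e_add algebra_simps)

lemma pairing_zero [simp]: "pairing w 0 = 0"
  by (simp add: pairing_def)

lemma pairing_diff: "pairing w (c - c') = pairing w c - pairing w c'"
  using pairing_add[of w "c - c'" c'] by simp

lemma pairing_sum: "pairing w (sum f A) = (\<Sum>x\<in>A. pairing w (f x))"
  by (induction A rule: infinite_finite_induct) (simp_all add: pairing_add)

lemma pairing_single [simp]: "pairing w (Poly_Mapping.single x a) = e a * w x"
  by (cases "a = 0") (simp_all add: pairing_def e_zero)

lemma pairing_scale: "pairing w (pm_scale a c) = e a * pairing w c"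
  unfolding pairing_def
  by (subst sum_keys_scale) (simp_all add: e_zero e_mult sum_distrib_left mult.assoc)

lemma vector_space_pair_e: "vector_space_pair pm_scale (\<lambda>a z. e a * z)"
  by (intro vector_space_pair.intro vector_space_pm_scale)
    (unfold_locales, auto simp: algebra_simps e_add e_mult e_one)

lemma linear_functional_eq_pairing:
  assumes "Vector_Spaces.linear pm_scale (\<lambda>a z. e a * z) \<psi>"
  shows "\<psi> c = pairing (\<lambda>xs. \<psi> (Poly_Mapping.single xs 1)) c"
proof -
  interpret l: Vector_Spaces.linear pm_scale "\<lambda>a z. e a * z" \<psi> by fact
  have "\<psi> c = \<psi> (\<Sum>x \<in> Poly_Mapping.keys c. Poly_Mapping.single x (Poly_Mapping.lookup c x))"
    by (simp add: poly_mapping_sum_single)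
  also have "\<dots> = (\<Sum>x \<in> Poly_Mapping.keys c.
      \<psi> (pm_scale (Poly_Mapping.lookup c x) (Poly_Mapping.single x 1)))"
    by (simp add: l.sum pm_scale_single)
  also have "\<dots> = pairing (\<lambda>xs. \<psi> (Poly_Mapping.single xs 1)) c"
    by (simp add: l.scale pairing_def)
  finally show ?thesis .
qed

lemma linear_pairing: "Vector_Spaces.linear pm_scale (\<lambda>a z. e a * z) (pairing w)"
proof -
  interpret vector_space_pair pm_scale "\<lambda>a z. e a * z" by (rule vector_space_pair_e)
  show ?thesis by (intro Vector_Spaces.linear_iff[THEN iffD2] conjI allI vector_space_pm_scale vs2.vector_space_axioms) (simp_all add: pairing_add pairing_scale)
qed

text \<open>Let \<open>g\<close> be a linear section of the boundary over its image. A chain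
  \<open>c\<close> and \<open>g\<close> of its boundary differ by a cycle, so \<open>w\<close> has
  the same value on both, and \<open>u\<close> is \<open>w\<close> composed with \<open>g\<close>.
  This is the part of universal coefficients that the proof uses: chains over a subfield, values in
  the larger field.\<close>

lemma pairing_vanishing_on_cycles:
  assumes "\<And>c. c \<in> bar_cycles H \<rho> n \<Longrightarrow> pairing w c = 0"
  shows "\<exists>u. \<forall>c \<in> bar_chains H n. pairing w c = pairing u (bar_boundary H \<rho> c)"
proof -
  interpret p1: vector_space_pair pm_scale pm_scale
    by (intro vector_space_pair.intro vector_space_pm_scale)
  obtain g where g: "range g \<subseteq> bar_chains H n" "Vector_Spaces.linear pm_scale pm_scale g"
    "\<And>v. v \<in> bar_boundary H \<rho> ` bar_chains H n \<Longrightarrow> bar_boundary H \<rho> (g v) = v"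
    using p1.linear_exists_right_inverse_on[OF linear_bar_boundary[of H \<rho>] subspace_bar_chains[of H n]]
    by blast
  define u where "u xs = pairing w (g (Poly_Mapping.single xs 1))" for xs
  have lin: "Vector_Spaces.linear pm_scale (\<lambda>a z. e a * z) (pairing w \<circ> g)"
    using g(2) linear_pairing by (rule Vector_Spaces.linear_compose)
  have u: "pairing w (g v) = pairing u v" for v
    using linear_functional_eq_pairing[OF lin, of v] by (simp add: u_def[abs_def])
  have "pairing w c = pairing u (bar_boundary H \<rho> c)" if c: "c \<in> bar_chains H n" for c
  proof -
    let ?c' = "g (bar_boundary H \<rho> c)"
    have "?c' \<in> bar_chains H n" using g(1) by blast
    then have "?c' - c \<in> bar_chains H n"
      using c subspace_bar_chains p1.vs1.subspace_diff by blast
    moreover have "bar_boundary H \<rho> (?c' - c) = 0"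
      using g(3)[of "bar_boundary H \<rho> c"] c bar_boundary_add[of H \<rho> "?c' - c" c] by simp
    ultimately have "pairing w (?c' - c) = 0"
      by (intro assms) (simp add: bar_cycles_def)
    then show ?thesis
      by (simp add: pairing_diff u)
  qed
  then show ?thesis by blast
qed

text \<open>The transpose of \<open>bar_boundary\<close> under \<open>pairing\<close>. The inverse
  on the initial face is why homology twisted by \<open>\<rho>\<close> is dual to derivations
  twisted by the inverse of \<open>\<rho>\<close>.\<close>

definition codiff :: "('a, 'b) monoid_scheme \<Rightarrow> ('a \<Rightarrow> 'f) \<Rightarrow> ('a list \<Rightarrow> 'k) \<Rightarrow> 'a list \<Rightarrow> 'k" where
  "codiff H \<rho> w xs = (if xs = [] then 0 else \<Sum>i\<le>length xs.
     (- 1) ^ i * (if i = 0 then e (inverse (\<rho> (hd xs))) else 1) * w (bar_face H i xs))"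

lemma pairing_boundary_single:
  "pairing w (bar_boundary H \<rho> (Poly_Mapping.single xs a)) = e a * codiff H \<rho> w xs"
proof -
  have "e ((- 1) ^ i) = (- 1) ^ i" for i
    by (induction i) (auto simp: e_mult e_minus e_one)
  then show ?thesis
    by (auto simp: bar_boundary_single codiff_def pairing_sum sum_distrib_left e_mult e_one mult_ac
        intro!: sum.cong)
qed

lemma pairing_boundary: "pairing w (bar_boundary H \<rho> c) = pairing (codiff H \<rho> w) c"
  by (subst bar_boundary_sum_single, simp only: pairing_sum pairing_boundary_single)
    (simp only: pairing_def)

end

global_interpretation id_emb: field_embedding "\<lambda>a. a"
  by unfold_locales simp_all

global_interpretation rat_emb: field_embedding "of_rat :: rat \<Rightarrow> complex"
  by unfold_locales (simp_all add: of_rat_add of_rat_mult)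

lemma bar_face_one [simp]: "bar_face H 0 [x] = []" "bar_face H (Suc 0) [x] = []"
  by (simp_all add: bar_face_def)

lemma bar_face_two [simp]:
  "bar_face H 0 [x, y] = [y]" "bar_face H (Suc 0) [x, y] = [x \<otimes>\<^bsub>H\<^esub> y]"
  "bar_face H (Suc (Suc 0)) [x, y] = [x]"
  by (simp_all add: bar_face_def)

lemma bar_face_three [simp]:
  "bar_face H 0 [x, y, z] = [y, z]" "bar_face H (Suc 0) [x, y, z] = [x \<otimes>\<^bsub>H\<^esub> y, z]"
  "bar_face H (Suc (Suc 0)) [x, y, z] = [x, y \<otimes>\<^bsub>H\<^esub> z]"
  "bar_face H (Suc (Suc (Suc 0))) [x, y, z] = [x, y]"
  by (simp_all add: bar_face_def)

lemma group_tuples_one: "xs \<in> group_tuples H (Suc 0) \<longleftrightarrow> (\<exists>x \<in> carrier H. xs = [x])"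
  by (auto simp: group_tuples_def length_Suc_conv)

lemma group_tuples_two:
  "xs \<in> group_tuples H 2 \<longleftrightarrow> (\<exists>x \<in> carrier H. \<exists>y \<in> carrier H. xs = [x, y])"
  by (auto simp: group_tuples_def length_Suc_conv numeral_2_eq_2)

lemma group_tuples_three:
  "xs \<in> group_tuples H 3 \<longleftrightarrow> (\<exists>x \<in> carrier H. \<exists>y \<in> carrier H. \<exists>z \<in> carrier H. xs = [x, y, z])"
  by (auto simp: group_tuples_def length_Suc_conv numeral_3_eq_3)

context field_embedding
begin

lemma codiff_one: "codiff H \<rho> w [x] = (e (inverse (\<rho> x)) - 1) * w []"
  by (simp add: codiff_def algebra_simps)

lemma codiff_two: "codiff H \<rho> w [x, y] = e (inverse (\<rho> x)) * w [y] - w [x \<otimes>\<^bsub>H\<^esub> y] + w [x]"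
  by (simp add: codiff_def)

lemma codiff_three:
  "codiff H \<rho> w [x, y, z] =
     e (inverse (\<rho> x)) * w [y, z] - w [x \<otimes>\<^bsub>H\<^esub> y, z] + w [x, y \<otimes>\<^bsub>H\<^esub> z] - w [x, y]"
  by (simp add: codiff_def)

lemma pairing_cong: "(\<And>xs. xs \<in> Poly_Mapping.keys c \<Longrightarrow> w xs = w' xs) \<Longrightarrow> pairing w c = pairing w' c"
  by (simp add: pairing_def)

lemma pairing_boundary_eq_0:
  assumes "c \<in> bar_chains H n" "\<And>xs. xs \<in> group_tuples H n \<Longrightarrow> codiff H \<rho> w xs = 0"
  shows "pairing w (bar_boundary H \<rho> c) = 0"
  unfolding pairing_boundary using assms by (auto simp: pairing_def bar_chains_def intro!: sum.neutral)

end

lemma single_in_bar_chains: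
  "xs \<in> group_tuples H n \<Longrightarrow> Poly_Mapping.single xs a \<in> bar_chains H n"
  by (auto simp: bar_chains_def)

lemma boundary_boundary_two:
  fixes \<rho> :: "'a \<Rightarrow> 'k::field"
  assumes "mult_char H \<rho>" "c \<in> bar_chains H 2"
  shows "bar_boundary H \<rho> (bar_boundary H \<rho> c) = 0"
proof -
  interpret l: Vector_Spaces.linear pm_scale pm_scale "bar_boundary H \<rho>"
    by (rule linear_bar_boundary)
  have "bar_boundary H \<rho> (bar_boundary H \<rho> (Poly_Mapping.single [x, y] a)) = 0"
    if "x \<in> carrier H" "y \<in> carrier H" for x y a
  proof -
    have "\<rho> (x \<otimes>\<^bsub>H\<^esub> y) = \<rho> x * \<rho> y"
      using mult_charD(2)[OF assms(1)] that by blast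
    then show ?thesis
      by (simp add: bar_boundary_single bar_boundary_add algebra_simps
          flip: single_add single_diff single_uminus)
  qed
  then have "bar_boundary H \<rho> (bar_boundary H \<rho> (Poly_Mapping.single xs a)) = 0"
    if "xs \<in> Poly_Mapping.keys c" for xs a
    using that assms(2) unfolding bar_chains_def by (auto simp: group_tuples_two dest!: subsetD)
  then show ?thesis
    by (subst bar_boundary_sum_single) (simp add: l.sum)
qed

text \<open>Adjoin \<open>z\<close> to a basis of \<open>B\<close> and prescribe 1 on
  \<open>z\<close> and 0 on the basis.\<close>

lemma separating_functional:
  fixes z :: "'a \<Rightarrow>\<^sub>0 'k::field"
  assumes B: "module.subspace pm_scale B" and z: "z \<notin> B"
  shows "\<exists>\<psi>. Vector_Spaces.linear pm_scale (*) \<psi> \<and> (\<forall>b \<in> B. \<psi> b = 0) \<and> \<psi> z = 1"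
proof -
  interpret vector_space_pair "pm_scale :: 'k \<Rightarrow> ('a \<Rightarrow>\<^sub>0 'k) \<Rightarrow> _" "(*) :: 'k \<Rightarrow> 'k \<Rightarrow> 'k"
    by (rule id_emb.vector_space_pair_e)
  obtain B0 where B0: "B0 \<subseteq> B" "vs1.independent B0" "B \<subseteq> vs1.span B0"
    using vs1.maximal_independent_subset[of B] by metis
  have sp: "vs1.span B0 = B"
    using B0 vs1.span_minimal[OF B0(1) B] by blast
  then have "vs1.independent (insert z B0)"
    using z B0(2) vs1.independent_insert[of z B0] by auto
  then obtain \<psi> where \<psi>: "Vector_Spaces.linear pm_scale (*) \<psi>"
    "\<And>x. x \<in> insert z B0 \<Longrightarrow> \<psi> x = (if x = z then 1 else 0)"
    using linear_independent_extend[of "insert z B0" "\<lambda>x. if x = z then 1 else 0"] by blast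
  have "\<psi> b = 0" if "b \<in> B" for b
  proof (rule linear_eq_0_on_span[OF \<psi>(1), of B0])
    show "b \<in> vs1.span B0" using that sp by simp
    show "\<psi> x = 0" if "x \<in> B0" for x
      using \<psi>(2)[of x] that z B0(1) by auto
  qed
  then show ?thesis
    using \<psi> by auto
qed

text \<open>A functional on 1-chains that kills boundaries is a derivation on the symbols
  \<open>[x]\<close>, and it kills all cycles exactly when that derivation is principal. Separating
  a cycle from the boundaries gives one direction; \<open>pairing_vanishing_on_cycles\<close> gives
  the other, the constant being the value of \<open>u\<close> at the empty symbol.\<close>

lemma homology1_nontrivial_iff:
  fixes \<rho> :: "'a \<Rightarrow> 'k::field"
  assumes "group H" and \<rho>: "mult_char H \<rho>"
  shows "\<not> trivial_group (group_homology H \<rho> 1) \<longleftrightarrow>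
    (\<exists>d. derivation H (\<lambda>x. inverse (\<rho> x)) d \<and> \<not> principal H (\<lambda>x. inverse (\<rho> x)) d)"
proof -
  interpret v: vector_space "pm_scale :: 'k \<Rightarrow> ('a list \<Rightarrow>\<^sub>0 'k) \<Rightarrow> _" by (rule vector_space_pm_scale)
  let ?B = "bar_boundaries H \<rho> 1" and ?Z = "bar_cycles H \<rho> 1"
  have B: "v.subspace ?B" by (rule subspace_bar_boundaries)
  have chain: "bar_boundary H \<rho> c \<in> bar_chains H 1" if c: "c \<in> bar_chains H 2" for c :: "'a list \<Rightarrow>\<^sub>0 'k"
  proof -
    interpret group H by fact
    have "bar_boundary H \<rho> (Poly_Mapping.single xs a) \<in> bar_chains H 1"
      if "xs \<in> Poly_Mapping.keys c" for xs a
    proof -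
      obtain x y where "x \<in> carrier H" "y \<in> carrier H" "xs = [x, y]"
      proof -
        have "xs \<in> group_tuples H 2"
          using c \<open>xs \<in> _\<close> by (auto simp: bar_chains_def)
        then show ?thesis
          using that unfolding group_tuples_two by blast
      qed
      then show ?thesis
        by (auto simp: bar_boundary_single group_tuples_def
            intro!: v.subspace_add[OF subspace_bar_chains] single_in_bar_chains)
    qed
    then show ?thesis
      by (subst bar_boundary_sum_single) (rule v.subspace_sum[OF subspace_bar_chains])
  qed
  have sub: "?B \<subseteq> ?Z"
    using boundary_boundary_two[OF \<rho>] chain
    by (auto simp: bar_boundaries_def bar_cycles_def numeral_2_eq_2)
  have triv: "trivial_group (group_homology H \<rho> 1) \<longleftrightarrow> ?Z = ?B"
    unfolding group_homology_def
    by (rule trivial_group_additive_quotient_iff[OF sub])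
      (use B v.subspace_0 v.subspace_add v.subspace_neg in blast)+
  show ?thesis
  proof
    assume "\<not> trivial_group (group_homology H \<rho> 1)"
    then obtain z where z: "z \<in> ?Z" "z \<notin> ?B"
      using triv sub by blast
    then obtain \<psi> where \<psi>: "Vector_Spaces.linear pm_scale (*) \<psi>" "\<And>b. b \<in> ?B \<Longrightarrow> \<psi> b = 0" "\<psi> z = 1"
      using separating_functional[OF B] by blast
    define w where "w xs = \<psi> (Poly_Mapping.single xs 1)" for xs
    have w: "\<psi> c = id_emb.pairing w c" for c
      unfolding w_def[abs_def] by (rule id_emb.linear_functional_eq_pairing[OF \<psi>(1)])
    have "derivation H (\<lambda>x. inverse (\<rho> x)) (\<lambda>x. w [x])"
      unfolding derivation_def
    proof (intro ballI)
      fix x y assume "x \<in> carrier H" "y \<in> carrier H"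
      then have "bar_boundary H \<rho> (Poly_Mapping.single [x, y] 1) \<in> ?B"
        unfolding bar_boundaries_def
        by (intro imageI single_in_bar_chains) (simp add: group_tuples_def)
      then have "id_emb.codiff H \<rho> w [x, y] = 0"
        using \<psi>(2) w id_emb.pairing_boundary_single[of w H \<rho> "[x, y]" 1] by simp
      then show "w [x \<otimes>\<^bsub>H\<^esub> y] = w [x] + inverse (\<rho> x) * w [y]"
        by (simp add: id_emb.codiff_two algebra_simps)
    qed
    moreover have "\<not> principal H (\<lambda>x. inverse (\<rho> x)) (\<lambda>x. w [x])"
    proof
      assume "principal H (\<lambda>x. inverse (\<rho> x)) (\<lambda>x. w [x])"
      then obtain c where c: "\<And>x. x \<in> carrier H \<Longrightarrow> w [x] = (inverse (\<rho> x) - 1) * c"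
        by (auto simp: principal_def)
      have "id_emb.pairing w z = id_emb.pairing (id_emb.codiff H \<rho> (\<lambda>_. c)) z"
      proof (rule id_emb.pairing_cong)
        fix xs assume "xs \<in> Poly_Mapping.keys z"
        then have "xs \<in> group_tuples H 1"
          using z(1) by (auto simp: bar_cycles_def bar_chains_def)
        then show "w xs = id_emb.codiff H \<rho> (\<lambda>_. c) xs"
          using c by (auto simp: group_tuples_one id_emb.codiff_one)
      qed
      also have "\<dots> = id_emb.pairing (\<lambda>_. c) (bar_boundary H \<rho> z)"
        by (simp only: id_emb.pairing_boundary)
      also have "\<dots> = 0"
        using z(1) by (simp add: bar_cycles_def)
      finally show False
        using \<psi>(3) w by simp
    qed
    ultimately show "\<exists>d. derivation H (\<lambda>x. inverse (\<rho> x)) d \<and> \<not> principal H (\<lambda>x. inverse (\<rho> x)) d"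
      by blast
  next
    assume "\<exists>d. derivation H (\<lambda>x. inverse (\<rho> x)) d \<and> \<not> principal H (\<lambda>x. inverse (\<rho> x)) d"
    then obtain d where d: "derivation H (\<lambda>x. inverse (\<rho> x)) d" "\<not> principal H (\<lambda>x. inverse (\<rho> x)) d"
      by blast
    show "\<not> trivial_group (group_homology H \<rho> 1)"
    proof
      assume "trivial_group (group_homology H \<rho> 1)"
      then have ZB: "?Z = ?B" using triv by blast
      define w where "w xs = d (hd xs)" for xs
      have "id_emb.pairing w c = 0" if c: "c \<in> ?Z" for c
      proof -
        obtain b where b: "b \<in> bar_chains H 2" "c = bar_boundary H \<rho> b"
          using c unfolding ZB bar_boundaries_def by (auto simp: numeral_2_eq_2)
        show ?thesis
          unfolding b(2)
        proof (rule id_emb.pairing_boundary_eq_0[OF b(1)])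
          fix xs assume "xs \<in> group_tuples H 2"
          then show "id_emb.codiff H \<rho> w xs = 0"
            using d(1) by (auto simp: group_tuples_two id_emb.codiff_two w_def derivation_def)
        qed
      qed
      then obtain u where u: "\<And>c. c \<in> bar_chains H 1 \<Longrightarrow>
          id_emb.pairing w c = id_emb.pairing u (bar_boundary H \<rho> c)"
        using id_emb.pairing_vanishing_on_cycles[of H \<rho> 1 w] by blast
      have "d x = (inverse (\<rho> x) - 1) * u []" if "x \<in> carrier H" for x
      proof -
        have "Poly_Mapping.single [x] 1 \<in> bar_chains H 1"
          using that by (intro single_in_bar_chains) (simp add: group_tuples_def)
        from u[OF this] show ?thesis
          by (simp only: id_emb.pairing_boundary_single id_emb.codiff_one id_emb.pairing_single) (simp add: w_def)
      qed
      then show False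
        using d(2) by (auto simp: principal_def)
    qed
  qed
qed

section \<open>Kernels of epimorphisms to the integers\<close>

lemma (in field_embedding) pairing_bar_chain_map:
  "pairing w (bar_chain_map f c) = pairing (\<lambda>xs. w (map f xs)) c"
  unfolding bar_chain_map_def pairing_sum pairing_single by (simp only: pairing_def)

text \<open>Since 0 is a boundary, \<open>z\<close> lies in its own class and its conjugate lies in
  the conjugated class; equality of the two classes compares these representatives.\<close>

lemma trivial_action_boundary:
  assumes "trivial_action_on_homology G N n" "group G" "N \<subseteq> carrier G" "\<one>\<^bsub>G\<^esub> \<in> N"
    and g: "g \<in> carrier G"
    and z: "z \<in> bar_cycles (G\<lparr>carrier := N\<rparr>) (\<lambda>_. 1 :: rat) n"
  shows "bar_chain_map (\<lambda>x. g \<otimes>\<^bsub>G\<^esub> x \<otimes>\<^bsub>G\<^esub> inv\<^bsub>G\<^esub> g) z - z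
    \<in> bar_boundaries (G\<lparr>carrier := N\<rparr>) (\<lambda>_. 1) n"
proof -
  interpret group G by fact
  interpret v: vector_space "pm_scale :: rat \<Rightarrow> ('a list \<Rightarrow>\<^sub>0 rat) \<Rightarrow> _" by (rule vector_space_pm_scale)
  let ?B = "bar_boundaries (G\<lparr>carrier := N\<rparr>) (\<lambda>_. 1 :: rat) n"
  let ?Z = "bar_cycles (G\<lparr>carrier := N\<rparr>) (\<lambda>_. 1 :: rat) n"
  let ?c = "bar_chain_map (\<lambda>x. g \<otimes>\<^bsub>G\<^esub> x \<otimes>\<^bsub>G\<^esub> inv\<^bsub>G\<^esub> g)"
  define \<alpha> where "\<alpha> = (\<lambda>b. b + z) ` ?B"
  have "\<alpha> \<in> carrier (group_homology (G\<lparr>carrier := N\<rparr>) (\<lambda>_. 1 :: rat) n)"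
    using z unfolding group_homology_def FactGroup_def RCOSETS_def
    by (auto simp: \<alpha>_def additive_r_coset additive_group_def r_coset_def)
  moreover have "N #>\<^bsub>G\<^esub> g \<in> carrier (G Mod N)"
    using g by (auto simp: FactGroup_def RCOSETS_def)
  moreover have "g \<in> N #>\<^bsub>G\<^esub> g"
    using assms(4) g by (auto simp: r_coset_def intro!: bexI[of _ "\<one>\<^bsub>G\<^esub>"])
  ultimately have eq: "conj_on_homology G N n g \<alpha> = \<alpha>"
    using assms(1) unfolding trivial_action_on_homology_def by blast
  have 0: "0 \<in> ?B"
    using subspace_bar_boundaries v.subspace_0 by blast
  have "z \<in> \<alpha>"
    unfolding \<alpha>_def using imageI[OF 0, of "\<lambda>b. b + z"] by simp
  moreover have "?c z \<in> (\<lambda>b. b + ?c z) ` ?B"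
    using imageI[OF 0, of "\<lambda>b. b + ?c z"] by simp
  ultimately have "?c z \<in> conj_on_homology G N n g \<alpha>"
    unfolding conj_on_homology_def additive_r_coset by blast
  then obtain b where "b \<in> ?B" "?c z = b + z"
    unfolding eq unfolding \<alpha>_def by blast
  then show ?thesis by simp
qed

text \<open>The choice of \<open>\<tau>\<close> splits \<open>\<chi>\<close> and makes
  \<open>G\<close> a semidirect product of \<open>N\<close> with the powers of
  \<open>\<tau>\<close>: \<open>cj\<close> is the action on \<open>N\<close>, and
  \<open>nrm g\<close> is the factor of \<open>g\<close> in \<open>N\<close>.\<close>

locale int_extension = group G for G (structure) +
  fixes \<chi> :: "'a \<Rightarrow> int" and \<tau> :: 'a
  assumes chi_mult: "\<And>x y. x \<in> carrier G \<Longrightarrow> y \<in> carrier G \<Longrightarrow> \<chi> (x \<otimes> y) = \<chi> x + \<chi> y"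
    and tau: "\<tau> \<in> carrier G" "\<chi> \<tau> = 1"
begin

definition N where "N = {x \<in> carrier G. \<chi> x = 0}"

abbreviation NG where "NG \<equiv> G\<lparr>carrier := N\<rparr>"

lemma N_closed: "x \<in> N \<Longrightarrow> x \<in> carrier G"
  by (simp add: N_def)

lemma chi_one [simp]: "\<chi> \<one> = 0"
  using chi_mult[of \<one> \<one>] by simp

lemma chi_inv [simp]: "x \<in> carrier G \<Longrightarrow> \<chi> (inv x) = - \<chi> x"
  using chi_mult[of x "inv x"] by simp

lemma tau_pow_closed [simp]: "\<tau> [^] (i::int) \<in> carrier G"
  using tau by simp

lemma chi_tau_pow [simp]: "\<chi> (\<tau> [^] (i::int)) = i"
proof -
  have nat: "\<chi> (\<tau> [^] n) = int n" for n :: nat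
    by (induction n) (simp_all add: tau chi_mult)
  show ?thesis
    using tau by (cases i rule: int_cases2) (simp_all add: int_pow_int nat int_pow_neg)
qed

lemma N_mult [simp]: "x \<in> N \<Longrightarrow> y \<in> N \<Longrightarrow> x \<otimes> y \<in> N"
  by (simp add: N_def chi_mult)

lemma N_one [simp]: "\<one> \<in> N"
  by (simp add: N_def)

lemma N_conj [simp]: "g \<in> carrier G \<Longrightarrow> x \<in> N \<Longrightarrow> g \<otimes> x \<otimes> inv g \<in> N"
  by (simp add: N_def chi_mult)

lemma mem_N: "x \<in> N \<longleftrightarrow> x \<in> carrier G \<and> \<chi> x = 0"
  by (simp add: N_def)

lemma group_NG: "group NG"
proof (rule subgroup.subgroup_is_group[OF _ is_group])
  show "subgroup N G"
    by unfold_locales (auto simp: N_def chi_mult)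
qed

definition cj :: "int \<Rightarrow> 'a \<Rightarrow> 'a" where
  "cj i x = \<tau> [^] i \<otimes> x \<otimes> inv (\<tau> [^] i)"

lemma cj_N [simp]: "x \<in> N \<Longrightarrow> cj i x \<in> N"
  unfolding cj_def by (rule N_conj[OF tau_pow_closed])

lemma cj_closed [simp]: "x \<in> carrier G \<Longrightarrow> cj i x \<in> carrier G"
  by (simp add: cj_def)

lemma cj_0 [simp]: "x \<in> carrier G \<Longrightarrow> cj 0 x = x"
  by (simp add: cj_def)

lemma cj_mult: "x \<in> carrier G \<Longrightarrow> y \<in> carrier G \<Longrightarrow> cj i (x \<otimes> y) = cj i x \<otimes> cj i y"
  by (simp add: cj_def m_assoc inv_solve_left)

lemma cj_cj: "x \<in> carrier G \<Longrightarrow> cj i (cj j x) = cj (i + j) x"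
  using tau by (simp add: cj_def int_pow_mult inv_mult_group m_assoc)

definition nrm :: "'a \<Rightarrow> 'a" where
  "nrm g = g \<otimes> inv (\<tau> [^] \<chi> g)"

lemma nrm_N [simp]: "g \<in> carrier G \<Longrightarrow> nrm g \<in> N"
  by (simp add: nrm_def N_def chi_mult)

lemma nrm_of_N [simp]: "x \<in> N \<Longrightarrow> nrm x = x"
  by (simp add: nrm_def N_def)

declare N_closed [simp]

text \<open>The multiplication law of the semidirect product, read in the factor
  \<open>N\<close>.\<close>

lemma nrm_mult:
  assumes "g \<in> carrier G" "h \<in> carrier G"
  shows "nrm (g \<otimes> h) = nrm g \<otimes> cj (\<chi> g) (nrm h)"
proof -
  have "nrm g \<otimes> cj (\<chi> g) (nrm h) =
      g \<otimes> (inv (\<tau> [^] \<chi> g) \<otimes> \<tau> [^] \<chi> g) \<otimes> h \<otimes> (inv (\<tau> [^] \<chi> h) \<otimes> inv (\<tau> [^] \<chi> g))"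
    using assms tau by (simp only: nrm_def cj_def m_assoc m_closed inv_closed tau_pow_closed)
  also have "\<dots> = g \<otimes> h \<otimes> (inv (\<tau> [^] \<chi> h) \<otimes> inv (\<tau> [^] \<chi> g))"
    using assms by simp
  also have "inv (\<tau> [^] \<chi> h) \<otimes> inv (\<tau> [^] \<chi> g) = inv (\<tau> [^] (\<chi> g + \<chi> h))"
    using tau by (simp add: int_pow_mult inv_mult_group)
  finally show ?thesis
    using assms by (simp add: nrm_def chi_mult)
qed

text \<open>Reidemeister--Schreier: the values of \<open>\<phi>\<close> along the \<open>\<tau>\<close>-orbit of \<open>nrm g\<close> form a derivation
  of \<open>G\<close> with values in the coinduced module.\<close>

definition orb :: "('a \<Rightarrow> 'c) \<Rightarrow> 'a \<Rightarrow> int \<Rightarrow> 'c" where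
  "orb \<phi> g i = \<phi> (cj i (nrm g))"

lemma cj_nrm_mult:
  assumes "g \<in> carrier G" "h \<in> carrier G"
  shows "cj i (nrm (g \<otimes> h)) = cj i (nrm g) \<otimes> cj (i + \<chi> g) (nrm h)"
  using assms by (simp add: nrm_mult cj_mult cj_cj)

definition invariant :: "('a \<Rightarrow> 'c) \<Rightarrow> bool" where
  "invariant \<phi> \<longleftrightarrow> (\<forall>x \<in> N. \<phi> (cj 1 x) = \<phi> x)"

lemma invariant_cj:
  assumes "invariant \<phi>" "x \<in> N"
  shows "\<phi> (cj i x) = \<phi> x"
proof -
  have step: "\<phi> (cj (i + 1) x) = \<phi> (cj i x)" for i
    using assms cj_cj[of x 1 i] unfolding invariant_def
    by (metis N_closed add.commute cj_N)
  show ?thesis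
  proof (induction i rule: int_induct[where k = 0])
    case (step2 i)
    then show ?case using step[of "i - 1"] by simp
  qed (use assms step in simp_all)
qed

text \<open>The symbol \<open>[x]\<close> is a rational cycle, so it differs from its conjugate by a
  boundary, and a homomorphism extended linearly kills boundaries.\<close>

lemma hom_invariant:
  fixes w :: "'a \<Rightarrow> complex"
  assumes "trivial_action_on_homology G N 1"
    and w: "\<And>x y. x \<in> N \<Longrightarrow> y \<in> N \<Longrightarrow> w (x \<otimes> y) = w x + w y"
  shows "invariant w"
  unfolding invariant_def
proof
  fix x assume x: "x \<in> N"
  let ?g = "\<tau> [^] (1::int)" and ?w = "\<lambda>xs. w (hd xs)"
  let ?z = "Poly_Mapping.single [x] (1::rat)"
  have z: "?z \<in> bar_cycles NG (\<lambda>_. 1) 1"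
    using x unfolding bar_cycles_def
    by (auto intro!: single_in_bar_chains simp: group_tuples_def bar_boundary_single single_add[symmetric])
  have "bar_chain_map (\<lambda>x. ?g \<otimes> x \<otimes> inv ?g) ?z - ?z \<in> bar_boundaries NG (\<lambda>_. 1) 1"
    by (rule trivial_action_boundary[OF assms(1) is_group _ _ _ z]) auto
  then obtain b where b: "b \<in> bar_chains NG 2"
    "bar_chain_map (\<lambda>x. ?g \<otimes> x \<otimes> inv ?g) ?z - ?z = bar_boundary NG (\<lambda>_. 1) b"
    by (auto simp: bar_boundaries_def numeral_2_eq_2)
  have "rat_emb.pairing ?w (bar_boundary NG (\<lambda>_. 1) b) = 0"
    using b(1)
    by (rule rat_emb.pairing_boundary_eq_0) (auto simp: group_tuples_two rat_emb.codiff_two w)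
  then show "w (cj 1 x) = w x"
    unfolding b(2)[symmetric] rat_emb.pairing_diff rat_emb.pairing_bar_chain_map
    by (simp add: cj_def)
qed

text \<open>A rational 2-cycle and its conjugate differ by a boundary, which the cocycle
  \<open>w\<close> kills. Hence the change of \<open>w\<close> under \<open>\<tau>\<close> vanishes
  on all rational cycles, and \<open>pairing_vanishing_on_cycles\<close> makes it a
  coboundary.\<close>

lemma cocycle2_invariant:
  fixes w :: "'a \<Rightarrow> 'a \<Rightarrow> complex"
  assumes "trivial_action_on_homology G N 2"
    and w: "\<And>x y z. x \<in> N \<Longrightarrow> y \<in> N \<Longrightarrow> z \<in> N \<Longrightarrow>
      w y z - w (x \<otimes> y) z + w x (y \<otimes> z) - w x y = 0"
  shows "\<exists>u. \<forall>x \<in> N. \<forall>y \<in> N. w (cj 1 x) (cj 1 y) - w x y = u x + u y - u (x \<otimes> y)"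
proof -
  let ?g = "\<tau> [^] (1::int)"
  define w1 where "w1 xs = w (hd xs) (hd (tl xs))" for xs
  define w2 where "w2 xs = w1 (map (\<lambda>x. ?g \<otimes> x \<otimes> inv ?g) xs) - w1 xs" for xs
  have "rat_emb.pairing w2 z = 0" if z: "z \<in> bar_cycles NG (\<lambda>_. 1) 2" for z
  proof -
    have "bar_chain_map (\<lambda>x. ?g \<otimes> x \<otimes> inv ?g) z - z \<in> bar_boundaries NG (\<lambda>_. 1) 2"
      by (rule trivial_action_boundary[OF assms(1) is_group _ _ _ z]) auto
    then obtain b where b: "b \<in> bar_chains NG 3"
      "bar_chain_map (\<lambda>x. ?g \<otimes> x \<otimes> inv ?g) z - z = bar_boundary NG (\<lambda>_. 1) b"
      by (auto simp: bar_boundaries_def numeral_3_eq_3 numeral_2_eq_2)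
    have "rat_emb.pairing w1 (bar_boundary NG (\<lambda>_. 1) b) = 0"
      using b(1)
      by (rule rat_emb.pairing_boundary_eq_0)
        (auto simp: group_tuples_three rat_emb.codiff_three w w1_def)
    then have "rat_emb.pairing (\<lambda>xs. w1 (map (\<lambda>x. ?g \<otimes> x \<otimes> inv ?g) xs)) z - rat_emb.pairing w1 z = 0"
      unfolding b(2)[symmetric] rat_emb.pairing_diff rat_emb.pairing_bar_chain_map .
    then show ?thesis
      by (simp add: w2_def rat_emb.pairing_def right_diff_distrib sum_subtractf)
  qed
  then obtain u where u: "\<And>c. c \<in> bar_chains NG 2 \<Longrightarrow>
      rat_emb.pairing w2 c = rat_emb.pairing u (bar_boundary NG (\<lambda>_. 1) c)"
    using rat_emb.pairing_vanishing_on_cycles[of NG "\<lambda>_. 1" 2 w2] by blast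
  have "w (cj 1 x) (cj 1 y) - w x y = u [x] + u [y] - u [x \<otimes> y]" if "x \<in> N" "y \<in> N" for x y
  proof -
    have "Poly_Mapping.single [x, y] (1::rat) \<in> bar_chains NG 2"
      using that by (intro single_in_bar_chains) (simp add: group_tuples_def)
    from u[OF this] have "w2 [x, y] = u [x] + u [y] - u [x \<otimes> y]"
      by (simp only: rat_emb.pairing_boundary_single rat_emb.codiff_two rat_emb.pairing_single) simp
    then show ?thesis
      by (simp add: w2_def w1_def cj_def)
  qed
  then show ?thesis
    by (intro exI[of _ "\<lambda>x. u [x]"]) blast
qed

end

section \<open>Resonance in terms of homomorphisms\<close>

definition additive_on :: "('a, 'b) monoid_scheme \<Rightarrow> ('a \<Rightarrow> 'k::plus) \<Rightarrow> bool" where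
  "additive_on H b \<longleftrightarrow> (\<forall>x \<in> carrier H. \<forall>y \<in> carrier H. b (x \<otimes>\<^bsub>H\<^esub> y) = b x + b y)"

definition cup_exact :: "('a, 'b) monoid_scheme \<Rightarrow> ('a \<Rightarrow> 'k::field) \<Rightarrow> ('a \<Rightarrow> 'k) \<Rightarrow> ('a \<Rightarrow> 'k) \<Rightarrow> bool" where
  "cup_exact H b a f \<longleftrightarrow>
     (\<forall>x \<in> carrier H. \<forall>y \<in> carrier H. b x * a y = f x + f y - f (x \<otimes>\<^bsub>H\<^esub> y))"

text \<open>Nonvanishing of the first cohomology of the Aomoto complex at \<open>a\<close>, written
  with cochains: \<open>b\<close> is a cocycle up to the primitive \<open>f\<close>, and the
  coboundaries are the multiples of \<open>a\<close>.\<close>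

definition resonant :: "('a, 'b) monoid_scheme \<Rightarrow> ('a \<Rightarrow> 'k::field) \<Rightarrow> bool" where
  "resonant H a \<longleftrightarrow> (\<exists>b f. additive_on H b \<and> cup_exact H b a f \<and>
     \<not> (\<exists>c. \<forall>x \<in> carrier H. b x = c * a x))"

definition one_cochain :: "('a, 'b) monoid_scheme \<Rightarrow> ('a \<Rightarrow> 'k::field) \<Rightarrow> 'a list \<Rightarrow> 'k" where
  "one_cochain H b = (\<lambda>xs. if xs \<in> group_tuples H 1 then b (hd xs) else 0)"

lemma one_cochain_single [simp]: "x \<in> carrier H \<Longrightarrow> one_cochain H b [x] = b x"
  by (simp add: one_cochain_def group_tuples_def)

lemma coboundary_two:
  "x \<in> carrier H \<Longrightarrow> y \<in> carrier H \<Longrightarrow>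
    coboundary H 1 f [x, y] = f [x] + f [y] - f [x \<otimes>\<^bsub>H\<^esub> y]"
  by (simp add: coboundary_def group_tuples_def)

lemma coboundary_outside: "xs \<notin> group_tuples H (Suc n) \<Longrightarrow> coboundary H n f xs = 0"
  by (simp add: coboundary_def)

lemma coboundary_0: "coboundary H 0 f = 0"
  by (auto simp: coboundary_def group_tuples_def length_Suc_conv fun_eq_iff)

text \<open>With trivial coefficients the two faces of \<open>[x]\<close> cancel. Classes in degree
  one are therefore singletons, and homomorphisms can stand for them.\<close>

lemma coboundaries_1: "coboundaries H 1 = {0 :: 'a list \<Rightarrow> 'k::field}"
proof -
  have "(0 :: 'a list \<Rightarrow> 'k) \<in> cochains H 0"
    by (simp add: cochains_def)
  then show ?thesis
    by (auto simp: coboundaries_def coboundary_0)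
qed

lemma one_cochain_add: "one_cochain H b + one_cochain H c = one_cochain H (\<lambda>x. b x + c x)"
  by (auto simp: one_cochain_def)

lemma one_cochain_eq_iff:
  "one_cochain H b = one_cochain H c \<longleftrightarrow> (\<forall>x \<in> carrier H. b x = c x)"
proof
  assume eq: "one_cochain H b = one_cochain H c"
  show "\<forall>x \<in> carrier H. b x = c x"
  proof
    fix x assume "x \<in> carrier H"
    then show "b x = c x" using fun_cong[OF eq, of "[x]"] by simp
  qed
qed (auto simp: one_cochain_def group_tuples_one fun_eq_iff)

lemma cocycles_1:
  assumes "group H"
  shows "cocycles H 1 = one_cochain H ` {b :: 'a \<Rightarrow> 'k::field. additive_on H b}"
proof (intro equalityI subsetI)
  fix f :: "'a list \<Rightarrow> 'k" assume f: "f \<in> cocycles H 1"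
  have "additive_on H (\<lambda>x. f [x])"
    unfolding additive_on_def
  proof (intro ballI)
    fix x y assume "x \<in> carrier H" "y \<in> carrier H"
    then have "f [x] + f [y] - f [x \<otimes>\<^bsub>H\<^esub> y] = 0"
      using f coboundary_two[of x H y f] by (simp add: cocycles_def)
    then show "f [x \<otimes>\<^bsub>H\<^esub> y] = f [x] + f [y]" by simp
  qed
  moreover have "f = one_cochain H (\<lambda>x. f [x])"
  proof
    fix xs show "f xs = one_cochain H (\<lambda>x. f [x]) xs"
      using f by (auto simp: cocycles_def cochains_def one_cochain_def group_tuples_one)
  qed
  ultimately show "f \<in> one_cochain H ` {b. additive_on H b}" by blast
next
  interpret group H by fact
  fix f :: "'a list \<Rightarrow> 'k" assume "f \<in> one_cochain H ` {b. additive_on H b}"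
  then obtain b where b: "f = one_cochain H b" "additive_on H b" by blast
  have "coboundary H 1 f = 0"
  proof
    fix xs show "coboundary H 1 f xs = 0 xs"
    proof (cases "xs \<in> group_tuples H 2")
      case True
      then obtain x y where "x \<in> carrier H" "y \<in> carrier H" "xs = [x, y]"
        unfolding group_tuples_two by blast
      then show ?thesis
        using b coboundary_two[of x H y f] by (simp add: additive_on_def)
    next
      case False
      then show ?thesis
        using coboundary_outside[of xs H 1 f] by (simp add: numeral_2_eq_2)
    qed
  qed
  then show "f \<in> cocycles H 1"
    using b(1) by (auto simp: cocycles_def cochains_def one_cochain_def)
qed

lemma carrier_cohomology_1:
  assumes "group H"
  shows "carrier (group_cohomology H 1) =
    (\<lambda>b. {one_cochain H b}) ` {b :: 'a \<Rightarrow> 'k::field. additive_on H b}"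
proof -
  have "carrier (group_cohomology H 1 :: ('a list \<Rightarrow> 'k) set monoid) = (\<lambda>z. {z}) ` cocycles H 1"
    unfolding group_cohomology_def coboundaries_1 FactGroup_def RCOSETS_def
    by (auto simp: additive_r_coset) (auto simp: additive_group_def)
  then show ?thesis
    by (simp only: cocycles_1[OF assms] image_image)
qed

lemma cohomology_class_1: "cohomology_class H 1 f = {f}"
  by (simp add: cohomology_class_def coboundaries_1[simplified] additive_r_coset)

lemma hom_class_eq: "hom_class H h = {one_cochain H h}"
  by (simp only: hom_class_def cohomology_class_1 one_cochain_def)

lemma mult_cohomology_1: "{x} \<otimes>\<^bsub>group_cohomology H 1\<^esub> {y} = {x + y}"
  by (simp add: group_cohomology_def set_mult_def additive_group_def)

lemma coboundaries_2: "coboundaries H 2 = coboundary H 1 ` cochains H 1"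
  by (simp add: coboundaries_def numeral_2_eq_2)

lemma cup_in_coboundaries_iff:
  assumes "group H"
  shows "cup_cochain 1 (one_cochain H b) (one_cochain H a) \<in> coboundaries H 2 \<longleftrightarrow> (\<exists>f. cup_exact H b a f)"
proof
  assume "cup_cochain 1 (one_cochain H b) (one_cochain H a) \<in> coboundaries H 2"
  then obtain f where f: "cup_cochain 1 (one_cochain H b) (one_cochain H a) = coboundary H 1 f"
    unfolding coboundaries_2 by blast
  have "cup_exact H b a (\<lambda>x. f [x])"
    unfolding cup_exact_def
  proof (intro ballI)
    fix x y assume "x \<in> carrier H" "y \<in> carrier H"
    then show "b x * a y = f [x] + f [y] - f [x \<otimes>\<^bsub>H\<^esub> y]"
      using fun_cong[OF f, of "[x, y]"] coboundary_two[of x H y f] by (simp add: cup_cochain_def)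
  qed
  then show "\<exists>f. cup_exact H b a f" by blast
next
  assume "\<exists>f. cup_exact H b a f"
  then obtain f where f: "cup_exact H b a f" by blast
  define F where "F xs = (if xs \<in> group_tuples H 1 then f (hd xs) else 0)" for xs
  have "F \<in> cochains H 1"
    by (simp add: F_def cochains_def)
  moreover have "cup_cochain 1 (one_cochain H b) (one_cochain H a) = coboundary H 1 F"
  proof
    fix xs show "cup_cochain 1 (one_cochain H b) (one_cochain H a) xs = coboundary H 1 F xs"
    proof (cases "xs \<in> group_tuples H 2")
      case True
      then obtain x y where xy: "x \<in> carrier H" "y \<in> carrier H" "xs = [x, y]"
        unfolding group_tuples_two by blast
      moreover have "x \<otimes>\<^bsub>H\<^esub> y \<in> carrier H"
        using xy assms by (simp add: group.is_monoid monoid.m_closed)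
      ultimately show ?thesis
        using f coboundary_two[of x H y F]
        by (simp add: cup_cochain_def F_def group_tuples_def cup_exact_def)
    next
      case False
      have "cup_cochain 1 (one_cochain H b) (one_cochain H a) xs = 0"
      proof (rule ccontr)
        assume "cup_cochain 1 (one_cochain H b) (one_cochain H a) xs \<noteq> 0"
        then have "take 1 xs \<in> group_tuples H 1" "drop 1 xs \<in> group_tuples H 1"
          by (auto simp: cup_cochain_def one_cochain_def split: if_splits)
        then have "xs \<in> group_tuples H 2"
          by (cases xs) (auto simp: group_tuples_def)
        then show False using False by simp
      qed
      then show ?thesis
        using False coboundary_outside[of xs H 1 F] by (simp add: numeral_2_eq_2)
    qed
  qed
  ultimately show "cup_cochain 1 (one_cochain H b) (one_cochain H a) \<in> coboundaries H 2"
    unfolding coboundaries_2 by blast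
qed

lemma coboundary_add: "coboundary H n (f + g) = coboundary H n f + coboundary H n g"
  by (auto simp: coboundary_def algebra_simps sum.distrib)

lemma coboundary_minus: "coboundary H n (- f) = - coboundary H n f"
  by (auto simp: coboundary_def sum_negf)

lemma coboundaries_2_subgroup:
  "0 \<in> coboundaries H 2"
  "f \<in> coboundaries H 2 \<Longrightarrow> g \<in> coboundaries H 2 \<Longrightarrow> f + g \<in> coboundaries H 2"
  "f \<in> coboundaries H 2 \<Longrightarrow> - f \<in> coboundaries H 2"
proof -
  have "coboundary H 1 0 = 0" "0 \<in> cochains H 1"
    by (auto simp: coboundary_def cochains_def fun_eq_iff)
  then show "0 \<in> coboundaries H 2"
    unfolding coboundaries_2 by (metis imageI)
  show "f + g \<in> coboundaries H 2" if "f \<in> coboundaries H 2" "g \<in> coboundaries H 2"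
  proof -
    obtain f' g' where "f' \<in> cochains H 1" "g' \<in> cochains H 1" "f = coboundary H 1 f'" "g = coboundary H 1 g'"
      using \<open>f \<in> _\<close> \<open>g \<in> _\<close> unfolding coboundaries_2 by blast
    moreover from this have "f' + g' \<in> cochains H 1"
      by (simp add: cochains_def)
    ultimately show ?thesis
      unfolding coboundaries_2 by (auto simp: coboundary_add[symmetric])
  qed
  show "- f \<in> coboundaries H 2" if "f \<in> coboundaries H 2"
  proof -
    obtain f' where "f' \<in> cochains H 1" "f = coboundary H 1 f'"
      using \<open>f \<in> _\<close> unfolding coboundaries_2 by blast
    moreover from this have "- f' \<in> cochains H 1"
      by (simp add: cochains_def)
    ultimately show ?thesis
      unfolding coboundaries_2 by (auto simp: coboundary_minus[symmetric])
  qed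
qed

lemma aomoto_cocycles_1:
  assumes "group H"
  shows "aomoto_cocycles H {one_cochain H h} 1 =
    (\<lambda>b. {one_cochain H b}) ` {b :: 'a \<Rightarrow> 'k::field. additive_on H b \<and> (\<exists>f. cup_exact H b h f)}"
proof -
  have "aomoto_diff H {one_cochain H h} 1 {one_cochain H b} = \<one>\<^bsub>group_cohomology H 2\<^esub> \<longleftrightarrow>
      (\<exists>f. cup_exact H b h f)" for b
  proof -
    have "aomoto_diff H {one_cochain H h} 1 {one_cochain H b} =
        (\<lambda>z. z + cup_cochain 1 (one_cochain H b) (one_cochain H h)) ` coboundaries H 2"
      by (simp add: aomoto_diff_def cup_product_def cohomology_class_def additive_r_coset
          numeral_2_eq_2[symmetric])
    then show ?thesis
      using additive_r_coset_eq_iff[OF coboundaries_2_subgroup, of H "cup_cochain 1 (one_cochain H b) (one_cochain H h)"]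
        cup_in_coboundaries_iff[OF assms, of b h]
      by (simp add: group_cohomology_def)
  qed
  then have eq: "{x \<in> (\<lambda>b. {one_cochain H b}) ` {b. additive_on H b}.
        aomoto_diff H {one_cochain H h} 1 x = \<one>\<^bsub>group_cohomology H 2\<^esub>} =
      (\<lambda>b. {one_cochain H b}) ` {b. additive_on H b \<and> (\<exists>f. cup_exact H b h f)}"
    by blast
  have two: "Suc 1 = 2" by simp
  show ?thesis
    unfolding aomoto_cocycles_def kernel_def carrier_cohomology_1[OF assms] two by (rule eq)
qed

text \<open>A cochain of degree 0 is a scalar, its value at the empty tuple, and every one is a
  cocycle; the differential multiplies that scalar by \<open>h\<close>.\<close>

lemma aomoto_coboundaries_1:
  "aomoto_coboundaries H {one_cochain H (h :: 'a \<Rightarrow> 'k::field)} 1 = range (\<lambda>c. {one_cochain H (\<lambda>x. c * h x)})"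
proof -
  have car: "carrier (group_cohomology H 0 :: ('a list \<Rightarrow> 'k) set monoid) = (\<lambda>f. {f}) ` cochains H 0"
    unfolding group_cohomology_def coboundaries_def FactGroup_def RCOSETS_def cocycles_def coboundary_0
    by (auto simp: additive_r_coset) (auto simp: additive_group_def)
  have diff: "aomoto_diff H {one_cochain H h} 0 {f} = {one_cochain H (\<lambda>x. f [] * h x)}" for f
  proof -
    have "aomoto_diff H {one_cochain H h} 0 {f} = {cup_cochain 0 f (one_cochain H h)}"
      using cohomology_class_1[of H] by (simp add: aomoto_diff_def cup_product_def)
    also have "cup_cochain 0 f (one_cochain H h) = one_cochain H (\<lambda>x. f [] * h x)"
      by (auto simp: cup_cochain_def one_cochain_def)
    finally show ?thesis .
  qed
  have "(\<lambda>f. f []) ` (cochains H 0 :: ('a list \<Rightarrow> 'k) set) = UNIV"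
  proof -
    have "c \<in> (\<lambda>f. f []) ` (cochains H 0 :: ('a list \<Rightarrow> 'k) set)" for c
      by (rule image_eqI[of _ _ "\<lambda>xs. if xs = [] then c else 0"])
        (auto simp: cochains_def group_tuples_def)
    then show ?thesis by blast
  qed
  then have "range (\<lambda>c. {one_cochain H (\<lambda>x. c * h x)}) =
      (\<lambda>c. {one_cochain H (\<lambda>x. c * h x)}) ` (\<lambda>f. f []) ` (cochains H 0 :: ('a list \<Rightarrow> 'k) set)"
    by simp
  also have "\<dots> = (\<lambda>f. {one_cochain H (\<lambda>x. f [] * h x)}) ` cochains H 0"
    by (simp only: image_image)
  finally show ?thesis
    unfolding aomoto_coboundaries_def by (simp add: car diff image_image)
qed

lemma additive_on_scale:
  assumes "additive_on H (h :: 'a \<Rightarrow> 'k::field)"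
  shows "additive_on H (\<lambda>x. c * h x)"
  using assms by (simp add: additive_on_def distrib_left)

text \<open>Polarization: \<open>h(xy)^2 - h(x)^2 - h(y)^2 = 2 h(x) h(y)\<close>. Characteristic 0
  enters through division by 2; the lemma makes the multiples of \<open>h\<close> Aomoto
  cocycles.\<close>

lemma cup_exact_self:
  assumes "additive_on H (h :: 'a \<Rightarrow> 'k::field_char_0)"
  shows "cup_exact H (\<lambda>x. c * h x) h (\<lambda>x. - (c * (h x)\<^sup>2 / 2))"
  using assms by (simp add: cup_exact_def additive_on_def power2_eq_square field_simps)

lemma aomoto_nontrivial_iff:
  assumes "group H" and h: "additive_on H (h :: 'a \<Rightarrow> 'k::field_char_0)"
  shows "\<not> trivial_group (aomoto_cohomology H {one_cochain H h} 1) \<longleftrightarrow> resonant H h"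
proof -
  let ?K = "aomoto_cocycles H {one_cochain H h} 1" and ?D = "aomoto_coboundaries H {one_cochain H h} 1"
  let ?M = "(group_cohomology H 1)\<lparr>carrier := ?K\<rparr>"
  have mult: "{x} \<otimes>\<^bsub>?M\<^esub> {y} = {x + y}" for x y
    using mult_cohomology_1 by simp
  have DK: "?D \<subseteq> ?K"
    unfolding aomoto_cocycles_1[OF assms(1)] aomoto_coboundaries_1
    using cup_exact_self[OF h] additive_on_scale[OF h] by blast
  have coset: "?D #>\<^bsub>?M\<^esub> {one_cochain H b} = range (\<lambda>c. {one_cochain H (\<lambda>x. c * h x + b x)})" for b
    unfolding aomoto_coboundaries_1 r_coset_def by (auto simp: mult[simplified] one_cochain_add)
  have "trivial_group (?M Mod ?D) \<longleftrightarrow> carrier ?M = ?D"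
  proof (rule trivial_group_Mod_iff)
    show "?D <#>\<^bsub>?M\<^esub> ?D = ?D"
    proof -
      have "?D <#>\<^bsub>?M\<^esub> ?D = (\<Union>c. range (\<lambda>c'. {one_cochain H (\<lambda>x. (c + c') * h x)}))"
        unfolding aomoto_coboundaries_1 set_mult_def
        by (auto simp: mult[simplified] one_cochain_add distrib_right)
      also have "\<dots> = ?D"
        unfolding aomoto_coboundaries_1
      proof (intro equalityI subsetI)
        fix z assume "z \<in> (\<Union>c. range (\<lambda>c'. {one_cochain H (\<lambda>x. (c + c') * h x)}))"
        then obtain c c' where "z = {one_cochain H (\<lambda>x. (c + c') * h x)}" by blast
        then show "z \<in> range (\<lambda>c. {one_cochain H (\<lambda>x. c * h x)})"
          by (rule range_eqI[of _ _ "c + c'"])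
      next
        fix z assume "z \<in> range (\<lambda>c. {one_cochain H (\<lambda>x. c * h x)})"
        then obtain c where "z = {one_cochain H (\<lambda>x. (0 + c) * h x)}" by auto
        then have "z \<in> range (\<lambda>c'. {one_cochain H (\<lambda>x. (0 + c') * h x)})"
          by (rule range_eqI[of _ _ c])
        then show "z \<in> (\<Union>c. range (\<lambda>c'. {one_cochain H (\<lambda>x. (c + c') * h x)}))"
          by (rule UN_I[OF UNIV_I])
      qed
      finally show ?thesis .
    qed
  next
    fix z assume "z \<in> carrier ?M"
    then obtain b where z: "z = {one_cochain H b}"
      using aomoto_cocycles_1[OF assms(1), of h] by auto
    show "?D #>\<^bsub>?M\<^esub> z = ?D \<longleftrightarrow> z \<in> ?D"
    proof
      assume "?D #>\<^bsub>?M\<^esub> z = ?D"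
      moreover have "z \<in> ?D #>\<^bsub>?M\<^esub> z"
        unfolding z coset by (rule range_eqI[of _ _ 0]) simp
      ultimately show "z \<in> ?D" by simp
    next
      assume "z \<in> ?D"
      then obtain c0 where c0: "z = {one_cochain H (\<lambda>x. c0 * h x)}"
        unfolding aomoto_coboundaries_1 by blast
      have "range (\<lambda>c. {one_cochain H (\<lambda>x. c * h x + c0 * h x)}) = ?D"
      proof -
        have "range (\<lambda>c. {one_cochain H (\<lambda>x. c * h x + c0 * h x)}) =
            (\<lambda>c. {one_cochain H (\<lambda>x. c * h x)}) ` range (\<lambda>c. c + c0)"
          by (simp only: image_image distrib_right)
        also have "range (\<lambda>c. c + c0) = UNIV"
          by (rule surjI[of _ "\<lambda>c. c - c0"]) simp
        finally show ?thesis
          unfolding aomoto_coboundaries_1 .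
      qed
      then show "?D #>\<^bsub>?M\<^esub> z = ?D"
        unfolding c0 coset .
    qed
  next
    show "?D \<noteq> {}" unfolding aomoto_coboundaries_1 by blast
  qed (use DK in simp)
  then have "\<not> trivial_group (aomoto_cohomology H {one_cochain H h} 1) \<longleftrightarrow> \<not> ?K \<subseteq> ?D"
    using DK by (auto simp: aomoto_cohomology_def)
  also have "\<dots> \<longleftrightarrow> resonant H h"
  proof -
    have "{one_cochain H b} \<in> range (\<lambda>c. {one_cochain H (\<lambda>x. c * h x)}) \<longleftrightarrow>
        (\<exists>c. \<forall>x \<in> carrier H. b x = c * h x)" for b
      by (auto simp: image_iff one_cochain_eq_iff)
    then show ?thesis
      unfolding aomoto_cocycles_1[OF assms(1)] aomoto_coboundaries_1 resonant_def image_subset_iff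
      by blast
  qed
  finally show ?thesis .
qed

lemma resonance_in_Hom_iff:
  assumes "group H"
  shows "h \<in> resonance_in_Hom H \<longleftrightarrow> h \<in> Hom H complex_group \<and> resonant H h"
proof -
  have "additive_on H h" if "h \<in> Hom H complex_group"
    using that by (auto simp: Hom_def hom_def additive_on_def additive_group_def)
  then show ?thesis
    using aomoto_nontrivial_iff[OF assms]
    by (auto simp: resonance_in_Hom_def resonance_1_1_def hom_class_eq carrier_cohomology_1[OF assms, simplified])
qed

section \<open>Eigenvectors modulo a subspace\<close>

text \<open>Split off one root \<open>\<mu>\<close> of \<open>q\<close> at a time. Either
  \<open>\<Theta> b - \<mu> b\<close> lies in \<open>U\<close> and \<open>b\<close> is the
  eigenvector, or that difference replaces \<open>b\<close> and is sent into \<open>U\<close> by the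
  quotient polynomial. The relation \<open>q\<close> takes the place of a characteristic polynomial,
  so \<open>E\<close> may be infinite dimensional.\<close>

lemma eigenvector_modulo_subspace:
  fixes \<Theta> :: "('a \<Rightarrow> 'k::alg_closed_field) \<Rightarrow> ('a \<Rightarrow> 'k)"
  assumes E: "\<And>f g c. f \<in> E \<Longrightarrow> g \<in> E \<Longrightarrow> (\<lambda>x. f x + c * g x) \<in> E"
    and U: "\<And>f c. f \<in> U \<Longrightarrow> (\<lambda>x. c * f x) \<in> U"
    and lin: "\<And>f g c. f \<in> E \<Longrightarrow> g \<in> E \<Longrightarrow> \<Theta> (\<lambda>x. f x + c * g x) = (\<lambda>x. \<Theta> f x + c * \<Theta> g x)"
    and \<Theta>: "\<And>f. f \<in> E \<Longrightarrow> \<Theta> f \<in> E"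
    and b: "b \<in> E" "b \<notin> U"
    and q: "q \<noteq> 0" "(\<lambda>x. \<Sum>i\<le>degree q. coeff q i * (\<Theta> ^^ i) b x) \<in> U"
  shows "\<exists>b' \<in> E. \<exists>\<mu>. b' \<notin> U \<and> (\<lambda>x. \<Theta> b' x - \<mu> * b' x) \<in> U"
  using b q
proof (induction "degree q" arbitrary: q b)
  case 0
  then obtain c where c: "q = [:c:]" "c \<noteq> 0"
    by (metis degree_eq_zeroE pCons_0_0)
  then have "(\<lambda>x. inverse c * (c * b x)) \<in> U"
    using U[of "\<lambda>x. c * b x" "inverse c"] 0 by simp
  then show ?case
    using 0 c by (simp add: mult.assoc[symmetric])
next
  case (Suc n)
  obtain \<mu> where "poly q \<mu> = 0"
    using Suc.hyps(2) alg_closed_imp_poly_has_root[of q] by auto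
  then obtain q' where q': "q = [:- \<mu>, 1:] * q'"
    by (metis dvdE poly_eq_0_iff_dvd)
  have q0: "q' \<noteq> 0" using q' Suc.prems(3) by auto
  have deg: "degree q' = n"
    using Suc.hyps(2) q0 unfolding q' by (subst (asm) degree_mult_eq) auto
  define b1 where "b1 = (\<lambda>x. \<Theta> b x - \<mu> * b x)"
  have pow: "(\<Theta> ^^ i) b \<in> E" for i
    by (induction i) (simp_all add: Suc.prems(1) \<Theta>)
  have "(\<lambda>x. \<Theta> b x + (- \<mu>) * b x) \<in> E"
    by (rule E) (simp_all add: Suc.prems \<Theta>)
  then have b1: "b1 \<in> E" by (simp add: b1_def)
  have b1_pow: "(\<Theta> ^^ i) b1 = (\<lambda>x. (\<Theta> ^^ Suc i) b x - \<mu> * (\<Theta> ^^ i) b x)" for i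
  proof (induction i)
    case (Suc i)
    have "(\<Theta> ^^ Suc i) b1 = \<Theta> (\<lambda>x. (\<Theta> ^^ Suc i) b x + (- \<mu>) * (\<Theta> ^^ i) b x)"
      using Suc by simp
    also have "\<dots> = (\<lambda>x. \<Theta> ((\<Theta> ^^ Suc i) b) x + (- \<mu>) * \<Theta> ((\<Theta> ^^ i) b) x)"
      by (rule lin[OF pow pow])
    finally show ?case by simp
  qed (simp add: b1_def)
  show ?case
  proof (cases "b1 \<in> U")
    case True
    then show ?thesis
      using Suc.prems(1,2) unfolding b1_def by blast
  next
    case False
    have "(\<Sum>i\<le>degree q'. coeff q' i * (\<Theta> ^^ i) b1 x) = (\<Sum>i\<le>degree q. coeff q i * (\<Theta> ^^ i) b x)" for x
    proof -
      have cf: "coeff q i = coeff (pCons 0 q') i - \<mu> * coeff q' i" for i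
        unfolding q' by (simp add: mult_pCons_left)
      have "(\<Sum>i\<le>degree q. coeff q i * (\<Theta> ^^ i) b x) =
          (\<Sum>i\<le>Suc n. coeff (pCons 0 q') i * (\<Theta> ^^ i) b x) - (\<Sum>i\<le>Suc n. \<mu> * coeff q' i * (\<Theta> ^^ i) b x)"
        unfolding cf Suc.hyps(2)[symmetric] by (simp only: left_diff_distrib sum_subtractf)
      also have "(\<Sum>i\<le>Suc n. coeff (pCons 0 q') i * (\<Theta> ^^ i) b x) = (\<Sum>i\<le>n. coeff q' i * (\<Theta> ^^ Suc i) b x)"
        by (subst sum.atMost_Suc_shift) simp
      also have "(\<Sum>i\<le>Suc n. \<mu> * coeff q' i * (\<Theta> ^^ i) b x) = (\<Sum>i\<le>n. \<mu> * coeff q' i * (\<Theta> ^^ i) b x)"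
        using deg by (simp add: coeff_eq_0)
      also have "(\<Sum>i\<le>n. coeff q' i * (\<Theta> ^^ Suc i) b x) - (\<Sum>i\<le>n. \<mu> * coeff q' i * (\<Theta> ^^ i) b x) =
          (\<Sum>i\<le>degree q'. coeff q' i * (\<Theta> ^^ i) b1 x)"
        unfolding b1_pow deg sum_subtractf[symmetric] by (intro sum.cong HOL.refl) (simp only: algebra_simps)
      finally show ?thesis by simp
    qed
    then have "(\<lambda>x. \<Sum>i\<le>degree q'. coeff q' i * (\<Theta> ^^ i) b1 x) \<in> U"
      using Suc.prems(4) by simp
    then show ?thesis
      using Suc.hyps(1)[of q' b1] deg b1 False q0 by blast
  qed
qed

text \<open>Each point of \<open>S\<close> is one linear condition on the coefficients, and two
  solutions can be combined to meet one more condition. The clause on coefficients below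
  \<open>n\<close> lets the second solution begin above the degree of the first, so the combination
  cannot cancel to 0.\<close>

lemma polynomial_relation:
  fixes h :: "nat \<Rightarrow> 'a \<Rightarrow> 'k::field"
  assumes "finite S"
  shows "\<exists>q. q \<noteq> 0 \<and> (\<forall>i<n. coeff q i = 0) \<and> (\<forall>s \<in> S. (\<Sum>i\<le>degree q. coeff q i * h i s) = 0)"
  using assms
proof (induction S arbitrary: n rule: finite_induct)
  case empty
  show ?case
    by (rule exI[of _ "monom 1 n"]) auto
next
  case (insert s S)
  define ev where "ev q s = (\<Sum>i\<le>degree q. coeff q i * h i s)" for q s
  have ev: "ev q s = (\<Sum>i\<le>m. coeff q i * h i s)" if "degree q \<le> m" for q m s
    unfolding ev_def using that by (intro sum.mono_neutral_left) (auto simp: coeff_eq_0)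
  obtain q1 where q1: "q1 \<noteq> 0" "\<forall>i<n. coeff q1 i = 0" "\<And>t. t \<in> S \<Longrightarrow> ev q1 t = 0"
    using insert.IH[of n] unfolding ev_def by blast
  obtain q2 where q2: "q2 \<noteq> 0" "\<forall>i<max n (Suc (degree q1)). coeff q2 i = 0" "\<And>t. t \<in> S \<Longrightarrow> ev q2 t = 0"
    using insert.IH[of "max n (Suc (degree q1))"] unfolding ev_def by blast
  show ?case
  proof (cases "ev q2 s = 0")
    case True
    then show ?thesis
      using q2 unfolding ev_def by (intro exI[of _ q2]) auto
  next
    case False
    define q where "q = smult (ev q2 s) q1 - smult (ev q1 s) q2"
    have "coeff q (degree q1) \<noteq> 0"
      using q1(1) q2(2) False by (simp add: q_def)
    then have "q \<noteq> 0" by auto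
    moreover have "\<forall>i<n. coeff q i = 0"
      using q1(2) q2(2) by (simp add: q_def)
    moreover have "ev q t = ev q2 s * ev q1 t - ev q1 s * ev q2 t" for t
    proof -
      let ?m = "max (degree q) (max (degree q1) (degree q2))"
      have "ev q t = (\<Sum>i\<le>?m. coeff q i * h i t)" by (rule ev) simp
      also have "\<dots> = ev q2 s * (\<Sum>i\<le>?m. coeff q1 i * h i t) - ev q1 s * (\<Sum>i\<le>?m. coeff q2 i * h i t)"
        by (simp add: q_def left_diff_distrib sum_subtractf sum_distrib_left mult.assoc)
      also have "(\<Sum>i\<le>?m. coeff q1 i * h i t) = ev q1 t" by (rule ev[symmetric]) simp
      also have "(\<Sum>i\<le>?m. coeff q2 i * h i t) = ev q2 t" by (rule ev[symmetric]) simp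
      finally show ?thesis .
    qed
    ultimately show ?thesis
      using q1(3) q2(3) unfolding ev_def[symmetric] by (intro exI[of _ q]) (auto simp: mult.commute)
  qed
qed

section \<open>Resonance and restriction to the kernel\<close>

context int_extension
begin

lemma additive_on_NG: "additive_on NG w \<longleftrightarrow> (\<forall>x \<in> N. \<forall>y \<in> N. w (x \<otimes> y) = w x + w y)"
  by (simp add: additive_on_def)

lemma cup_exact_NG:
  "cup_exact NG b a f \<longleftrightarrow> (\<forall>x \<in> N. \<forall>y \<in> N. b x * a y = f x + f y - f (x \<otimes> y))"
  by (simp add: cup_exact_def)

lemma additive_invariant:
  fixes w :: "'a \<Rightarrow> complex"
  assumes "trivial_action_on_homology G N 1" "additive_on NG w" "x \<in> N"
  shows "w (cj i x) = w x"
  using invariant_cj[OF hom_invariant[OF assms(1)] assms(3)] assms(2) by (simp add: additive_on_NG)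

lemma additive_tau_pow:
  fixes k :: "'a \<Rightarrow> 'k::field"
  assumes k: "additive_on G k" "\<And>x. x \<in> N \<Longrightarrow> k x = 0" and g: "g \<in> carrier G"
  shows "k g = k \<tau> * of_int (\<chi> g)"
proof -
  have mult: "k (x \<otimes> y) = k x + k y" if "x \<in> carrier G" "y \<in> carrier G" for x y
    using k(1) that by (simp add: additive_on_def)
  have "k \<one> = 0" by (simp add: k(2))
  then have inv: "k (inv x) = - k x" if "x \<in> carrier G" for x
    using mult[OF that, of "inv x"] that by (simp add: eq_neg_iff_add_eq_0 add.commute)
  have nat: "k (\<tau> [^] n) = k \<tau> * of_nat n" for n :: nat
    using \<open>k \<one> = 0\<close> tau by (induction n) (simp_all add: mult algebra_simps)
  have "k (\<tau> [^] i) = k \<tau> * of_int i" for i :: int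
    using tau by (cases i rule: int_cases2) (simp_all add: int_pow_int int_pow_neg nat inv)
  moreover have "g = nrm g \<otimes> \<tau> [^] \<chi> g"
    using g by (simp add: nrm_def m_assoc)
  ultimately show ?thesis
    using mult[of "nrm g" "\<tau> [^] \<chi> g"] k(2)[of "nrm g"] g by simp
qed

text \<open>If \<open>a\<close> vanishes on \<open>N\<close>, then \<open>b0\<close> is a witness.
  Otherwise the witness \<open>b\<close> on \<open>G\<close> restricts to one on \<open>N\<close>:
  were \<open>b = c a\<close> on \<open>N\<close>, then \<open>k = b - c a\<close> would be a
  multiple of \<open>\<chi>\<close>, and a primitive of the product of \<open>k\<close> and
  \<open>a\<close> would be a homomorphism on \<open>N\<close>. Its invariance under
  \<open>\<tau>\<close> gives \<open>k(\<tau>) a = 0\<close> on \<open>N\<close>.\<close>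

lemma resonant_restrict:
  fixes a b0 :: "'a \<Rightarrow> complex"
  assumes H1: "trivial_action_on_homology G N 1"
    and nz: "additive_on NG b0" "\<not> (\<forall>x \<in> N. b0 x = 0)"
    and a: "additive_on G a" "resonant G a"
  shows "resonant NG a"
proof (cases "\<forall>x \<in> N. a x = 0")
  case True
  then have "cup_exact NG b0 a (\<lambda>_. 0)"
    by (simp add: cup_exact_NG)
  then show ?thesis
    unfolding resonant_def using nz True by auto
next
  case False
  obtain b f where b: "additive_on G b" "cup_exact G b a f" "\<not> (\<exists>c. \<forall>x \<in> carrier G. b x = c * a x)"
    using a(2) unfolding resonant_def by blast
  have "\<not> (\<exists>c. \<forall>x \<in> N. b x = c * a x)"
  proof
    assume "\<exists>c. \<forall>x \<in> N. b x = c * a x"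
    then obtain c where c: "\<And>x. x \<in> N \<Longrightarrow> b x = c * a x" by blast
    define k where "k x = b x - c * a x" for x
    \<comment> \<open>The correction is a primitive for the product of \<open>- c a\<close> with
      \<open>a\<close>.\<close>
    define f' where "f' x = f x + c * (a x)\<^sup>2 / 2" for x
    have k: "additive_on G k" "\<And>x. x \<in> N \<Longrightarrow> k x = 0"
      using b(1) a(1) c by (auto simp: k_def additive_on_def algebra_simps)
    have f': "k x * a y = f' x + f' y - f' (x \<otimes> y)" if "x \<in> carrier G" "y \<in> carrier G" for x y
    proof -
      have "b x * a y = f x + f y - f (x \<otimes> y)" "a (x \<otimes> y) = a x + a y"
        using that b(2) a(1) by (auto simp: cup_exact_def additive_on_def)
      then have eq: "f (x \<otimes> y) = f x + f y - b x * a y" "a (x \<otimes> y) = a x + a y"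
        by simp_all
      show ?thesis
        unfolding k_def f'_def eq by (simp add: power2_eq_square field_simps)
    qed
    have "additive_on NG f'"
      unfolding additive_on_NG
    proof (intro ballI)
      fix x y assume "x \<in> N" "y \<in> N"
      then show "f' (x \<otimes> y) = f' x + f' y"
        using f'[of x y] k(2)[of x] by simp
    qed
    then have inv: "f' (cj 1 x) = f' x" if "x \<in> N" for x
      using additive_invariant[OF H1] that by blast
    have k\<tau>: "k \<tau> \<noteq> 0"
    proof
      assume "k \<tau> = 0"
      then have "b x = c * a x" if "x \<in> carrier G" for x
        using additive_tau_pow[OF k that] by (simp add: k_def)
      then show False using b(3) by blast
    qed
    have "a x = 0" if x: "x \<in> N" for x
    proof -
      \<comment> \<open>The two ways of writing this element give two values of \<open>f'\<close>;
        their comparison isolates \<open>k \<tau> * a x\<close>.\<close>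
      have "cj 1 x \<otimes> \<tau> = \<tau> \<otimes> x"
        using x tau by (simp add: cj_def m_assoc)
      moreover have "0 = f' (cj 1 x) + f' \<tau> - f' (cj 1 x \<otimes> \<tau>)"
        using f'[of "cj 1 x" \<tau>] k(2)[of "cj 1 x"] x tau by simp
      moreover have "k \<tau> * a x = f' \<tau> + f' x - f' (\<tau> \<otimes> x)"
        using f'[of \<tau> x] x tau by simp
      ultimately have "k \<tau> * a x = 0"
        using inv[OF x] by (simp add: add.commute)
      then show ?thesis using k\<tau> by simp
    qed
    then show False using False by blast
  qed
  moreover have "additive_on NG b" "cup_exact NG b a f"
    using b(1,2) unfolding additive_on_NG cup_exact_NG unfolding additive_on_def cup_exact_def
    by (meson N_closed)+
  ultimately show ?thesis
    unfolding resonant_def by (intro exI[of _ b] exI[of _ f]) simp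
qed

text \<open>A primitive \<open>f\<close> of \<open>b \<union> a\<close> on the kernel changes under \<open>\<tau>\<close> by a homomorphism \<open>\<Theta> b\<close>. If \<open>b\<close> is an
  eigenvector of \<open>\<Theta>\<close> modulo \<open>a\<close>, then suitable extensions of \<open>b\<close> and \<open>a\<close> to \<open>G\<close> have
  an exact cup product.\<close>

lemma resonant_extend_eigenvector:
  fixes a b :: "'a \<Rightarrow> complex"
  assumes H1: "trivial_action_on_homology G N 1"
    and a: "additive_on NG a" and b: "additive_on NG b" and f: "cup_exact NG b a f"
    and nprop: "\<not> (\<exists>c. \<forall>x \<in> N. b x = c * a x)"
    and eig: "\<And>x. x \<in> N \<Longrightarrow> f (cj 1 x) - f x = z * b x + \<eta> * a x"
  shows "additive_on G (\<lambda>g. a (nrm g) + z * of_int (\<chi> g)) \<and>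
    resonant G (\<lambda>g. a (nrm g) + z * of_int (\<chi> g))"
proof -
  have inv: "a (cj i x) = a x" "b (cj i x) = b x" if "x \<in> N" for i x
    using additive_invariant[OF H1] a b that by blast+
  have am: "a (x \<otimes> y) = a x + a y" "b (x \<otimes> y) = b x + b y" "f (x \<otimes> y) = f x + f y - b x * a y"
    if "x \<in> N" "y \<in> N" for x y
    using a b f that by (auto simp: additive_on_NG cup_exact_NG)
  have f_cj: "f (cj i x) = f x + of_int i * (z * b x + \<eta> * a x)" if x: "x \<in> N" for i x
  proof -
    have step: "f (cj (i + 1) x) = f (cj i x) + (z * b x + \<eta> * a x)" for i
      using eig[of "cj i x"] x inv[OF x, of i] cj_cj[of x 1 i] by (simp add: algebra_simps)
    show ?thesis
    proof (induction i rule: int_induct[where k = 0])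
      case (step2 i)
      then show ?case using step[of "i - 1"] by (simp add: algebra_simps)
    qed (use x step in \<open>simp_all add: algebra_simps\<close>)
  qed
  \<comment> \<open>All constants are forced. Writing \<open>\<tau> x\<close> as
    \<open>cj 1 x\<close> times \<open>\<tau>\<close> and comparing primitives gives
    \<open>f (cj 1 x) - f x = A(\<tau>) b x - B(\<tau>) a x\<close>, whence
    \<open>A(\<tau>) = z\<close> and \<open>B(\<tau>) = - \<eta>\<close>. Then \<open>F\<close> is
    determined by \<open>F(n \<tau>^i) = f n + F(\<tau>^i) - b n * (z i)\<close>, with
    \<open>F(\<tau>^i) = \<eta> z i^2 / 2\<close>.\<close>
  define A where "A g = a (nrm g) + z * of_int (\<chi> g)" for g
  define B where "B g = b (nrm g) - \<eta> * of_int (\<chi> g)" for g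
  define F where "F g = f (nrm g) - z * of_int (\<chi> g) * b (nrm g) + \<eta> * z / 2 * (of_int (\<chi> g))\<^sup>2" for g
  have "additive_on G A" "additive_on G B"
    by (auto simp: additive_on_def A_def B_def nrm_mult chi_mult am inv algebra_simps)
  moreover have "cup_exact G B A F"
    unfolding cup_exact_def
  proof (intro ballI)
    fix g h assume gh: "g \<in> carrier G" "h \<in> carrier G"
    have F: "F (g \<otimes> h) = f (nrm g) + (f (nrm h) + of_int (\<chi> g) * (z * b (nrm h) + \<eta> * a (nrm h)))
        - b (nrm g) * a (nrm h) - z * (of_int (\<chi> g) + of_int (\<chi> h)) * (b (nrm g) + b (nrm h))
        + \<eta> * z / 2 * (of_int (\<chi> g) + of_int (\<chi> h))\<^sup>2"
      using gh by (simp add: F_def nrm_mult chi_mult am inv f_cj)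
    show "B g * A h = F g + F h - F (g \<otimes> h)"
      unfolding F by (simp add: A_def B_def F_def power2_eq_square field_simps)
  qed
  moreover have "\<not> (\<exists>c. \<forall>x \<in> carrier G. B x = c * A x)"
  proof
    assume "\<exists>c. \<forall>x \<in> carrier G. B x = c * A x"
    then obtain c where c: "\<And>x. x \<in> carrier G \<Longrightarrow> B x = c * A x" by blast
    have "b x = c * a x" if "x \<in> N" for x
      using c[of x] that by (simp add: A_def B_def mem_N[THEN iffD1])
    then show False using nprop by blast
  qed
  ultimately show ?thesis
    unfolding resonant_def A_def[abs_def] by blast
qed

text \<open>Two primitives of the same product differ by a homomorphism of \<open>N\<close>, which
  is invariant; so \<open>\<Theta>\<close> is independent of the chosen primitives and linear. The
  finite set \<open>S\<close> detects homomorphisms, which yields a polynomial relation among the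
  iterates of \<open>\<Theta>\<close> on \<open>b\<close> and hence an eigenvector modulo the
  multiples of \<open>a\<close>.\<close>

lemma resonant_extend:
  fixes a :: "'a \<Rightarrow> complex"
  assumes H1: "trivial_action_on_homology G N 1" and H2: "trivial_action_on_homology G N 2"
    and S: "finite S" "S \<subseteq> N" "\<And>w :: 'a \<Rightarrow> complex. additive_on NG w \<Longrightarrow> invariant w \<Longrightarrow>
      (\<And>s. s \<in> S \<Longrightarrow> w s = 0) \<Longrightarrow> (\<And>x. x \<in> N \<Longrightarrow> w x = 0)"
    and a: "additive_on NG a" "resonant NG a"
  shows "\<exists>A. additive_on G A \<and> resonant G A \<and> (\<forall>x \<in> N. A x = a x)"
proof -
  define E where "E = {b. additive_on NG b \<and> (\<exists>f. cup_exact NG b a f)}"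
  define U where "U = {b \<in> E. \<exists>c. \<forall>x \<in> N. b x = c * a x}"
  define prim where "prim b = (SOME f. cup_exact NG b a f)" for b
  have prim: "cup_exact NG b a (prim b)" if "b \<in> E" for b
    using that unfolding E_def prim_def by (metis (mono_tags, lifting) mem_Collect_eq someI_ex)
  \<comment> \<open>The value 0 off \<open>N\<close> makes linearity of \<open>\<Theta>\<close> an
    equality of functions.\<close>
  define \<Theta> where "\<Theta> b x = (if x \<in> N then prim b (cj 1 x) - prim b x else 0)" for b x
  have inv: "w (cj 1 x) = w x" if "additive_on NG w" "x \<in> N" for w :: "'a \<Rightarrow> complex" and x
    using additive_invariant[OF H1 that] .
  have primitive_unique: "f (cj 1 x) - f x = g (cj 1 x) - g x"
    if "cup_exact NG b a f" "cup_exact NG b a g" "x \<in> N" for b f g x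
  proof -
    have "additive_on NG (\<lambda>x. f x - g x)"
      unfolding additive_on_NG
    proof (intro ballI)
      fix x y assume "x \<in> N" "y \<in> N"
      then have "f x + f y - f (x \<otimes> y) = g x + g y - g (x \<otimes> y)"
        using that(1,2) unfolding cup_exact_NG by metis
      then show "f (x \<otimes> y) - g (x \<otimes> y) = f x - g x + (f y - g y)"
        by (simp add: algebra_simps)
    qed
    from inv[OF this that(3)] show ?thesis by (simp add: algebra_simps)
  qed
  have \<Theta>_eq: "\<Theta> b x = f (cj 1 x) - f x" if "cup_exact NG b a f" "b \<in> E" "x \<in> N" for b f x
    using primitive_unique[OF prim[OF that(2)] that(1,3)] that(3) by (simp add: \<Theta>_def)
  have \<Theta>E: "\<Theta> b \<in> E" if b: "b \<in> E" for b
  proof -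
    have ab: "additive_on NG b" using b by (simp add: E_def)
    let ?f = "prim b"
    have f: "?f (x \<otimes> y) = ?f x + ?f y - b x * a y" if "x \<in> N" "y \<in> N" for x y
      using prim[OF b] that by (simp add: cup_exact_NG)
    have abm: "a (x \<otimes> y) = a x + a y" "b (x \<otimes> y) = b x + b y" if "x \<in> N" "y \<in> N" for x y
      using a(1) ab that by (auto simp: additive_on_NG)
    have "additive_on NG (\<Theta> b)"
      by (simp add: additive_on_NG \<Theta>_def cj_mult f inv[OF a(1)] inv[OF ab])
    moreover have "\<exists>u. cup_exact NG (\<Theta> b) a u"
    proof -
      \<comment> \<open>A Massey product of \<open>b\<close>, \<open>a\<close>, \<open>a\<close>:
        both terms of \<open>w\<close> have coboundary \<open>b x * a y * a z\<close>, so
        \<open>w\<close> is a cocycle. As \<open>a\<close> and \<open>b\<close> are invariant, only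
        the factor \<open>?f\<close> changes under \<open>\<tau>\<close>, and it changes by
        \<open>\<Theta> b\<close>.\<close>
      define w where "w x y = ?f x * a y - b x * (a y)\<^sup>2 / 2" for x y
      have "w y z - w (x \<otimes> y) z + w x (y \<otimes> z) - w x y = 0" if "x \<in> N" "y \<in> N" "z \<in> N" for x y z
        using that by (simp add: w_def f abm power2_eq_square field_simps)
      then obtain u where "\<And>x y. x \<in> N \<Longrightarrow> y \<in> N \<Longrightarrow>
          w (cj 1 x) (cj 1 y) - w x y = u x + u y - u (x \<otimes> y)"
        using cocycle2_invariant[OF H2, of w] by blast
      moreover have "w (cj 1 x) (cj 1 y) - w x y = \<Theta> b x * a y" if "x \<in> N" "y \<in> N" for x y
        using that by (simp add: w_def \<Theta>_def inv[OF a(1)] inv[OF ab] algebra_simps)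
      ultimately show ?thesis
        unfolding cup_exact_NG by metis
    qed
    ultimately show ?thesis by (simp add: E_def)
  qed
  have cup_lin: "cup_exact NG (\<lambda>x. b x + c * b' x) a (\<lambda>x. f x + c * f' x)"
    if "cup_exact NG b a f" "cup_exact NG b' a f'" for b b' f f' c
    unfolding cup_exact_NG
  proof (intro ballI)
    fix x y assume "x \<in> N" "y \<in> N"
    then have e: "b x * a y = f x + f y - f (x \<otimes> y)" "b' x * a y = f' x + f' y - f' (x \<otimes> y)"
      using that by (simp_all add: cup_exact_NG)
    have "(b x + c * b' x) * a y = b x * a y + c * (b' x * a y)"
      by (simp add: algebra_simps)
    then show "(b x + c * b' x) * a y = f x + c * f' x + (f y + c * f' y) - (f (x \<otimes> y) + c * f' (x \<otimes> y))"
      unfolding e by (simp add: algebra_simps)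
  qed
  have E_lin: "(\<lambda>x. b x + c * b' x) \<in> E" if "b \<in> E" "b' \<in> E" for b b' c
    using that cup_lin unfolding E_def by (auto simp: additive_on_NG algebra_simps) blast
  have lin: "\<Theta> (\<lambda>x. b x + c * b' x) = (\<lambda>x. \<Theta> b x + c * \<Theta> b' x)" if "b \<in> E" "b' \<in> E" for b b' c
  proof
    fix x show "\<Theta> (\<lambda>x. b x + c * b' x) x = \<Theta> b x + c * \<Theta> b' x"
    proof (cases "x \<in> N")
      case True
      show ?thesis
        using \<Theta>_eq[OF cup_lin[OF prim[OF that(1)] prim[OF that(2)]] E_lin[OF that] True] True
        by (simp add: \<Theta>_def algebra_simps)
    qed (simp add: \<Theta>_def)
  qed
  have zeroE: "b \<in> E" if "\<And>x. x \<in> N \<Longrightarrow> b x = 0" for b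
  proof -
    have "cup_exact NG b a (\<lambda>_. 0)" "additive_on NG b"
      using that by (auto simp: cup_exact_NG additive_on_NG)
    then show ?thesis by (auto simp: E_def)
  qed
  show ?thesis
  proof (cases "\<forall>x \<in> N. a x = 0")
    case True
    \<comment> \<open>Here the extension is 0, and \<open>\<chi>\<close> is a class outside the
      multiples of 0 whose product with 0 is exact.\<close>
    have "additive_on G (\<lambda>g. of_int (\<chi> g) :: complex)"
      by (simp add: additive_on_def chi_mult)
    moreover have "\<chi> \<tau> \<noteq> 0" "\<tau> \<in> carrier G"
      using tau by auto
    ultimately have "resonant G (\<lambda>_. 0 :: complex)"
      unfolding resonant_def
      by (intro exI[of _ "\<lambda>g. of_int (\<chi> g)"] exI[of _ "\<lambda>_. 0"]) (auto simp: cup_exact_def)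
    then show ?thesis
      using True by (intro exI[of _ "\<lambda>_. 0"]) (auto simp: additive_on_def)
  next
    case False
    obtain b where b: "b \<in> E" "b \<notin> U"
      using a(2) unfolding resonant_def U_def E_def by auto
    obtain q where q: "q \<noteq> 0" "\<And>s. s \<in> S \<Longrightarrow> (\<Sum>i\<le>degree q. coeff q i * (\<Theta> ^^ i) b s) = 0"
      using polynomial_relation[OF S(1), of 0 "\<lambda>i. (\<Theta> ^^ i) b"] by blast
    have pow: "(\<Theta> ^^ i) b \<in> E" for i
      by (induction i) (simp_all add: b \<Theta>E)
    have "additive_on NG ((\<Theta> ^^ i) b)" for i
      using pow[of i] by (simp add: E_def)
    then have r: "additive_on NG (\<lambda>x. \<Sum>i\<le>degree q. coeff q i * (\<Theta> ^^ i) b x)"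
      unfolding additive_on_NG by (simp add: distrib_left sum.distrib)
    have qz: "(\<Sum>i\<le>degree q. coeff q i * (\<Theta> ^^ i) b x) = 0" if "x \<in> N" for x
    proof (rule S(3)[OF r _ _ that])
      show "invariant (\<lambda>x. \<Sum>i\<le>degree q. coeff q i * (\<Theta> ^^ i) b x)"
        unfolding invariant_def using inv[OF r] by blast
    qed (rule q(2))
    have "(\<lambda>x. \<Sum>i\<le>degree q. coeff q i * (\<Theta> ^^ i) b x) \<in> U"
      unfolding U_def using zeroE qz by (auto intro!: exI[of _ 0])
    moreover have "(\<lambda>x. c * u x) \<in> U" if "u \<in> U" for u c
    proof -
      obtain d where d: "u \<in> E" "\<And>x. x \<in> N \<Longrightarrow> u x = d * a x"
        using \<open>u \<in> U\<close> unfolding U_def by blast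
      have "(\<lambda>x. 0 + c * u x) \<in> E"
        by (rule E_lin[OF zeroE d(1)]) simp
      then show ?thesis
        unfolding U_def using d(2) by (auto intro!: exI[of _ "c * d"])
    qed
    ultimately obtain b' z where b': "b' \<in> E" "b' \<notin> U" "(\<lambda>x. \<Theta> b' x - z * b' x) \<in> U"
      using eigenvector_modulo_subspace[of E U \<Theta> b q] E_lin lin \<Theta>E b q(1) by blast
    obtain \<eta> where \<eta>: "\<And>x. x \<in> N \<Longrightarrow> \<Theta> b' x - z * b' x = \<eta> * a x"
      using b'(3) unfolding U_def by blast
    have "prim b' (cj 1 x) - prim b' x = z * b' x + \<eta> * a x" if "x \<in> N" for x
      using \<eta>[OF that] that by (simp add: \<Theta>_def algebra_simps)
    moreover have "\<not> (\<exists>c. \<forall>x \<in> N. b' x = c * a x)" "additive_on NG b'"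
      using b'(1,2) by (auto simp: U_def E_def)
    ultimately have "additive_on G (\<lambda>g. a (nrm g) + z * of_int (\<chi> g)) \<and>
        resonant G (\<lambda>g. a (nrm g) + z * of_int (\<chi> g))"
      using resonant_extend_eigenvector[OF H1 a(1) _ prim[OF b'(1)]] by blast
    moreover have "a (nrm x) + z * of_int (\<chi> x) = a x" if "x \<in> N" for x
      using that by (simp add: mem_N[THEN iffD1])
    ultimately show ?thesis by blast
  qed
qed

end

section \<open>Derivations and restriction to the kernel\<close>

context int_extension
begin

lemma mult_char_NG: "mult_char G \<sigma> \<Longrightarrow> mult_char NG \<sigma>"
  by (simp add: mult_char_def)

text \<open>If \<open>d\<close> is principal on \<open>N\<close>, subtract that principal derivation
  so that it vanishes on \<open>N\<close>. Comparing \<open>x g\<close> with \<open>g\<close> times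
  the conjugate of \<open>x\<close> then gives \<open>d' g = \<sigma> x * d' g\<close>, and
  \<open>\<sigma> x\<close> is not 1.\<close>

lemma nonprincipal_restrict:
  fixes \<sigma> :: "'a \<Rightarrow> 'k::field"
  assumes \<sigma>: "mult_char G \<sigma>" and d: "derivation G \<sigma> d" "\<not> principal G \<sigma> d"
    and x: "x \<in> N" "\<sigma> x \<noteq> 1"
  shows "derivation NG \<sigma> d" "\<not> principal NG \<sigma> d"
proof -
  show "derivation NG \<sigma> d"
    using d(1) by (simp add: derivation_def)
  show "\<not> principal NG \<sigma> d"
  proof
    assume "principal NG \<sigma> d"
    then obtain c where c: "\<And>x. x \<in> N \<Longrightarrow> d x = (\<sigma> x - 1) * c"
      by (auto simp: principal_def)
    define d' where "d' g = d g - (\<sigma> g - 1) * c" for g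
    have d': "d' (g \<otimes> h) = d' g + \<sigma> g * d' h" if "g \<in> carrier G" "h \<in> carrier G" for g h
      using d(1) mult_charD(2)[OF \<sigma> that] that by (simp add: d'_def derivation_def algebra_simps)
    have d'N: "d' x = 0" if "x \<in> N" for x
      using c[OF that] by (simp add: d'_def)
    have "d' g = 0" if g: "g \<in> carrier G" for g
    proof -
      let ?x' = "inv g \<otimes> x \<otimes> g"
      have x': "?x' \<in> N"
        using N_conj[OF inv_closed[OF g] x(1)] g by simp
      have "g \<otimes> ?x' = x \<otimes> g"
      proof -
        have "g \<otimes> ?x' = g \<otimes> inv g \<otimes> x \<otimes> g"
          using g x(1) by (simp only: m_assoc m_closed inv_closed N_closed)
        then show ?thesis using g x(1) by simp
      qed
      then have "d' g = \<sigma> x * d' g"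
        using d'[OF g N_closed[OF x']] d'[OF N_closed[OF x(1)] g] d'N[OF x'] d'N[OF x(1)] by simp
      then show ?thesis using x(2) by simp
    qed
    then show False
      using d(2) by (auto simp: principal_def d'_def)
  qed
qed

lemma cj_one_minus_one: "x \<in> N \<Longrightarrow> cj 1 (cj (- 1) x) = x"
  by (simp add: cj_cj)

text \<open>The extension takes the value \<open>\<mu>\<close> at \<open>\<tau>\<close> for the
  character and \<open>- c\<close> for the derivation. The eigenvector equation is exactly
  compatibility of these values with \<open>\<tau> x\<close> being \<open>cj 1 x\<close> times
  \<open>\<tau>\<close>.\<close>

lemma derivation_extend:
  fixes \<sigma> :: "'a \<Rightarrow> 'k::field"
  assumes \<sigma>: "mult_char NG \<sigma>" "invariant \<sigma>"
    and \<phi>: "derivation NG \<sigma> \<phi>" "\<not> principal NG \<sigma> \<phi>"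
    and eig: "principal NG \<sigma> (\<lambda>x. \<phi> (cj 1 x) - \<mu> * \<phi> x)"
  shows "\<exists>\<rho> \<delta>. mult_char G \<rho> \<and> (\<forall>x \<in> N. \<rho> x = \<sigma> x) \<and> derivation G \<rho> \<delta> \<and> \<not> principal G \<rho> \<delta>"
proof -
  obtain c where "\<And>x. x \<in> N \<Longrightarrow> \<phi> (cj 1 x) - \<mu> * \<phi> x = (\<sigma> x - 1) * c"
    using eig by (auto simp: principal_def)
  then have c: "\<phi> (cj 1 x) = \<mu> * \<phi> x + (\<sigma> x - 1) * c" if "x \<in> N" for x
    using that by (metis add.commute diff_add_cancel)
  have \<sigma>inv: "\<sigma> (cj i x) = \<sigma> x" if "x \<in> N" for i x
    using invariant_cj[OF \<sigma>(2) that] .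
  have \<sigma>m: "\<sigma> (x \<otimes> y) = \<sigma> x * \<sigma> y" "\<sigma> x \<noteq> 0" if "x \<in> N" "y \<in> N" for x y
    using mult_charD[OF \<sigma>(1)] that by auto
  have \<phi>m: "\<phi> (x \<otimes> y) = \<phi> x + \<sigma> x * \<phi> y" if "x \<in> N" "y \<in> N" for x y
    using \<phi>(1) that by (simp add: derivation_def)
  \<comment> \<open>Conjugation by \<open>\<tau>\<close> is onto \<open>N\<close>, so
    \<open>\<mu> = 0\<close> would make \<open>\<phi>\<close> itself principal.\<close>
  have \<mu>: "\<mu> \<noteq> 0"
  proof
    assume "\<mu> = 0"
    then have "\<phi> x = (\<sigma> x - 1) * c" if "x \<in> N" for x
      using c[of "cj (- 1) x"] that cj_one_minus_one[OF that] \<sigma>inv[OF that] by simp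
    then show False using \<phi>(2) by (auto simp: principal_def)
  qed
  \<comment> \<open>The derivation of the integers twisted by the powers of \<open>\<mu>\<close>,
    with value \<open>- c\<close> at 1: a geometric sum, whose closed form degenerates at
    \<open>\<mu> = 1\<close>.\<close>
  define \<beta> where "\<beta> i = (if \<mu> = 1 then - c * of_int i else - c * ((\<mu> powi i - 1) / (\<mu> - 1)))" for i
  have \<beta>_add: "\<beta> (i + j) = \<beta> i + \<mu> powi i * \<beta> j" for i j
  proof -
    have "(\<mu> powi (i + j) - 1) / (\<mu> - 1) = (\<mu> powi i - 1) / (\<mu> - 1) + \<mu> powi i * ((\<mu> powi j - 1) / (\<mu> - 1))"
      using \<mu> by (simp add: power_int_add add_divide_distrib[symmetric] algebra_simps)
    then show ?thesis
      by (simp add: \<beta>_def algebra_simps)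
  qed
  have \<beta>_1: "\<beta> 1 = - c" and \<beta>_0: "\<beta> 0 = 0"
    by (auto simp: \<beta>_def)
  have \<phi>_cj: "\<phi> (cj i x) = \<mu> powi i * \<phi> x + (1 - \<sigma> x) * \<beta> i" if x: "x \<in> N" for i x
  proof -
    have step: "\<phi> (cj (1 + i) x) = \<mu> * \<phi> (cj i x) + (\<sigma> x - 1) * c" for i
      using c[of "cj i x"] x \<sigma>inv[OF x] cj_cj[of x 1 i] by simp
    show ?thesis
    proof (induction i rule: int_induct[where k = 0])
      case base
      then show ?case using x \<beta>_0 by simp
    next
      case (step1 i)
      have "\<phi> (cj (i + 1) x) = \<mu> * (\<mu> powi i * \<phi> x + (1 - \<sigma> x) * \<beta> i) + (\<sigma> x - 1) * c"
        using step[of i] step1(2) by (simp add: add.commute)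
      also have "\<dots> = \<mu> powi (1 + i) * \<phi> x + (1 - \<sigma> x) * \<beta> (1 + i)"
        unfolding \<beta>_add \<beta>_1 using \<mu> by (simp add: power_int_add algebra_simps)
      finally show ?case by (simp add: add.commute)
    next
      case (step2 i)
      have "\<mu> * \<phi> (cj (i - 1) x) = \<phi> (cj i x) - (\<sigma> x - 1) * c"
        using step[of "i - 1"] by simp
      also have "\<dots> = \<mu> powi (1 + (i - 1)) * \<phi> x + (1 - \<sigma> x) * \<beta> (1 + (i - 1)) - (\<sigma> x - 1) * c"
        using step2(2) by simp
      also have "\<dots> = \<mu> * (\<mu> powi (i - 1) * \<phi> x + (1 - \<sigma> x) * \<beta> (i - 1))"
        unfolding \<beta>_add[of 1] power_int_add[OF disjI1[OF \<mu>], of 1] \<beta>_1 by (simp add: algebra_simps)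
      finally show ?case using \<mu> by simp
    qed
  qed
  define \<rho> where "\<rho> g = \<sigma> (nrm g) * \<mu> powi \<chi> g" for g
  define \<delta> where "\<delta> g = \<phi> (nrm g) + \<sigma> (nrm g) * \<beta> (\<chi> g)" for g
  have "mult_char G \<rho>"
    unfolding mult_char_def
  proof (intro conjI ballI)
    fix g assume "g \<in> carrier G"
    then show "\<rho> g \<noteq> 0"
      using \<mu> \<sigma>m(2)[of "nrm g" \<one>] by (simp add: \<rho>_def)
  next
    fix g h assume "g \<in> carrier G" "h \<in> carrier G"
    then show "\<rho> (g \<otimes> h) = \<rho> g * \<rho> h"
      using \<mu> \<sigma>m(1) by (simp add: \<rho>_def nrm_mult chi_mult \<sigma>inv power_int_add)
  qed
  moreover have "\<rho> x = \<sigma> x" if "x \<in> N" for x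
    using that by (simp add: \<rho>_def mem_N[THEN iffD1])
  moreover have "derivation G \<rho> \<delta>"
    unfolding derivation_def
  proof (intro ballI)
    fix g h assume gh: "g \<in> carrier G" "h \<in> carrier G"
    have "\<delta> (g \<otimes> h) = \<phi> (nrm g) + \<sigma> (nrm g) * (\<mu> powi \<chi> g * \<phi> (nrm h) + (1 - \<sigma> (nrm h)) * \<beta> (\<chi> g))
        + \<sigma> (nrm g) * \<sigma> (nrm h) * (\<beta> (\<chi> g) + \<mu> powi \<chi> g * \<beta> (\<chi> h))"
      using gh by (simp add: \<delta>_def nrm_mult chi_mult \<phi>m \<sigma>m \<sigma>inv \<phi>_cj \<beta>_add)
    then show "\<delta> (g \<otimes> h) = \<delta> g + \<rho> g * \<delta> h"
      by (simp add: \<delta>_def \<rho>_def algebra_simps)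
  qed
  moreover have "\<not> principal G \<rho> \<delta>"
  proof
    assume "principal G \<rho> \<delta>"
    then obtain c' where c': "\<And>g. g \<in> carrier G \<Longrightarrow> \<delta> g = (\<rho> g - 1) * c'"
      by (auto simp: principal_def)
    have "\<phi> x = (\<sigma> x - 1) * c'" if "x \<in> N" for x
      using c'[of x] that by (simp add: \<delta>_def \<rho>_def mem_N[THEN iffD1] \<beta>_0)
    then show False using \<phi>(2) by (auto simp: principal_def)
  qed
  ultimately show ?thesis by blast
qed

text \<open>Algebraic closedness enters here: an eigenvector of precomposition with
  \<open>cj 1\<close>, acting on derivations modulo principal ones, is what
  \<open>derivation_extend\<close> requires.\<close>

lemma nonprincipal_extend:
  fixes \<sigma> :: "'a \<Rightarrow> 'k::alg_closed_field"
  assumes \<sigma>: "mult_char NG \<sigma>" "invariant \<sigma>"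
    and \<phi>: "derivation NG \<sigma> \<phi>" "\<not> principal NG \<sigma> \<phi>"
    and q: "q \<noteq> 0" "principal NG \<sigma> (\<lambda>x. \<Sum>i\<le>degree q. coeff q i * \<phi> (cj (int i) x))"
  shows "\<exists>\<rho> \<delta>. mult_char G \<rho> \<and> (\<forall>x \<in> N. \<rho> x = \<sigma> x) \<and> derivation G \<rho> \<delta> \<and> \<not> principal G \<rho> \<delta>"
proof -
  define E where "E = {\<phi>. derivation NG \<sigma> \<phi>}"
  define U where "U = {\<phi>. principal NG \<sigma> \<phi>}"
  define \<Theta> where "\<Theta> \<phi> = (\<lambda>x. \<phi> (cj 1 x))" for \<phi> :: "'a \<Rightarrow> 'k"
  have pow: "(\<Theta> ^^ i) \<phi> x = \<phi> (cj (int i) x)" if "x \<in> N" for i x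
    using that
  proof (induction i arbitrary: x)
    case (Suc i)
    then show ?case
      using cj_cj[of x "int i" 1] by (simp add: \<Theta>_def add.commute)
  qed simp
  have "\<exists>\<phi>' \<in> E. \<exists>\<mu>. \<phi>' \<notin> U \<and> (\<lambda>x. \<Theta> \<phi>' x - \<mu> * \<phi>' x) \<in> U"
  proof (rule eigenvector_modulo_subspace[of E U \<Theta> \<phi> q])
    show "(\<lambda>x. f x + c * g x) \<in> E" if "f \<in> E" "g \<in> E" for f g c
      using that by (simp add: E_def derivation_def algebra_simps)
    show "(\<lambda>x. c * f x) \<in> U" if f: "f \<in> U" for f c
    proof -
      obtain c' where "\<And>x. x \<in> N \<Longrightarrow> f x = (\<sigma> x - 1) * c'"
        using f by (auto simp: U_def principal_def)
      then show ?thesis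
        unfolding U_def principal_def by (intro CollectI exI[of _ "c * c'"]) (simp add: mult_ac)
    qed
    show "\<Theta> f \<in> E" if "f \<in> E" for f
      using that invariant_cj[OF \<sigma>(2)] by (simp add: E_def \<Theta>_def derivation_def cj_mult)
    show "(\<lambda>x. \<Sum>i\<le>degree q. coeff q i * (\<Theta> ^^ i) \<phi> x) \<in> U"
      using q(2) by (simp add: U_def principal_def pow)
  qed (use \<phi> q in \<open>simp_all add: E_def U_def \<Theta>_def\<close>)
  then obtain \<phi>' \<mu> where "derivation NG \<sigma> \<phi>'" "\<not> principal NG \<sigma> \<phi>'"
    "principal NG \<sigma> (\<lambda>x. \<phi>' (cj 1 x) - \<mu> * \<phi>' x)"
    by (auto simp: E_def U_def \<Theta>_def)
  then show ?thesis
    by (rule derivation_extend[OF \<sigma>])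
qed

end

section \<open>Commuting operators along a connected dominating set\<close>

lemma foldr_commute:
  assumes comm: "\<And>v w y. f v (f w y) = f w (f v y)"
  shows "foldr f ws (f v y) = f v (foldr f ws y)"
  by (induction ws) (simp_all add: comm)

text \<open>Put \<open>D u = f v0 (e u) - f u (e v0)\<close>. On an edge from \<open>v\<close> to
  \<open>u\<close>, \<open>f v (D u) = f u (D v)\<close>; so whatever kills \<open>D v\<close>,
  followed by \<open>f v\<close>, kills \<open>D u\<close>. Starting from \<open>D v0 = 0\<close>, a
  path inside \<open>W\<close> with one last step out of it reaches any \<open>u\<close>, and only
  operators of vertices in \<open>W\<close> are applied. As the operators commute, the words for all
  \<open>u\<close> can be concatenated.\<close>

lemma connected_dominating_chase:
  fixes f :: "'v \<Rightarrow> 'b::ab_group_add \<Rightarrow> 'b"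
  assumes diff: "\<And>v y z. f v (y - z) = f v y - f v z"
    and comm: "\<And>v w y. f v (f w y) = f w (f v y)"
    and edge: "\<And>v w. adj v w \<Longrightarrow> f v (e w) = f w (e v)"
    and W: "v0 \<in> W" and V: "finite V"
    and reach: "\<And>u. u \<in> V \<Longrightarrow>
      \<exists>w. (v0, w) \<in> {(v, w). v \<in> W \<and> w \<in> W \<and> adj v w}\<^sup>* \<and> (w = u \<or> adj w u)"
  shows "\<exists>ws. set ws \<subseteq> W \<and> (\<forall>u \<in> V. foldr f ws (f v0 (e u) - f u (e v0)) = 0)"
proof -
  define D where "D u = f v0 (e u) - f u (e v0)" for u
  have f0: "f v 0 = 0" for v
    using diff[of v 0 0] by simp
  have foldr0: "foldr f ws 0 = 0" for ws
    by (induction ws) (simp_all add: f0)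
  have step: "foldr f (v # ws) (D u) = 0" if "foldr f ws (D v) = 0" "adj v u" for v u ws
  proof -
    have "f v (D u) = f u (D v)"
      using edge[OF that(2)] by (simp add: D_def diff comm[of v v0] comm[of v u] comm[of u v0])
    then have "f v (foldr f ws (D u)) = f u (foldr f ws (D v))"
      by (simp add: foldr_commute[of f, OF comm, symmetric])
    then show ?thesis using that(1) f0 by simp
  qed
  have W_reach: "w \<in> W \<and> (\<exists>ws. set ws \<subseteq> W \<and> foldr f ws (D w) = 0)"
    if "(v0, w) \<in> {(v, w). v \<in> W \<and> w \<in> W \<and> adj v w}\<^sup>*" for w
    using that
  proof (induction rule: rtrancl_induct)
    case base
    then show ?case
      using W by (auto simp: D_def intro!: exI[of _ "[]"])
  next
    case (step v w)
    then obtain ws where "set ws \<subseteq> W" "foldr f ws (D v) = 0" by blast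
    moreover have "v \<in> W" "w \<in> W" "adj v w" using step by auto
    ultimately show ?case
      using \<open>\<And>ws v u. foldr f ws (D v) = 0 \<Longrightarrow> adj v u \<Longrightarrow> foldr f (v # ws) (D u) = 0\<close>[of ws v w]
      by (intro conjI exI[of _ "v # ws"]) auto
  qed
  have single: "\<exists>ws. set ws \<subseteq> W \<and> foldr f ws (D u) = 0" if u: "u \<in> V" for u
  proof -
    obtain w where w: "(v0, w) \<in> {(v, w). v \<in> W \<and> w \<in> W \<and> adj v w}\<^sup>*" "w = u \<or> adj w u"
      using reach[OF u] by blast
    obtain ws where ws: "w \<in> W" "set ws \<subseteq> W" "foldr f ws (D w) = 0"
      using W_reach[OF w(1)] by blast
    show ?thesis
    proof (cases "w = u")
      case False
      then have "foldr f (w # ws) (D u) = 0"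
        using w(2) step[OF ws(3)] by blast
      then show ?thesis
        using ws by (intro exI[of _ "w # ws"]) simp
    qed (use ws in blast)
  qed
  have "\<exists>ws. set ws \<subseteq> W \<and> (\<forall>u \<in> V'. foldr f ws (D u) = 0)" if "finite V'" "V' \<subseteq> V" for V'
    using that
  proof (induction V' rule: finite_induct)
    case empty
    show ?case by (intro exI[of _ "[]"]) simp
  next
    case (insert u V')
    then obtain ws where ws: "set ws \<subseteq> W" "\<forall>u \<in> V'. foldr f ws (D u) = 0" by auto
    obtain ws' where ws': "set ws' \<subseteq> W" "foldr f ws' (D u) = 0"
      using single[of u] insert.prems by auto
    have swap: "foldr f (ws @ ws') y = foldr f ws' (foldr f ws y)" for y
      by (induction ws) (simp_all add: foldr_commute[of f, OF comm])
    have "foldr f (ws @ ws') (D u') = 0" if "u' \<in> insert u V'" for u'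
    proof (cases "u' = u")
      case True
      then show ?thesis using ws'(2) by (simp add: foldr0)
    next
      case False
      then show ?thesis
        using ws(2) that unfolding swap by (simp add: foldr0)
    qed
    then show ?case
      using ws(1) ws'(1) by (intro exI[of _ "ws @ ws'"]) auto
  qed
  from this[OF V] show ?thesis by (simp add: D_def)
qed

section \<open>Geometric sums of shifts\<close>

text \<open>The operator \<open>1 + T + ... + T^(n-1)\<close> for the shift \<open>T\<close>, that
  is, the quotient of \<open>T^n - 1\<close> by \<open>T - 1\<close>. Dividing out
  \<open>T - 1\<close> is what allows coprime lengths to be comaximal.\<close>

definition geo :: "nat \<Rightarrow> (int \<Rightarrow> 'b::ab_group_add) \<Rightarrow> int \<Rightarrow> 'b" where
  "geo n y = (\<lambda>i. \<Sum>j<n. y (i + int j))"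

lemma geo_diff: "geo n (y - z) = geo n y - geo n z"
  by (simp add: geo_def fun_eq_iff sum_subtractf)

lemma geo_zero [simp]: "geo n 0 = 0"
  by (simp add: geo_def fun_eq_iff)

lemma geo_commute: "geo m (geo n y) = geo n (geo m y)"
proof
  fix i
  have "(\<Sum>j<m. \<Sum>k<n. y (i + int j + int k)) = (\<Sum>k<n. \<Sum>j<m. y (i + int j + int k))"
    by (rule sum.swap)
  then show "geo m (geo n y) i = geo n (geo m y) i"
    by (simp add: geo_def add_ac)
qed

lemma geo_shift: "geo n (\<lambda>i. y (i + c)) = (\<lambda>i. geo n y (i + c))"
  by (simp add: geo_def add_ac)

lemma geo_telescope: "geo n (\<lambda>i. y (i + 1) - y i) = (\<lambda>i. y (i + int n) - y i)"
  by (rule HOL.ext, induction n) (simp_all add: geo_def algebra_simps)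

lemma geo_add: "geo (m + n) y i = geo m y i + geo n y (i + int m)"
  by (induction n) (simp_all add: geo_def algebra_simps)

lemma geo_1 [simp]: "geo (Suc 0) y = y"
  by (simp add: geo_def)

lemma geo_0 [simp]: "geo 0 y = 0"
  by (simp add: geo_def fun_eq_iff)

text \<open>By \<open>geo_add\<close>, subtracting lengths subtracts operators up to a shift, so
  Euclid's algorithm runs on the lengths of the operators that kill \<open>y\<close>.\<close>

lemma geo_gcd:
  assumes "geo a y = 0" "geo b y = 0"
  shows "geo (gcd a b) y = 0"
  using assms
proof (induction a b rule: gcd_nat_induct)
  case (step m n)
  have z: "geo m y i = 0" "geo n y i = 0" for i
    using step.prems by simp_all
  have k: "geo (n * k) y i = 0" for k i
    by (induction k arbitrary: i) (simp_all add: geo_add z)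
  have "geo (m mod n) y i = 0" for i
  proof -
    \<comment> \<open>The starting index is moved back by the multiple of \<open>n\<close>, so that
      the remainder term is evaluated at \<open>i\<close>.\<close>
    have "geo (n * (m div n) + m mod n) y (i - int (n * (m div n))) = 0"
      by (simp only: mult_div_mod_eq z)
    then show ?thesis
      unfolding geo_add k by simp
  qed
  then have "geo (m mod n) y = 0" by (simp add: fun_eq_iff)
  then have "geo (gcd n (m mod n)) y = 0"
    using step.IH step.prems(2) by blast
  then show ?case
    by (simp only: gcd_red_nat[of m n])
qed simp

lemma foldr_geo_add: "foldr geo cs (y + z) = foldr geo cs y + foldr geo cs z"
proof (induction cs)
  case (Cons c cs)
  have "geo c (y + z) = geo c y + geo c z" for y z :: "int \<Rightarrow> 'a"
    by (simp add: geo_def fun_eq_iff sum.distrib)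
  then show ?case
    by (simp only: foldr.simps comp_apply Cons.IH)
qed simp

lemma foldr_geo_shift: "foldr geo cs (\<lambda>i. y (i + c)) = (\<lambda>i. foldr geo cs y (i + c))"
  by (induction cs) (simp_all add: geo_shift)

text \<open>The operators \<open>geo a\<close> and \<open>geo b\<close> are comaximal when \<open>a\<close> and \<open>b\<close> are coprime; hence \<open>y = 0\<close> as soon
  as, for every prime \<open>p\<close>, it is killed by a product of operators \<open>geo c\<close> with \<open>c\<close> prime to \<open>p\<close>.\<close>

definition locally_killed :: "(int \<Rightarrow> 'b::ab_group_add) \<Rightarrow> bool" where
  "locally_killed y \<longleftrightarrow>
     (\<forall>p::nat. Factorial_Ring.prime p \<longrightarrow> (\<exists>cs. (\<forall>c \<in> set cs. \<not> p dvd c) \<and> foldr geo cs y = 0))"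

lemma locally_killed_geo: "locally_killed y \<Longrightarrow> locally_killed (geo c y)"
  unfolding locally_killed_def foldr_commute[of geo, OF geo_commute] by (metis geo_zero)

text \<open>The outermost operator is removed first. It acts on an image of \<open>y\<close> under
  the remaining ones, which is still locally killed and still satisfies \<open>Q\<close>.\<close>

lemma locally_killed_peel:
  assumes "\<And>c z. c \<in> set cs \<Longrightarrow> locally_killed z \<Longrightarrow> Q z \<Longrightarrow> geo c z = 0 \<Longrightarrow> z = 0"
    and Q: "\<And>c z. Q z \<Longrightarrow> Q (geo c z)"
    and "foldr geo cs y = 0" "locally_killed y" "Q y"
  shows "y = 0"
  using assms(1,3-)
proof (induction cs)
  case (Cons c cs)
  have "locally_killed (foldr geo ds y) \<and> Q (foldr geo ds y)" for ds
    by (induction ds) (simp_all add: Cons.prems locally_killed_geo Q)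
  then have "foldr geo cs y = 0"
    using Cons.prems(1)[of c "foldr geo cs y"] Cons.prems(2) by auto
  then show ?case
    using Cons.IH Cons.prems by auto
qed simp

text \<open>Strong induction on \<open>c\<close>. For a prime \<open>p\<close> dividing
  \<open>c\<close>, every local killer \<open>b\<close> at \<open>p\<close> is prime to
  \<open>p\<close>, so the gcd of \<open>c\<close> and \<open>b\<close> is smaller than
  \<open>c\<close> and its operator kills the same vector.\<close>

lemma locally_killed_geo_zero:
  assumes "c > 0" "locally_killed y" "geo c y = 0"
  shows "y = 0"
  using assms
proof (induction c arbitrary: y rule: less_induct)
  case (less c)
  show ?case
  proof (cases "c = 1")
    case True
    then show ?thesis using less.prems by simp
  next
    case False
    then obtain p where p: "Factorial_Ring.prime p" "p dvd c"
      using prime_factor_nat by blast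
    obtain cs where cs: "\<And>b. b \<in> set cs \<Longrightarrow> \<not> p dvd b" "foldr geo cs y = 0"
      using less.prems(2) p(1) unfolding locally_killed_def by blast
    show ?thesis
    proof (rule locally_killed_peel[of cs "\<lambda>z. geo c z = 0" y])
      fix b and z :: "int \<Rightarrow> 'a" assume b: "b \<in> set cs" and z: "locally_killed z" "geo c z = 0" "geo b z = 0"
      have "gcd c b \<noteq> c"
        using cs(1)[OF b] p(2) by (metis dvd_trans gcd_dvd2)
      then have "gcd c b < c"
        using less.prems(1) by (simp add: gcd_le1_nat le_neq_implies_less)
      moreover have "gcd c b > 0"
        using less.prems(1) by simp
      ultimately show "z = 0"
        using less.IH[of "gcd c b" z] z(1) geo_gcd[OF z(2,3)] by blast
    next
      show "geo c (geo b z) = 0" if "geo c z = 0" for b and z :: "int \<Rightarrow> 'a"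
        using that geo_commute[of c b z] by (simp only: geo_zero)
    qed (fact cs less.prems)+
  qed
qed

lemma locally_killed_zero:
  assumes "locally_killed y"
  shows "y = 0"
proof -
  \<comment> \<open>Any prime would do: its killers have nonzero length, as
    \<open>locally_killed_geo_zero\<close> requires.\<close>
  obtain cs where cs: "\<And>b. b \<in> set cs \<Longrightarrow> \<not> 2 dvd b" "foldr geo cs y = 0"
    using assms two_is_prime_nat unfolding locally_killed_def by blast
  show ?thesis
  proof (rule locally_killed_peel[of cs "\<lambda>_. True" y])
    fix c and z :: "int \<Rightarrow> 'a" assume "c \<in> set cs" "locally_killed z" "geo c z = 0"
    moreover have "c > 0" using cs(1)[OF \<open>c \<in> set cs\<close>] by (cases c) simp_all
    ultimately show "z = 0" using locally_killed_geo_zero by blast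
  qed (simp_all only: cs assms)
qed

section \<open>Polynomials in the shift\<close>

definition pact :: "'k::field poly \<Rightarrow> (int \<Rightarrow> 'k) \<Rightarrow> int \<Rightarrow> 'k" where
  "pact q y i = (\<Sum>j\<le>degree q. coeff q j * y (i + int j))"

lemma pact_bound: "degree q \<le> n \<Longrightarrow> pact q y i = (\<Sum>j\<le>n. coeff q j * y (i + int j))"
  unfolding pact_def by (intro sum.mono_neutral_left) (auto simp: coeff_eq_0)

lemma pact_diff: "pact (p - q) y i = pact p y i - pact q y i"
proof -
  let ?n = "max (degree (p - q)) (max (degree p) (degree q))"
  show ?thesis
    by (simp add: pact_bound[of _ ?n] left_diff_distrib sum_subtractf)
qed

lemma pact_smult: "pact (smult s q) y i = s * pact q y i"
  by (subst pact_bound[of _ "degree q"]) (simp_all add: pact_def sum_distrib_left mult.assoc degree_smult_le)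

lemma pact_pCons_0: "pact (pCons 0 q) y i = pact q y (i + 1)"
proof -
  have "pact (pCons 0 q) y i = (\<Sum>j\<le>Suc (degree q). coeff (pCons 0 q) j * y (i + int j))"
    by (rule pact_bound) (rule degree_pCons_le)
  also have "\<dots> = pact q y (i + 1)"
    by (subst sum.atMost_Suc_shift) (simp add: pact_def add_ac)
  finally show ?thesis .
qed

lemma pact_monom_mult: "pact (monom s m * q) y i = s * pact q y (i + int m)"
proof (induction m arbitrary: i)
  case 0
  have "monom s 0 * q = smult s q"
    by (simp add: monom_0)
  then show ?case by (simp add: pact_smult)
next
  case (Suc m)
  have "monom s (Suc m) * q = pCons 0 (monom s m * q)"
    by (simp add: monom_Suc)
  then show ?case
    using Suc[of "i + 1"] by (simp add: pact_pCons_0 add_ac)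
qed

lemma pact_1: "pact 1 y i = y i"
  by (simp add: pact_def)

text \<open>The operator \<open>s T^m - 1\<close> for the shift \<open>T\<close>; with
  \<open>s = 1\<close> it is \<open>geo m\<close> composed with \<open>T - 1\<close>.\<close>

definition twist :: "'k::field \<Rightarrow> nat \<Rightarrow> (int \<Rightarrow> 'k) \<Rightarrow> int \<Rightarrow> 'k" where
  "twist s m y = (\<lambda>i. s * y (i + int m) - y i)"

lemma twist_diff: "twist s m (y - z) = twist s m y - twist s m z"
  by (simp add: twist_def fun_eq_iff algebra_simps)

lemma twist_commute: "twist s m (twist t n y) = twist t n (twist s m y)"
  by (simp add: twist_def fun_eq_iff algebra_simps)

lemma foldr_twist_add:
  "foldr (\<lambda>v. twist (s v) (m v)) ws (y + z) =
    foldr (\<lambda>v. twist (s v) (m v)) ws y + foldr (\<lambda>v. twist (s v) (m v)) ws z"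
  by (induction ws) (simp_all add: twist_def fun_eq_iff algebra_simps)

lemma foldr_twist_shift:
  "foldr (\<lambda>v. twist (s v) (m v)) ws (\<lambda>i. c * y (i + n)) =
    (\<lambda>i. c * foldr (\<lambda>v. twist (s v) (m v)) ws y (i + n))"
  by (induction ws) (simp_all add: twist_def fun_eq_iff algebra_simps)

text \<open>Each factor \<open>s X^m - 1\<close> has the coefficient \<open>s\<close> at
  \<open>X^m\<close>, since \<open>m > 0\<close>, and is nonzero; polynomials over a field have no
  zero divisors.\<close>

lemma foldr_twist_pact:
  assumes "\<And>w. w \<in> set ws \<Longrightarrow> s w \<noteq> 0 \<and> m w > 0"
  shows "\<exists>q. q \<noteq> 0 \<and> (\<forall>y i. foldr (\<lambda>v. twist (s v) (m v)) ws y i = pact q y i)"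
  using assms
proof (induction ws)
  case Nil
  show ?case by (intro exI[of _ 1]) (simp add: pact_1)
next
  case (Cons w ws)
  then obtain q where q: "q \<noteq> 0" "\<And>y i. foldr (\<lambda>v. twist (s v) (m v)) ws y i = pact q y i"
    by auto
  let ?q = "(monom (s w) (m w) - 1) * q"
  have "coeff (monom (s w) (m w) - 1) (m w) = s w"
    using Cons.prems[of w] by simp
  moreover have "s w \<noteq> 0"
    using Cons.prems[of w] by simp
  ultimately have "monom (s w) (m w) - 1 \<noteq> 0"
    by (metis coeff_0)
  then have "?q \<noteq> 0" using q(1) by simp
  moreover have "foldr (\<lambda>v. twist (s v) (m v)) (w # ws) y i = pact ?q y i" for y i
  proof -
    have "pact ?q y i = pact (monom (s w) (m w) * q - q) y i"
      by (simp add: left_diff_distrib)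
    also have "\<dots> = s w * pact q y (i + int (m w)) - pact q y i"
      by (simp only: pact_diff pact_monom_mult)
    finally show ?thesis
      by (simp add: twist_def q(2))
  qed
  ultimately show ?case by blast
qed

section \<open>The group of units of a field, written additively\<close>

text \<open>Turns characters into additive maps with values in an \<open>ab_group_add\<close>, so
  that the invariance result for arbitrary abelian groups applies to them.\<close>

typedef (overloaded) ('k::field) kunit = "{x :: 'k. x \<noteq> 0}"
  by (rule exI[of _ 1]) simp

instantiation kunit :: (field) ab_group_add
begin

definition "0 = Abs_kunit 1"
definition "x + y = Abs_kunit (Rep_kunit x * Rep_kunit y)"
definition "- x = Abs_kunit (inverse (Rep_kunit x))"
definition "x - y = Abs_kunit (Rep_kunit x / Rep_kunit y)" for x y :: "'a kunit"

instance
proof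
  fix a b c :: "'a kunit"
  have nz: "Rep_kunit x \<noteq> 0" for x :: "'a kunit"
    using Rep_kunit[of x] by simp
  show "a + b + c = a + (b + c)" "a + b = b + a" "0 + a = a" "- a + a = 0" "a - b = a + - b"
    using nz by (simp_all add: plus_kunit_def zero_kunit_def uminus_kunit_def minus_kunit_def
        Abs_kunit_inverse Rep_kunit_inverse mult_ac divide_inverse)
qed

end

section \<open>Kernels of characters of right-angled Artin groups\<close>

lemma add_eq_swap:
  fixes a b c d :: "'b::ab_group_add"
  assumes "a + b = c + d"
  shows "b - c = d - a"
proof -
  have "b = c + d - a"
    using assms by (metis add_diff_cancel_left')
  then show ?thesis by simp
qed

locale raag_kernel = int_extension G \<chi> \<tau>
  for G :: "'v word set monoid" (structure) and \<chi> \<tau> +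
  fixes V :: "'v set" and L :: "'v set set"
  assumes complex: "finite_simplicial_complex_on L V" and G_eq: "G = raag V L"
begin

abbreviation gen where "gen \<equiv> raag_gen V L"

abbreviation adj where "adj v w \<equiv> v \<noteq> w \<and> {v, w} \<in> L"

lemma finite_V: "finite V" and L_sub: "L \<subseteq> Pow V"
  using complex by (auto simp: finite_simplicial_complex_on_def)

lemma adj_V: "adj v w \<Longrightarrow> v \<in> V \<and> w \<in> V"
  using L_sub by auto

lemma gen_closed [simp]: "v \<in> V \<Longrightarrow> gen v \<in> carrier G"
  by (simp add: G_eq raag_gen_closed)

lemma generated:
  assumes "x \<in> carrier G" "P \<one>"
    and "\<And>x y. x \<in> carrier G \<Longrightarrow> y \<in> carrier G \<Longrightarrow> P x \<Longrightarrow> P y \<Longrightarrow> P (x \<otimes> y)"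
    and "\<And>x. x \<in> carrier G \<Longrightarrow> P x \<Longrightarrow> P (inv x)"
    and "\<And>v. v \<in> V \<Longrightarrow> P (gen v)"
  shows "P x"
  using assms(1)[unfolded G_eq]
proof (induction x rule: raag_induct)
  case one
  then show ?case using assms(2) by (simp add: G_eq)
next
  case (gen v x)
  then show ?case
    using assms(3)[of "gen v" x] assms(5)[of v] gen_closed[of v] unfolding G_eq by blast
next
  case (inv_gen v x)
  then show ?case
    using assms(3)[of "inv (gen v)" x] assms(4)[of "gen v"] assms(5)[of v] gen_closed[of v] inv_closed[of "gen v"]
    unfolding G_eq by blast
qed

text \<open>Generators with sign chosen so that \<open>\<chi>\<close> is nonnegative: the shifts
  that they cause then have natural exponents, as \<open>geo\<close> and polynomials demand.\<close>

definition sgen where "sgen v = (if \<chi> (gen v) < 0 then inv (gen v) else gen v)"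

abbreviation ht where "ht v \<equiv> nat \<bar>\<chi> (gen v)\<bar>"

lemma sgen_closed [simp]: "v \<in> V \<Longrightarrow> sgen v \<in> carrier G"
  by (simp add: sgen_def)

lemma chi_sgen [simp]: "v \<in> V \<Longrightarrow> \<chi> (sgen v) = int (ht v)"
  by (simp add: sgen_def)

lemma commute_inv:
  assumes "x \<in> carrier G" "y \<in> carrier G" "x \<otimes> y = y \<otimes> x"
  shows "inv x \<otimes> y = y \<otimes> inv x"
proof -
  have "inv x \<otimes> y = inv x \<otimes> (y \<otimes> x) \<otimes> inv x"
    using assms(1,2) by (simp add: m_assoc)
  also have "\<dots> = inv x \<otimes> (x \<otimes> y) \<otimes> inv x"
    by (simp only: assms(3))
  also have "\<dots> = y \<otimes> inv x"
    using assms(1,2) by (simp add: m_assoc[symmetric])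
  finally show ?thesis .
qed

lemma sgen_commute:
  assumes "adj v w"
  shows "sgen v \<otimes> sgen w = sgen w \<otimes> sgen v"
proof -
  have vw: "v \<in> V" "w \<in> V" using adj_V[OF assms] by auto
  have c: "gen v \<otimes> gen w = gen w \<otimes> gen v"
    unfolding G_eq by (rule raag_gen_commute[OF L_sub]) (use assms in auto)
  then have c': "gen v \<otimes> sgen w = sgen w \<otimes> gen v"
    using commute_inv[of "gen w" "gen v"] vw by (simp add: sgen_def)
  then show ?thesis
    using commute_inv[of "gen v" "sgen w"] vw by (simp add: sgen_def[of v])
qed

lemma generated_sgen:
  assumes "x \<in> carrier G" "P \<one>"
    and "\<And>x y. x \<in> carrier G \<Longrightarrow> y \<in> carrier G \<Longrightarrow> P x \<Longrightarrow> P y \<Longrightarrow> P (x \<otimes> y)"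
    and inv: "\<And>x. x \<in> carrier G \<Longrightarrow> P x \<Longrightarrow> P (inv x)"
    and sgen: "\<And>v. v \<in> V \<Longrightarrow> P (sgen v)"
  shows "P x"
proof (rule generated[OF assms(1-4)])
  fix v assume v: "v \<in> V"
  then show "P (gen v)"
    using sgen[OF v] inv[of "sgen v"] by (auto simp: sgen_def split: if_splits)
qed

text \<open>Injectivity of each \<open>act g\<close> gives \<open>D\<close> the value 0 at the
  identity and at inverses. It is applied with the trivial action and with plain and twisted shifts
  of sequences.\<close>

lemma derivation_vanishes:
  fixes D :: "'v word set \<Rightarrow> 'b::ab_group_add"
  assumes D: "\<And>g h. g \<in> carrier G \<Longrightarrow> h \<in> carrier G \<Longrightarrow> D (g \<otimes> h) = D g + act g (D h)"
    and act: "\<And>g. g \<in> carrier G \<Longrightarrow> act g 0 = 0"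
      "\<And>g y. g \<in> carrier G \<Longrightarrow> act g y = 0 \<Longrightarrow> y = 0"
    and v: "\<And>v. v \<in> V \<Longrightarrow> D (sgen v) = 0" and x: "x \<in> carrier G"
  shows "D x = 0"
proof -
  have one: "D \<one> = 0"
    using D[of \<one> \<one>] act(2)[of \<one> "D \<one>"] by simp
  show ?thesis
  proof (rule generated_sgen[of x "\<lambda>x. D x = 0", OF x one])
    fix g assume g: "g \<in> carrier G" "D g = 0"
    then show "D (inv g) = 0"
      using D[of g "inv g"] one act(2)[of g "D (inv g)"] by simp
  next
    fix g h assume gh: "g \<in> carrier G" "h \<in> carrier G" "D g = 0" "D h = 0"
    show "D (g \<otimes> h) = 0"
      unfolding D[OF gh(1,2)] gh(3,4) act(1)[OF gh(1)] by simp
  qed (fact v)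
qed

lemma derivation_exists:
  fixes \<sigma> :: "'v word set \<Rightarrow> 'k::field"
  assumes "mult_char G \<sigma>"
    and "\<And>v w. adj v w \<Longrightarrow> (\<sigma> (gen v) - 1) * h w = (\<sigma> (gen w) - 1) * h v"
  shows "\<exists>d. derivation G \<sigma> d \<and> (\<forall>v \<in> V. d (gen v) = h v)"
  using raag_derivation_exists[OF L_sub, of \<sigma> h] assms unfolding G_eq by blast

lemma derivation_one: "derivation G (\<lambda>_. 1 :: 'k::field) d \<longleftrightarrow> additive_on G d"
  by (simp add: derivation_def additive_on_def)

text \<open>Additive maps that all vanish on \<open>N\<close> would all be multiples of
  \<open>\<chi>\<close>, yet their values on generators are arbitrary. The indicator of
  \<open>v1\<close> forces \<open>\<chi>(v2) = 0\<close> in the field, which the constant 1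
  contradicts.\<close>

lemma nonzero_additive:
  assumes "card V > 1"
  shows "\<exists>b :: 'v word set \<Rightarrow> 'k::field. additive_on G b \<and> (\<exists>x \<in> N. b x \<noteq> 0)"
proof (rule ccontr)
  assume "\<not> ?thesis"
  then have zero: "b x = 0" if "additive_on G b" "x \<in> N" for b :: "'v word set \<Rightarrow> 'k" and x
    using that by blast
  obtain v1 v2 where v: "v1 \<in> V" "v2 \<in> V" "v1 \<noteq> v2"
    using assms by (metis One_nat_def card_le_Suc0_iff_eq finite_V linorder_not_less)
  have "\<exists>d. additive_on G d \<and> (\<forall>v \<in> V. d (gen v) = h v)" for h :: "'v \<Rightarrow> 'k"
    using derivation_exists[of "\<lambda>_. 1" h] by (simp add: mult_char_def derivation_one)
  then obtain B where B: "additive_on G (B h)" "\<And>v. v \<in> V \<Longrightarrow> B h (gen v) = h v" for h :: "'v \<Rightarrow> 'k"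
    by metis
  have eq: "h v = B h \<tau> * of_int (\<chi> (gen v))" if "v \<in> V" for h v
    using additive_tau_pow[OF B(1) zero[OF B(1)], of "gen v" h] B(2)[OF that] that by simp
  have "of_int (\<chi> (gen v2)) = (0::'k)"
    using eq[OF v(1), of "\<lambda>v. if v = v1 then 1 else 0"] eq[OF v(2), of "\<lambda>v. if v = v1 then 1 else 0"] v(3)
    by auto
  then show False
    using eq[OF v(2), of "\<lambda>_. 1"] by simp
qed

text \<open>By invariance, \<open>w\<close> composed with \<open>nrm\<close> is a homomorphism on
  all of \<open>G\<close>, determined by its values on the finitely many generators.\<close>

lemma invariant_additive_detect:
  fixes w :: "'v word set \<Rightarrow> 'k::field"
  assumes w: "additive_on NG w" "invariant w" "\<And>v. v \<in> V \<Longrightarrow> w (nrm (sgen v)) = 0" and x: "x \<in> N"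
  shows "w x = 0"
proof -
  have wm: "w (x \<otimes> y) = w x + w y" if "x \<in> N" "y \<in> N" for x y
    using w(1) that by (simp add: additive_on_NG)
  have "w (nrm x) = 0"
    by (rule derivation_vanishes[of "\<lambda>g. w (nrm g)" "\<lambda>_ y. y"])
      (use x w(3) in \<open>simp_all add: nrm_mult wm invariant_cj[OF w(2)]\<close>)
  then show ?thesis using x by simp
qed

section \<open>The subgraph on the vertices whose height is prime to p\<close>

definition W :: "nat \<Rightarrow> 'v set" where "W p = {v \<in> V. \<not> p dvd ht v}"

lemma W_iff: "v \<in> W p \<longleftrightarrow> v \<in> V \<and> \<not> int p dvd \<chi> (gen v)"
proof -
  have "p dvd ht v \<longleftrightarrow> int p dvd \<chi> (gen v)"
    by (metis dvd_abs_iff abs_ge_zero int_dvd_int_iff int_nat_eq)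
  then show ?thesis by (simp add: W_def)
qed

definition root_char :: "nat \<Rightarrow> 'v word set \<Rightarrow> complex" where
  "root_char p g = cis (2 * pi * of_int (\<chi> g) / of_nat p)"

lemma root_char_eq_1_iff:
  assumes "p > 0"
  shows "root_char p g = 1 \<longleftrightarrow> int p dvd \<chi> g"
proof -
  have "root_char p g = 1 \<longleftrightarrow> cos (2 * pi * of_int (\<chi> g) / of_nat p) = 1"
    by (auto simp: root_char_def complex_eq_iff dest: cos_one_sin_zero)
  also have "\<dots> \<longleftrightarrow> (\<exists>n::int. 2 * pi * of_int (\<chi> g) / of_nat p = of_int n * 2 * pi)"
    by (rule cos_one_2pi_int)
  also have "\<dots> \<longleftrightarrow> (\<exists>n::int. \<chi> g = int p * n)"
  proof -
    have "2 * pi * of_int (\<chi> g) / of_nat p = of_int n * 2 * pi \<longleftrightarrow> \<chi> g = int p * n" for n :: int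
    proof -
      have "2 * pi * of_int (\<chi> g) / of_nat p = of_int n * 2 * pi \<longleftrightarrow>
          real_of_int (\<chi> g) = real_of_int (int p * n)"
        using assms by (simp add: field_simps)
      then show ?thesis by (simp only: of_int_eq_iff)
    qed
    then show ?thesis by simp
  qed
  also have "\<dots> \<longleftrightarrow> int p dvd \<chi> g"
    by (auto simp: dvd_def)
  finally show ?thesis .
qed

lemma mult_char_root_char: "mult_char G (root_char p)"
  by (auto simp: mult_char_def root_char_def chi_mult cis_mult add_divide_distrib distrib_left)

text \<open>A derivation twisted by a nontrivial character of \<open>G/N\<close> restricts to a homomorphism on \<open>N\<close> on
  which \<open>\<tau>\<close> acts by a scalar different from 1; so the restriction is zero.\<close>

lemma root_char_principal:
  assumes H1: "trivial_action_on_homology G N 1" and p: "p > 1" and d: "derivation G (root_char p) d"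
  shows "principal G (root_char p) d"
proof -
  let ?\<sigma> = "root_char p"
  have dm: "d (x \<otimes> y) = d x + ?\<sigma> x * d y" if "x \<in> carrier G" "y \<in> carrier G" for x y
    using d that by (simp add: derivation_def)
  have \<sigma>N: "?\<sigma> x = 1" if "x \<in> N" for x
    using that by (simp add: root_char_def mem_N)
  have "\<not> int p dvd 1" using p by simp
  then have \<sigma>\<tau>: "?\<sigma> \<tau> \<noteq> 1"
    using root_char_eq_1_iff[of p \<tau>] p tau by simp
  have dN: "d x = 0" if x: "x \<in> N" for x
  proof -
    have "d (cj 1 x) = d x"
      using hom_invariant[OF H1, of d] dm \<sigma>N x by (simp add: invariant_def)
    moreover have "cj 1 x \<otimes> \<tau> = \<tau> \<otimes> x"
      using x tau by (simp add: cj_def m_assoc)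
    ultimately have "d x + d \<tau> = d \<tau> + ?\<sigma> \<tau> * d x"
      using dm[of "cj 1 x" \<tau>] dm[of \<tau> x] \<sigma>N[of "cj 1 x"] x tau by simp
    then have "(?\<sigma> \<tau> - 1) * d x = 0" by (simp add: algebra_simps)
    then show ?thesis using \<sigma>\<tau> by simp
  qed
  have "d g = (?\<sigma> g - 1) * (d \<tau> / (?\<sigma> \<tau> - 1))" if g: "g \<in> carrier G" for g
  proof -
    \<comment> \<open>Since \<open>d\<close> vanishes at this element of \<open>N\<close>, it takes
      the same value at \<open>g \<tau>\<close> and \<open>\<tau> g\<close>; the two expansions
      determine \<open>d g\<close> from \<open>d \<tau>\<close>.\<close>
    let ?n = "g \<otimes> \<tau> \<otimes> inv (\<tau> \<otimes> g)"
    have "?n \<in> carrier G" "\<chi> ?n = 0"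
      using g tau by (simp_all add: chi_mult del: inv_mult_group)
    then have n: "?n \<in> N"
      unfolding mem_N ..
    have "?n \<otimes> (\<tau> \<otimes> g) = g \<otimes> \<tau>"
      using g tau by (simp add: m_assoc del: inv_mult_group)
    then have "d g + ?\<sigma> g * d \<tau> = d \<tau> + ?\<sigma> \<tau> * d g"
      using dm[of ?n "\<tau> \<otimes> g"] dN[OF n] \<sigma>N[OF n] dm[of g \<tau>] dm[of \<tau> g] n g tau by simp
    then have "(?\<sigma> \<tau> - 1) * d g = (?\<sigma> g - 1) * d \<tau>"
      by (simp add: algebra_simps)
    then show ?thesis using \<sigma>\<tau> by (simp add: field_simps)
  qed
  then show ?thesis unfolding principal_def by blast
qed

lemma connected_dominating:
  assumes H1: "trivial_action_on_homology G N 1" and p: "Factorial_Ring.prime p"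
  shows "\<exists>v0 \<in> W p. \<forall>u \<in> V. \<exists>w.
    (v0, w) \<in> {(v, w). v \<in> W p \<and> w \<in> W p \<and> adj v w}\<^sup>* \<and> (w = u \<or> adj w u)"
proof -
  let ?\<sigma> = "root_char p"
  have p1: "p > 1" using p prime_gt_1_nat by blast
  have \<sigma>W: "?\<sigma> (gen v) = 1 \<longleftrightarrow> v \<notin> W p" if "v \<in> V" for v
    using root_char_eq_1_iff[of p "gen v"] p1 that by (simp add: W_iff)
  have princ: "\<exists>c. \<forall>v \<in> V. h v = (?\<sigma> (gen v) - 1) * c"
    if h: "\<And>v w. adj v w \<Longrightarrow> (?\<sigma> (gen v) - 1) * h w = (?\<sigma> (gen w) - 1) * h v" for h
  proof -
    obtain d where d: "derivation G ?\<sigma> d" "\<And>v. v \<in> V \<Longrightarrow> d (gen v) = h v"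
      using derivation_exists[OF mult_char_root_char, of p h] h by blast
    then show ?thesis
      using root_char_principal[OF H1 p1 d(1)] gen_closed unfolding principal_def by metis
  qed
  have "W p \<noteq> {}"
  proof
    assume "W p = {}"
    then have dvd: "int p dvd \<chi> (gen v)" if "v \<in> V" for v
      using that W_iff[of v p] by blast
    have "int p dvd \<chi> \<tau>"
      by (rule generated[of \<tau> "\<lambda>g. int p dvd \<chi> g"]) (simp_all add: tau(1) dvd chi_mult)
    then show False using tau(2) p1 by simp
  qed
  then obtain v0 where v0: "v0 \<in> W p" by blast
  define R where "R = {(v, w). v \<in> W p \<and> w \<in> W p \<and> adj v w}"
  define C where "C = {w. (v0, w) \<in> R\<^sup>*}"
  have CW: "C \<subseteq> W p"
  proof
    fix w assume "w \<in> C"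
    then have "(v0, w) \<in> R\<^sup>*" by (simp add: C_def)
    then show "w \<in> W p"
      by (cases rule: rtranclE) (use v0 in \<open>auto simp: R_def\<close>)
  qed
  have C_adj: "w \<in> C" if "v \<in> C" "w \<in> W p" "adj v w" for v w
    using that CW unfolding C_def R_def by (auto intro: rtrancl_into_rtrancl)
  have v0C: "v0 \<in> C" by (simp add: C_def)
  have "W p \<subseteq> C"
  proof
    fix v assume v: "v \<in> W p"
    \<comment> \<open>The principal derivation with constant 1, cut off outside the component
      \<open>C\<close>. An edge leaving \<open>C\<close> ends outside \<open>W p\<close>, where the
      character is 1, so the cut is compatible with commutation. The vertex \<open>v0\<close> forces
      the constant 1, and then \<open>h\<close> is nonzero on all of \<open>W p\<close>.\<close>
    define h where "h v = (if v \<in> C then ?\<sigma> (gen v) - 1 else 0)" for v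
    have "(?\<sigma> (gen v) - 1) * h w = (?\<sigma> (gen w) - 1) * h v" if vw: "adj v w" for v w
    proof -
      have V: "v \<in> V" "w \<in> V" using adj_V[OF vw] by auto
      have vw': "adj w v" using vw by (auto simp: insert_commute)
      have "?\<sigma> (gen w) = 1" if "v \<in> C" "w \<notin> C"
        using \<sigma>W[OF V(2)] C_adj[OF that(1) _ vw] that(2) by blast
      moreover have "?\<sigma> (gen v) = 1" if "w \<in> C" "v \<notin> C"
        using \<sigma>W[OF V(1)] C_adj[OF that(1) _ vw'] that(2) by blast
      ultimately show ?thesis
        by (cases "v \<in> C"; cases "w \<in> C") (simp_all add: h_def mult.commute)
    qed
    then obtain c where c: "\<And>v. v \<in> V \<Longrightarrow> h v = (?\<sigma> (gen v) - 1) * c"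
      using princ[of h] by blast
    have V: "v0 \<in> V" "v \<in> V" using v v0 by (auto simp: W_def)
    have "c = 1"
      using c[OF V(1)] \<sigma>W[OF V(1)] v0 v0C by (simp add: h_def)
    then have "h v \<noteq> 0"
      using c[OF V(2)] \<sigma>W[OF V(2)] v by simp
    then show "v \<in> C" by (simp add: h_def split: if_splits)
  qed
  then have CW': "C = W p" using CW by blast
  have "\<exists>w \<in> C. w = u \<or> adj w u" if u: "u \<in> V" for u
  proof (rule ccontr)
    assume none: "\<not> (\<exists>w \<in> C. w = u \<or> adj w u)"
    \<comment> \<open>A derivation supported at an undominated vertex. All neighbours of
      \<open>u\<close> have character value 1, which makes it compatible; \<open>u\<close> itself
      also has character value 1, which keeps it from being principal.\<close>
    define h where "h v = (if v = u then 1 else 0 :: complex)" for v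
    have *: "(?\<sigma> (gen v) - 1) * h u = (?\<sigma> (gen u) - 1) * h v" if vu: "adj v u" for v
    proof -
      have "v \<notin> W p" "v \<in> V" using none vu adj_V[OF vu] unfolding CW' by auto
      then have "?\<sigma> (gen v) = 1" using \<sigma>W by blast
      then show ?thesis using vu by (simp add: h_def)
    qed
    have "(?\<sigma> (gen v) - 1) * h w = (?\<sigma> (gen w) - 1) * h v" if vw: "adj v w" for v w
    proof (cases "w = u")
      case True
      then show ?thesis using * vw by blast
    next
      case False
      show ?thesis
      proof (cases "v = u")
        case True
        then have "adj w u" using vw by (auto simp: insert_commute)
        then show ?thesis using *[of w] True by simp
      qed (use False in \<open>simp add: h_def\<close>)
    qed
    then obtain c where "h u = (?\<sigma> (gen u) - 1) * c"
      using princ[of h] u by blast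
    moreover have "?\<sigma> (gen u) = 1"
      using none \<sigma>W[OF u] unfolding CW' by blast
    ultimately show False
      by (simp add: h_def)
  qed
  then show ?thesis
    using v0 unfolding C_def R_def by blast
qed

text \<open>The bridge from rational coefficients to an arbitrary abelian group \<open>'b\<close>:
  the hypothesis is used only through \<open>connected_dominating\<close>. For each prime the chase
  produces operators of lengths prime to it that kill \<open>(T - 1) d x\<close>, so this sequence
  is locally killed and vanishes.\<close>

lemma additive_invariant_of_trivial_action:
  fixes \<phi> :: "'v word set \<Rightarrow> 'b::ab_group_add"
  assumes H1: "trivial_action_on_homology G N 1" and \<phi>: "additive_on NG \<phi>"
  shows "invariant \<phi>"
proof -
  have \<phi>m: "\<phi> (x \<otimes> y) = \<phi> x + \<phi> y" if "x \<in> N" "y \<in> N" for x y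
    using \<phi> that by (simp add: additive_on_NG)
  define d where "d = orb \<phi>"
  have dm: "d (g \<otimes> h) i = d g i + d h (i + \<chi> g)" if "g \<in> carrier G" "h \<in> carrier G" for g h i
    using that by (simp add: d_def orb_def cj_nrm_mult \<phi>m)
  \<comment> \<open>Commutation of two generators equates the results of \<open>T^m - 1\<close> for
    their heights \<open>m\<close>. Passing to \<open>(T - 1) d\<close> leaves \<open>geo m\<close>
    instead.\<close>
  define e where "e v = (\<lambda>i. d (sgen v) (i + 1) - d (sgen v) i)" for v
  have geo_e: "geo n (e v) = (\<lambda>i. d (sgen v) (i + int n) - d (sgen v) i)" for n v
    unfolding e_def by (rule geo_telescope)
  have edge: "geo (ht v) (e w) = geo (ht w) (e v)" if vw: "adj v w" for v w
  proof
    fix i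
    have V: "v \<in> V" "w \<in> V" using adj_V[OF vw] by auto
    have "d (sgen v) i + d (sgen w) (i + int (ht v)) = d (sgen w) i + d (sgen v) (i + int (ht w))"
      using dm[of "sgen v" "sgen w" i] dm[of "sgen w" "sgen v" i] sgen_commute[OF vw] V
      by (simp del: of_nat_nat)
    then have "d (sgen w) (i + int (ht v)) - d (sgen w) i = d (sgen v) (i + int (ht w)) - d (sgen v) i"
      by (rule add_eq_swap)
    then show "geo (ht v) (e w) i = geo (ht w) (e v) i"
      unfolding geo_e .
  qed
  have killed: "locally_killed (\<lambda>i. d x (i + 1) - d x i)" if x: "x \<in> N" for x
    unfolding locally_killed_def
  proof (intro allI impI)
    fix p :: nat assume p: "Factorial_Ring.prime p"
    obtain v0 where v0: "v0 \<in> W p" and reach: "\<And>u. u \<in> V \<Longrightarrow>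
        \<exists>w. (v0, w) \<in> {(v, w). v \<in> W p \<and> w \<in> W p \<and> adj v w}\<^sup>* \<and> (w = u \<or> adj w u)"
      using connected_dominating[OF H1 p] by blast
    obtain ws where ws: "set ws \<subseteq> W p" and zero: "\<And>u. u \<in> V \<Longrightarrow>
        foldr (\<lambda>v. geo (ht v)) ws (geo (ht v0) (e u) - geo (ht u) (e v0)) = 0"
      using connected_dominating_chase[where f = "\<lambda>v. geo (ht v)" and adj = "\<lambda>v w. adj v w" and e = e,
          OF geo_diff geo_commute edge v0 finite_V reach] by blast
    let ?cs = "map (\<lambda>v. ht v) ws"
    have foldr_cs: "foldr geo ?cs = foldr (\<lambda>v. geo (ht v)) ws"
      by (induction ws) (simp_all only: list.map foldr.simps)
    \<comment> \<open>On generators this is the difference treated by the chase. On \<open>N\<close>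
      the second part drops out because \<open>\<chi>\<close> is 0 there, leaving
      \<open>T^m - 1\<close> applied to \<open>d x\<close> with \<open>m\<close> the height of
      \<open>v0\<close>.\<close>
    define D where "D g = (\<lambda>i. d g (i + int (ht v0)) - d g i - (d (sgen v0) (i + \<chi> g) - d (sgen v0) i))" for g
    have D_mult: "D (g \<otimes> h) = D g + (\<lambda>i. D h (i + \<chi> g))" if "g \<in> carrier G" "h \<in> carrier G" for g h
      using that by (simp add: D_def dm chi_mult fun_eq_iff algebra_simps del: of_nat_nat)
    have "foldr geo ?cs (D x) = 0"
    proof (rule derivation_vanishes[where act = "\<lambda>g y i. y (i + \<chi> g)"])
      fix g h assume "g \<in> carrier G" "h \<in> carrier G"
      then show "foldr geo ?cs (D (g \<otimes> h)) = foldr geo ?cs (D g) + (\<lambda>i. foldr geo ?cs (D h) (i + \<chi> g))"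
        by (simp only: D_mult foldr_geo_add foldr_geo_shift)
    next
      fix g and y :: "int \<Rightarrow> 'b" assume y: "(\<lambda>i. y (i + \<chi> g)) = 0"
      show "y = 0"
      proof
        fix i show "y i = 0 i"
          using fun_cong[OF y, of "i - \<chi> g"] by simp
      qed
    next
      fix v assume v: "v \<in> V"
      have "D (sgen v) = geo (ht v0) (e v) - geo (ht v) (e v0)"
        unfolding geo_e D_def chi_sgen[OF v] by (simp add: fun_eq_iff)
      then show "foldr geo ?cs (D (sgen v)) = 0"
        using zero[OF v] by (simp only: foldr_cs)
    qed (use x in \<open>simp_all add: fun_eq_iff\<close>)
    moreover have "D x = geo (ht v0) (\<lambda>i. d x (i + 1) - d x i)"
      using x unfolding geo_telescope by (simp add: D_def mem_N fun_eq_iff)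
    ultimately have "foldr geo (?cs @ [ht v0]) (\<lambda>i. d x (i + 1) - d x i) = 0"
      by simp
    moreover have "\<forall>c \<in> set (?cs @ [ht v0]). \<not> p dvd c"
      using ws v0 by (auto simp: W_def)
    ultimately show "\<exists>cs. (\<forall>c \<in> set cs. \<not> p dvd c) \<and> foldr geo cs (\<lambda>i. d x (i + 1) - d x i) = 0"
      by blast
  qed
  have "\<phi> (cj 1 x) = \<phi> x" if x: "x \<in> N" for x
    using fun_cong[OF locally_killed_zero[OF killed[OF x]], of 0] x by (simp add: d_def orb_def)
  then show ?thesis by (simp add: invariant_def)
qed

text \<open>The units of \<open>'k\<close> may have torsion, so invariance of complex homomorphisms
  says nothing here; the result for arbitrary abelian groups is applied to
  \<open>kunit\<close>.\<close>

lemma char_invariant: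
  fixes \<rho> :: "'v word set \<Rightarrow> 'k::field"
  assumes H1: "trivial_action_on_homology G N 1" and \<rho>: "mult_char NG \<rho>"
  shows "invariant \<rho>"
proof -
  define \<phi> where "\<phi> x = Abs_kunit (\<rho> x)" for x
  have nz: "\<rho> x \<noteq> 0" if "x \<in> N" for x
    using \<rho> that by (simp add: mult_char_def)
  then have Rep: "Rep_kunit (\<phi> x) = \<rho> x" if "x \<in> N" for x
    using that by (simp add: \<phi>_def Abs_kunit_inverse)
  have "additive_on NG \<phi>"
    unfolding additive_on_NG
  proof (intro ballI)
    fix x y assume xy: "x \<in> N" "y \<in> N"
    then have "\<rho> (x \<otimes> y) = \<rho> x * \<rho> y"
      using \<rho> by (simp add: mult_char_def)
    then show "\<phi> (x \<otimes> y) = \<phi> x + \<phi> y"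
      using xy by (simp add: plus_kunit_def Rep) (simp add: \<phi>_def)
  qed
  from additive_invariant_of_trivial_action[OF H1 this]
  show ?thesis
    unfolding invariant_def using Rep by (metis cj_N)
qed

text \<open>In the twisted setting commuting generators are related by operators
  \<open>s T^m - 1\<close>. Applied along a connected dominating set, their product sends the orbit
  of \<open>\<phi>\<close> at \<open>x\<close> in \<open>N\<close> to \<open>\<sigma> x - 1\<close>
  times a sequence that does not depend on \<open>x\<close>; its value at 0 is the constant of the
  principal derivation.\<close>

lemma polynomial_kills_derivation:
  fixes \<sigma> :: "'v word set \<Rightarrow> 'k::field"
  assumes H1: "trivial_action_on_homology G N 1" and \<sigma>: "mult_char NG \<sigma>" "invariant \<sigma>"
    and \<phi>: "derivation NG \<sigma> \<phi>"
  shows "\<exists>q. q \<noteq> 0 \<and> principal NG \<sigma> (\<lambda>x. \<Sum>i\<le>degree q. coeff q i * \<phi> (cj (int i) x))"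
proof -
  have \<phi>m: "\<phi> (x \<otimes> y) = \<phi> x + \<sigma> x * \<phi> y" if "x \<in> N" "y \<in> N" for x y
    using \<phi> that by (simp add: derivation_def)
  have \<sigma>m: "\<sigma> (x \<otimes> y) = \<sigma> x * \<sigma> y" "\<sigma> x \<noteq> 0" if "x \<in> N" "y \<in> N" for x y
    using \<sigma>(1) that by (auto simp: mult_char_def)
  define d where "d = orb \<phi>"
  have dm: "d (g \<otimes> h) i = d g i + \<sigma> (nrm g) * d h (i + \<chi> g)" if "g \<in> carrier G" "h \<in> carrier G" for g h i
    using that by (simp add: d_def orb_def cj_nrm_mult \<phi>m invariant_cj[OF \<sigma>(2)])
  define s where "s v = \<sigma> (nrm (sgen v))" for v
  let ?f = "\<lambda>v. twist (s v) (ht v)" and ?e = "\<lambda>v. d (sgen v)"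
  have edge: "?f v (?e w) = ?f w (?e v)" if vw: "adj v w" for v w
  proof
    fix i
    have V: "v \<in> V" "w \<in> V" using adj_V[OF vw] by auto
    have "d (sgen v) i + s v * d (sgen w) (i + int (ht v)) = d (sgen w) i + s w * d (sgen v) (i + int (ht w))"
      using dm[of "sgen v" "sgen w" i] dm[of "sgen w" "sgen v" i] sgen_commute[OF vw] V
      by (simp add: s_def del: of_nat_nat)
    then show "?f v (?e w) i = ?f w (?e v) i"
      unfolding twist_def by (simp add: algebra_simps)
  qed
  \<comment> \<open>Any one prime would do: vertices of \<open>W 2\<close> have nonzero height, so
    their operators are nonzero polynomials in the shift.\<close>
  obtain v0 where v0: "v0 \<in> W 2" and reach: "\<And>u. u \<in> V \<Longrightarrow>
      \<exists>w. (v0, w) \<in> {(v, w). v \<in> W 2 \<and> w \<in> W 2 \<and> adj v w}\<^sup>* \<and> (w = u \<or> adj w u)"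
    using connected_dominating[OF H1 two_is_prime_nat] by blast
  obtain ws where ws: "set ws \<subseteq> W 2" and zero: "\<And>u. u \<in> V \<Longrightarrow>
      foldr ?f ws (?f v0 (?e u) - ?f u (?e v0)) = 0"
    using connected_dominating_chase[where f = ?f and adj = "\<lambda>v w. adj v w" and e = ?e,
        OF twist_diff twist_commute edge v0 finite_V reach] by blast
  have "s w \<noteq> 0 \<and> ht w > 0" if "w \<in> set (ws @ [v0])" for w
  proof -
    have "w \<in> V" "\<not> 2 dvd ht w" using ws v0 that by (auto simp: W_def)
    then show ?thesis
      using \<sigma>m(2)[of "nrm (sgen w)" \<one>] by (cases "ht w = 0") (auto simp: s_def)
  qed
  then obtain q where q: "q \<noteq> 0" "\<And>y i. foldr ?f (ws @ [v0]) y i = pact q y i"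
    using foldr_twist_pact[of "ws @ [v0]" s "\<lambda>v. ht v"] by blast
  \<comment> \<open>The defect between the derivation and the one forced by its value at
    \<open>sgen v0\<close>; on generators it is the difference treated by the chase.\<close>
  define D where "D g = ?f v0 (d g) - (\<lambda>i. \<sigma> (nrm g) * d (sgen v0) (i + \<chi> g) - d (sgen v0) i)" for g
  have D_mult: "D (g \<otimes> h) = D g + (\<lambda>i. \<sigma> (nrm g) * D h (i + \<chi> g))" if "g \<in> carrier G" "h \<in> carrier G" for g h
    using that by (simp add: D_def twist_def dm chi_mult nrm_mult \<sigma>m(1) invariant_cj[OF \<sigma>(2)]
        fun_eq_iff algebra_simps del: of_nat_nat)
  have D0: "foldr ?f ws (D x) = 0" if x: "x \<in> N" for x
  proof (rule derivation_vanishes[where act = "\<lambda>g y i. \<sigma> (nrm g) * y (i + \<chi> g)"])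
    fix g h assume "g \<in> carrier G" "h \<in> carrier G"
    then show "foldr ?f ws (D (g \<otimes> h)) =
        foldr ?f ws (D g) + (\<lambda>i. \<sigma> (nrm g) * foldr ?f ws (D h) (i + \<chi> g))"
      by (simp only: D_mult foldr_twist_add
          foldr_twist_shift[of s "\<lambda>v. ht v" ws "\<sigma> (nrm g)" "D h" "\<chi> g"])
  next
    fix g and y :: "int \<Rightarrow> 'k"
    assume g: "g \<in> carrier G" and y: "(\<lambda>i. \<sigma> (nrm g) * y (i + \<chi> g)) = 0"
    show "y = 0"
    proof
      fix i show "y i = 0 i"
        using fun_cong[OF y, of "i - \<chi> g"] \<sigma>m(2)[of "nrm g" \<one>] g by simp
    qed
  next
    fix v assume v: "v \<in> V"
    have "D (sgen v) = ?f v0 (?e v) - ?f v (?e v0)"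
      unfolding D_def chi_sgen[OF v] by (simp add: twist_def s_def)
    then show "foldr ?f ws (D (sgen v)) = 0"
      using zero[OF v] by (simp only:)
  qed (use x in \<open>simp_all add: fun_eq_iff\<close>)
  have "pact q (d x) 0 = (\<sigma> x - 1) * foldr ?f ws (?e v0) 0" if x: "x \<in> N" for x
  proof -
    \<comment> \<open>The summand \<open>i + 0\<close> gives the last term the shape that
      \<open>foldr_twist_shift\<close> expects.\<close>
    have "?f v0 (d x) = D x + (\<lambda>i. (\<sigma> x - 1) * d (sgen v0) (i + 0))"
      using x by (simp add: D_def mem_N[THEN iffD1] fun_eq_iff algebra_simps)
    then have "foldr ?f ws (?f v0 (d x)) = (\<lambda>i. (\<sigma> x - 1) * foldr ?f ws (?e v0) (i + 0))"
      by (simp only: foldr_twist_add D0[OF x] add_0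
          foldr_twist_shift[of s "\<lambda>v. ht v" ws "\<sigma> x - 1" "d (sgen v0)" 0])
    then show ?thesis
      using q(2)[of "d x" 0] by simp
  qed
  moreover have "pact q (d x) 0 = (\<Sum>i\<le>degree q. coeff q i * \<phi> (cj (int i) x))" if "x \<in> N" for x
    using that by (simp add: pact_def d_def orb_def)
  ultimately have "principal NG \<sigma> (\<lambda>x. \<Sum>i\<le>degree q. coeff q i * \<phi> (cj (int i) x))"
    unfolding principal_def by (intro exI[of _ "foldr ?f ws (?e v0) 0"]) simp
  then show ?thesis using q(1) by blast
qed

end

section \<open>Characteristic and resonance varieties of the kernel\<close>

lemma mult_char_cong:
  "mult_char H \<rho> \<Longrightarrow> group H \<Longrightarrow> (\<And>x. x \<in> carrier H \<Longrightarrow> \<rho> x = \<rho>' x) \<Longrightarrow> mult_char H \<rho>'"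
  unfolding mult_char_def by (metis group.is_monoid monoid.m_closed)

lemma derivation_cong:
  "derivation H \<sigma> d \<Longrightarrow> (\<And>x. x \<in> carrier H \<Longrightarrow> \<sigma> x = \<sigma>' x) \<Longrightarrow> derivation H \<sigma>' d"
  by (simp add: derivation_def)

lemma principal_cong:
  "principal H \<sigma> d \<Longrightarrow> (\<And>x. x \<in> carrier H \<Longrightarrow> \<sigma> x = \<sigma>' x) \<Longrightarrow> principal H \<sigma>' d"
  by (simp add: principal_def)

lemma mult_char_inverse: "mult_char H \<rho> \<Longrightarrow> mult_char H (\<lambda>x. inverse (\<rho> x))"
  by (simp add: mult_char_def)

lemma resonant_cong:
  assumes "resonant H a" "\<And>x. x \<in> carrier H \<Longrightarrow> a x = a' x"
  shows "resonant H a'"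
proof -
  obtain b f where "additive_on H b" "cup_exact H b a f" "\<not> (\<exists>c. \<forall>x \<in> carrier H. b x = c * a x)"
    using assms(1) unfolding resonant_def by blast
  then have "additive_on H b \<and> cup_exact H b a' f \<and> \<not> (\<exists>c. \<forall>x \<in> carrier H. b x = c * a' x)"
    using assms(2) by (simp add: cup_exact_def)
  then show ?thesis unfolding resonant_def by blast
qed

lemma additive_on_cong:
  "additive_on H b \<Longrightarrow> group H \<Longrightarrow> (\<And>x. x \<in> carrier H \<Longrightarrow> b x = b' x) \<Longrightarrow> additive_on H b'"
  unfolding additive_on_def by (metis group.is_monoid monoid.m_closed)

lemma char_variety_iff:
  assumes "group H"
  shows "\<rho> \<in> char_variety_1_1 H \<longleftrightarrow> mult_char H \<rho> \<and> \<rho> \<in> extensional (carrier H) \<and>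
    (\<exists>d. derivation H (\<lambda>x. inverse (\<rho> x)) d \<and> \<not> principal H (\<lambda>x. inverse (\<rho> x)) d)"
proof -
  have "\<rho> \<in> hom H units_group \<longleftrightarrow> mult_char H \<rho>"
    by (auto simp: hom_def units_group_def mult_char_def)
  then show ?thesis
    using homology1_nontrivial_iff[OF assms, of \<rho>] by (auto simp: char_variety_1_1_def Hom_def)
qed

lemma resonance_iff:
  assumes "group H"
  shows "h \<in> resonance_in_Hom H \<longleftrightarrow> additive_on H h \<and> h \<in> extensional (carrier H) \<and> resonant H h"
proof -
  have "h \<in> hom H complex_group \<longleftrightarrow> additive_on H h"
    by (auto simp: hom_def additive_group_def additive_on_def)
  then show ?thesis
    using resonance_in_Hom_iff[OF assms, of h] by (auto simp: Hom_def)
qed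

context raag_kernel
begin

text \<open>Restriction stays in the variety by \<open>nonprincipal_restrict\<close> when the
  character is nontrivial on \<open>N\<close>. For surjectivity, the inverse character is invariant,
  its derivation is killed modulo principal ones by a polynomial in \<open>\<tau>\<close>, and the
  resulting extension is inverted back.\<close>

lemma char_variety_kernel:
  assumes card: "card V > 1" and H1: "trivial_action_on_homology G N 1"
  shows "(\<lambda>\<rho>. restrict \<rho> N) ` char_variety_1_1 G =
    (char_variety_1_1 NG :: ('v word set \<Rightarrow> 'k::alg_closed_field) set)"
proof (intro equalityI subsetI)
  fix \<rho>' :: "'v word set \<Rightarrow> 'k" assume "\<rho>' \<in> (\<lambda>\<rho>. restrict \<rho> N) ` char_variety_1_1 G"
  then obtain \<rho> where \<rho>': "\<rho>' = restrict \<rho> N" and V\<rho>: "\<rho> \<in> char_variety_1_1 G"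
    by (rule imageE)
  then have \<rho>: "mult_char G \<rho>"
    unfolding char_variety_iff[OF is_group] by simp
  obtain d where d: "derivation G (\<lambda>x. inverse (\<rho> x)) d" "\<not> principal G (\<lambda>x. inverse (\<rho> x)) d"
    using V\<rho> unfolding char_variety_iff[OF is_group] by (elim conjE exE)
  have "\<exists>d. derivation NG (\<lambda>x. inverse (\<rho> x)) d \<and> \<not> principal NG (\<lambda>x. inverse (\<rho> x)) d"
  proof (cases "\<exists>x \<in> N. \<rho> x \<noteq> 1")
    case True
    then obtain x where x: "x \<in> N" "inverse (\<rho> x) \<noteq> 1" by auto
    show ?thesis
      using nonprincipal_restrict[OF mult_char_inverse[OF \<rho>] d x] by blast
  next
    case False
    \<comment> \<open>On \<open>N\<close> the coefficients are now untwisted, and the derivation of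
      \<open>G\<close> may restrict to 0; a nonzero homomorphism replaces it.\<close>
    obtain b :: "'v word set \<Rightarrow> 'k" and x where b: "additive_on G b" "x \<in> N" "b x \<noteq> 0"
      using nonzero_additive[OF card] by blast
    have "derivation NG (\<lambda>x. inverse (\<rho> x)) b"
      using b(1) False by (simp add: derivation_def additive_on_def)
    moreover have "\<not> principal NG (\<lambda>x. inverse (\<rho> x)) b"
      using b(2,3) False by (auto simp: principal_def)
    ultimately show ?thesis by blast
  qed
  then obtain d' where d': "derivation NG (\<lambda>x. inverse (\<rho> x)) d'" "\<not> principal NG (\<lambda>x. inverse (\<rho> x)) d'"
    by blast
  have "mult_char NG \<rho>'"
    by (rule mult_char_cong[OF mult_char_NG[OF \<rho>] group_NG]) (simp add: \<rho>')
  moreover have "derivation NG (\<lambda>x. inverse (\<rho>' x)) d'"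
    by (rule derivation_cong[OF d'(1)]) (simp add: \<rho>')
  moreover have "\<not> principal NG (\<lambda>x. inverse (\<rho>' x)) d'"
    using d'(2) principal_cong[of NG "\<lambda>x. inverse (\<rho>' x)" d' "\<lambda>x. inverse (\<rho> x)"] by (auto simp: \<rho>')
  ultimately show "\<rho>' \<in> char_variety_1_1 NG"
    unfolding char_variety_iff[OF group_NG] by (auto simp: \<rho>')
next
  fix \<rho> :: "'v word set \<Rightarrow> 'k" assume "\<rho> \<in> char_variety_1_1 NG"
  then obtain \<phi> where \<rho>: "mult_char NG \<rho>" "\<rho> \<in> extensional N"
    and \<phi>: "derivation NG (\<lambda>x. inverse (\<rho> x)) \<phi>" "\<not> principal NG (\<lambda>x. inverse (\<rho> x)) \<phi>"
    unfolding char_variety_iff[OF group_NG] by auto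
  note \<sigma> = mult_char_inverse[OF \<rho>(1)]
  note inv = char_invariant[OF H1 \<sigma>]
  obtain q where q: "q \<noteq> 0"
    "principal NG (\<lambda>x. inverse (\<rho> x)) (\<lambda>x. \<Sum>i\<le>degree q. coeff q i * \<phi> (cj (int i) x))"
    using polynomial_kills_derivation[OF H1 \<sigma> inv \<phi>(1)] by blast
  obtain \<sigma>' \<delta> where \<sigma>': "mult_char G \<sigma>'" "\<And>x. x \<in> N \<Longrightarrow> \<sigma>' x = inverse (\<rho> x)"
    and \<delta>: "derivation G \<sigma>' \<delta>" "\<not> principal G \<sigma>' \<delta>"
    using nonprincipal_extend[OF \<sigma> inv \<phi> q] by blast
  \<comment> \<open>The extension was built for the inverse of \<open>\<rho>\<close>, so its inverse
    is the character that restricts to \<open>\<rho>\<close>.\<close>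
  define R where "R = restrict (\<lambda>x. inverse (\<sigma>' x)) (carrier G)"
  have R: "inverse (R x) = \<sigma>' x" if "x \<in> carrier G" for x
    using that by (simp add: R_def)
  have "mult_char G R"
    by (rule mult_char_cong[OF mult_char_inverse[OF \<sigma>'(1)] is_group]) (simp add: R_def)
  moreover have "derivation G (\<lambda>x. inverse (R x)) \<delta>"
    by (rule derivation_cong[OF \<delta>(1)]) (simp add: R)
  moreover have "\<not> principal G (\<lambda>x. inverse (R x)) \<delta>"
    using \<delta>(2) principal_cong[of G "\<lambda>x. inverse (R x)" \<delta> \<sigma>'] R by blast
  ultimately have "R \<in> char_variety_1_1 G"
    unfolding char_variety_iff[OF is_group] by (auto simp: R_def)
  moreover have "restrict R N = \<rho>"
  proof
    fix x show "restrict R N x = \<rho> x"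
      using \<rho>(2) \<sigma>'(2)[of x] by (cases "x \<in> N") (simp_all add: R_def extensional_def)
  qed
  ultimately show "\<rho> \<in> (\<lambda>\<rho>. restrict \<rho> N) ` char_variety_1_1 G"
    by (intro image_eqI[of _ _ R]) simp_all
qed

lemma resonance_kernel:
  assumes card: "card V > 1" and H1: "trivial_action_on_homology G N 1"
    and H2: "trivial_action_on_homology G N 2"
  shows "(\<lambda>h. restrict h N) ` resonance_in_Hom G = resonance_in_Hom NG"
proof (intro equalityI subsetI)
  fix h' assume "h' \<in> (\<lambda>h. restrict h N) ` resonance_in_Hom G"
  then obtain h where h': "h' = restrict h N" and "h \<in> resonance_in_Hom G"
    by (rule imageE)
  then have h: "additive_on G h" "resonant G h"
    unfolding resonance_iff[OF is_group] by simp_all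
  obtain b :: "'v word set \<Rightarrow> complex" and x where b: "additive_on G b" "x \<in> N" "b x \<noteq> 0"
    using nonzero_additive[OF card] by blast
  have NG: "additive_on NG w" if "additive_on G w" for w :: "'v word set \<Rightarrow> complex"
    using that by (simp add: additive_on_def)
  have "resonant NG h"
    using resonant_restrict[OF H1 NG[OF b(1)] _ h] b(2,3) by blast
  then have "resonant NG h'"
    by (rule resonant_cong) (simp add: h')
  moreover have "additive_on NG h'"
    by (rule additive_on_cong[OF NG[OF h(1)] group_NG]) (simp add: h')
  ultimately show "h' \<in> resonance_in_Hom NG"
    unfolding resonance_iff[OF group_NG] by (auto simp: h')
next
  fix a assume "a \<in> resonance_in_Hom NG"
  then have a: "additive_on NG a" "a \<in> extensional N" "resonant NG a"
    unfolding resonance_iff[OF group_NG] by auto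
  have "\<exists>A. additive_on G A \<and> resonant G A \<and> (\<forall>x \<in> N. A x = a x)"
  proof (rule resonant_extend[OF H1 H2 _ _ _ a(1,3)])
    show "finite ((\<lambda>v. nrm (sgen v)) ` V)"
      using finite_V by simp
    show "(\<lambda>v. nrm (sgen v)) ` V \<subseteq> N"
      by auto
    show "w x = 0"
      if "additive_on NG w" "invariant w" "\<And>s. s \<in> (\<lambda>v. nrm (sgen v)) ` V \<Longrightarrow> w s = 0" "x \<in> N"
      for w :: "'v word set \<Rightarrow> complex" and x
      by (rule invariant_additive_detect[OF that(1,2) _ that(4)]) (rule that(3), rule imageI)
  qed
  then obtain A where A: "additive_on G A" "resonant G A" "\<And>x. x \<in> N \<Longrightarrow> A x = a x"
    by blast
  define R where "R = restrict A (carrier G)"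
  have "additive_on G R"
    by (rule additive_on_cong[OF A(1) is_group]) (simp add: R_def)
  moreover have "resonant G R"
    by (rule resonant_cong[OF A(2)]) (simp add: R_def)
  ultimately have "R \<in> resonance_in_Hom G"
    unfolding resonance_iff[OF is_group] by (simp add: R_def)
  moreover have "restrict R N = a"
  proof
    fix x show "restrict R N x = a x"
      using a(2) A(3)[of x] by (cases "x \<in> N") (simp_all add: R_def extensional_def)
  qed
  ultimately show "a \<in> (\<lambda>h. restrict h N) ` resonance_in_Hom G"
    by (intro image_eqI[of _ _ R]) simp_all
qed

end

theorem theorem15p6:
  fixes V :: "'v set" and L :: "'v set set"
    and \<chi> :: "'v word set \<Rightarrow> int"
    and G :: "'v word set monoid" and N :: "'v word set set"
    and N_grp :: "'v word set monoid"
  assumes "finite_simplicial_complex_on L V" and "card V > 1"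
    and "G = raag V L"
    and "\<chi> \<in> epi G integer_group"
    and "N = kernel G integer_group \<chi>"
    and "N_grp = G\<lparr>carrier := N\<rparr>"
  shows
    "(trivial_action_on_homology G N 1 \<longrightarrow>
        (\<lambda>\<rho>. restrict \<rho> N) ` char_variety_1_1 G
          = (char_variety_1_1 N_grp :: ('v word set \<Rightarrow> 'k::alg_closed_field) set))
     \<and>
     (trivial_action_on_homology G N 1 \<and> trivial_action_on_homology G N 2 \<longrightarrow>
        (\<lambda>h. restrict h N) ` resonance_in_Hom G = resonance_in_Hom N_grp)"
proof -
  have hom: "\<chi> \<in> hom G integer_group" and "\<chi> ` carrier G = UNIV"
    using assms(4) by (auto simp: epi_def)
  then obtain \<tau> where \<tau>: "\<tau> \<in> carrier G" "\<chi> \<tau> = 1"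
    by (metis UNIV_I imageE)
  have "group G"
    unfolding assms(3) by (rule group_raag)
  then interpret K: raag_kernel G \<chi> \<tau> V L
    using hom \<tau> assms(1,3)
    by (intro raag_kernel.intro int_extension.intro int_extension_axioms.intro raag_kernel_axioms.intro)
      (auto dest: hom_mult)
  have N: "N = K.N"
    unfolding assms(5) K.N_def kernel_def by simp
  show ?thesis
    unfolding assms(6) N using K.char_variety_kernel[OF assms(2)] K.resonance_kernel[OF assms(2)] by blast
qed

end
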